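(* For $\nu>0$ and $0<x<\infty$ write $J_{i\nu}(\nu x)=R(\nu,x)\,e^{i\Theta(\nu,x)}$ with $R(\nu,x)=|J_{i\nu}(\nu x)|$ and $\Theta(\nu,x)=\arg\{J_{i\nu}(\nu x)\}$. Then $$R(\nu,x)\sim\frac{1}{(2\pi\nu)^{1/2}(x^2+1)^{1/4}}\exp\left\{\frac{\nu\pi}{2}+\sum_{s=1}^\infty\frac{\hat{\mathrm{E}}_{2s}(\hat\beta)}{\nu^{2s}}\right\}$$ and $$\Theta(\nu,x)\sim\nu\rho(x)-\frac{\pi}{4}+\sum_{s=0}^\infty\frac{\hat{\mathrm{E}}_{2s+1}(\hat\beta)}{\nu^{2s+1}}$$ as $\nu\to\infty$, uniformly for $0<x<\infty$.
   Context: $J_{i\nu}$ is the Bessel function of the first kind of imaginary order $i\nu$. The argument $\Theta(\nu,x)$ is taken to be continuous in $x$, on the branch for which $\Theta(\nu,x)=\nu\ln(\frac12x)+\nu-\frac14\pi+\mathcal{O}(\nu x^2)+\mathcal{O}(\nu^{-1})$ as $\nu x\to0^+$ and $\nu\to\infty$. Definitions: $$\rho(x)=(x^2+1)^{1/2}-\ln\left\{\frac{1+(x^2+1)^{1/2}}{x}\right\},\qquad\hat\beta=(1+x^2)^{-1/2},$$ $$\hat{\mathrm{E}}_{2s}(\hat\beta)=\mathrm{E}_{2s}(-i\hat\beta),\qquad\hat{\mathrm{E}}_{2s+1}(\hat\beta)=-i\,\mathrm{E}_{2s+1}(-i\hat\beta)$$ (all real), where the polynomials $\mathrm{E}_s$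 are given by $\mathrm{E}_1(\beta)=\frac1{24}\beta(5\beta^2+3)$, $\mathrm{E}_2(\beta)=\frac1{16}\beta^2(5\beta^2+1)(\beta^2+1)$, and for $s=2,3,4,\ldots$ $$\mathrm{E}_{s+1}(\beta)=\tfrac12\beta^2(\beta^2+1)\mathrm{E}_s'(\beta)+\tfrac12\int_0^\beta p^2(p^2+1)\sum_{j=1}^{s-1}\mathrm{E}_j'(p)\mathrm{E}_{s-j}'(p)\,dp.$$ The symbol $\sim$ is in the Poincaré sense in inverse powers of $\nu$ (for $R$, applied to the series in the exponent): for each $N$, truncating the series after finitely many terms leaves an error of the order of the first omitted power of $\nu^{-1}$, uniformly in $x$. *)

theory Defs
  imports "HOL-Analysis.Analysis" "HOL-Computational_Algebra.Polynomial"
begin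

text \<open>The principal power is used for the prefactor; the reciprocal Gamma function is entire,
  so the series makes sense for every complex order.\<close>

definition bessel_J :: "complex \<Rightarrow> complex \<Rightarrow> complex" where
  "bessel_J \<mu> z =
     (z / 2) powr \<mu> * (\<Sum>k. (-1) ^ k * rGamma (\<mu> + of_nat k + 1) / fact k * (z / 2) ^ (2 * k))"

definition rho :: "real \<Rightarrow> real" where
  "rho x = sqrt (x\<^sup>2 + 1) - ln ((1 + sqrt (x\<^sup>2 + 1)) / x)"

definition beta_hat :: "real \<Rightarrow> real" where
  "beta_hat x = 1 / sqrt (1 + x\<^sup>2)"

definition poly_integral :: "real poly \<Rightarrow> real poly" where
  "poly_integral p = (\<Sum>i\<le>degree p. monom (coeff p i / of_nat (Suc i)) (Suc i))"

lemma coeff_poly_integral: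
  "coeff (poly_integral p) n = (if n = 0 then 0 else coeff p (n - 1) / of_nat n)"
proof (cases n)
  case 0
  then show ?thesis by (simp add: poly_integral_def coeff_sum)
next
  case (Suc m)
  have "coeff (poly_integral p) n =
      (\<Sum>i\<le>degree p. if i = m then coeff p i / of_nat (Suc i) else 0)"
    unfolding poly_integral_def coeff_sum by (rule sum.cong) (auto simp: Suc)
  also have "\<dots> = coeff p m / of_nat (Suc m)"
    by (auto simp: sum.delta coeff_eq_0)
  finally show ?thesis using Suc by simp
qed

lemma pderiv_poly_integral: "pderiv (poly_integral p) = p"
  by (rule poly_eqI) (simp add: coeff_pderiv coeff_poly_integral)

lemma poly_integral_has_integral:
  assumes "0 \<le> b"
  shows "(poly p has_integral poly (poly_integral p) b) {0..b}"
proof -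
  have "(poly p has_integral poly (poly_integral p) b - poly (poly_integral p) 0) {0..b}"
    using assms poly_DERIV[of "poly_integral p"]
    by (intro fundamental_theorem_of_calculus)
       (auto simp: pderiv_poly_integral has_real_derivative_iff_has_vector_derivative
             intro: has_vector_derivative_at_within)
  then show ?thesis by (simp add: poly_0_coeff_0 coeff_poly_integral)
qed

text \<open>The polynomials are indexed from 1; the value at index 0 is a dummy.\<close>

fun E_poly :: "nat \<Rightarrow> real poly" where
  "E_poly 0 = 0"
| "E_poly (Suc 0) = smult (1/24) ([:0, 1:] * [:3, 0, 5:])"
| "E_poly (Suc (Suc 0)) = smult (1/16) ([:0, 1:]^2 * [:1, 0, 5:] * [:1, 0, 1:])"
| "E_poly (Suc (Suc (Suc n))) =
     smult (1/2) ([:0, 1:]^2 * [:1, 0, 1:] * pderiv (E_poly (Suc (Suc n)))) +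
     smult (1/2) (poly_integral ([:0, 1:]^2 * [:1, 0, 1:] *
       (\<Sum>j = 1..<Suc (Suc n). pderiv (E_poly j) * pderiv (E_poly (Suc (Suc n) - j)))))"

definition E_fun :: "nat \<Rightarrow> complex \<Rightarrow> complex" where
  "E_fun s z = poly (map_poly of_real (E_poly s)) z"

text \<open>The complex numbers whose real parts are taken here are real: see \<open>of_real_E_hat\<close> below.\<close>

definition E_hat :: "nat \<Rightarrow> real \<Rightarrow> real" where
  "E_hat s b =
     Re (if even s then E_fun s (- \<i> * of_real b) else - \<i> * E_fun s (- \<i> * of_real b))"

definition has_parity :: "nat \<Rightarrow> real poly \<Rightarrow> bool" where
  "has_parity n p \<longleftrightarrow> (\<forall>k. coeff p k \<noteq> 0 \<longrightarrow> even (k + n))"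

lemma has_parity_add: "has_parity n p \<Longrightarrow> has_parity n q \<Longrightarrow> has_parity n (p + q)"
  unfolding has_parity_def coeff_add
proof (intro allI impI)
  fix k assume "\<forall>k. coeff p k \<noteq> 0 \<longrightarrow> even (k + n)" "\<forall>k. coeff q k \<noteq> 0 \<longrightarrow> even (k + n)"
    and "coeff p k + coeff q k \<noteq> 0"
  then show "even (k + n)" by (cases "coeff p k = 0") (simp_all del: even_add)
qed

lemma has_parity_smult: "has_parity n p \<Longrightarrow> has_parity n (smult c p)"
  by (auto simp: has_parity_def)

lemma has_parity_sum: "(\<And>i. i \<in> A \<Longrightarrow> has_parity n (f i)) \<Longrightarrow> has_parity n (\<Sum>i\<in>A. f i)"
proof (induction A rule: infinite_finite_induct)
  case (insert x A)
  have "has_parity n (f x + sum f A)"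
    by (intro has_parity_add insert.IH insert.prems insertI1 insertI2)
  then show ?case by (simp only: sum.insert[OF insert.hyps])
qed (simp_all add: has_parity_def)

lemma has_parity_mult: "has_parity n p \<Longrightarrow> has_parity m q \<Longrightarrow> has_parity (n + m) (p * q)"
  unfolding has_parity_def
proof (intro allI impI)
  fix k assume p: "\<forall>k. coeff p k \<noteq> 0 \<longrightarrow> even (k + n)" and q: "\<forall>k. coeff q k \<noteq> 0 \<longrightarrow> even (k + m)"
    and nz: "coeff (p * q) k \<noteq> 0"
  have "\<exists>i\<in>{..k}. coeff p i * coeff q (k - i) \<noteq> 0"
  proof (rule ccontr)
    assume "\<not> ?thesis"
    then have "\<And>i. i \<in> {..k} \<Longrightarrow> coeff p i * coeff q (k - i) = 0" by blast
    then show False using nz unfolding coeff_mult by (simp only: sum.neutral_const cong: sum.cong)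
  qed
  then obtain i where i: "i \<le> k" "coeff p i * coeff q (k - i) \<noteq> 0"
    by auto
  then have "even (i + n)" "even (k - i + m)"
    using p[rule_format, of i] q[rule_format, of "k - i"] by (simp_all del: even_add)
  then have "even ((i + n) + (k - i + m))" by (rule dvd_add)
  then show "even (k + (n + m))" using i(1) by (simp add: algebra_simps)
qed

lemma has_parity_pderiv: "has_parity n p \<Longrightarrow> has_parity (Suc n) (pderiv p)"
  by (auto simp: has_parity_def coeff_pderiv)

lemma has_parity_integral: "has_parity n p \<Longrightarrow> has_parity (Suc n) (poly_integral p)"
  unfolding has_parity_def coeff_poly_integral
proof (intro allI impI)
  fix k assume p: "\<forall>k. coeff p k \<noteq> 0 \<longrightarrow> even (k + n)"
    and "(if k = 0 then 0 else coeff p (k - 1) / real k) \<noteq> 0"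
  then obtain m where "k = Suc m" "coeff p m \<noteq> 0" by (cases k) auto
  then show "even (k + Suc n)" using p by auto
qed

lemma has_parity_cong: "has_parity n p \<Longrightarrow> even (n + m) \<Longrightarrow> has_parity m p"
  by (auto simp: has_parity_def)

lemma has_parity_E_poly: "has_parity s (E_poly s)"
proof (induction s rule: less_induct)
  case (less s)
  have X: "has_parity (Suc 0) [:0, 1:]" and X2: "has_parity 0 ([:0, 1:]^2)"
    and q: "has_parity 0 [:c, 0, d:]" for c d
    by (auto simp: has_parity_def coeff_pCons power2_eq_square split: nat.splits)
  consider "s = 0" | "s = 1" | "s = 2" | n where "s = Suc (Suc (Suc n))"
    by (metis One_nat_def Suc_1 not0_implies_Suc)
  then show ?case
  proof cases
    case 1
    then show ?thesis by (simp add: has_parity_def)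
  next
    case 2
    have "has_parity (Suc 0 + 0) (E_poly (Suc 0))"
      unfolding E_poly.simps by (intro has_parity_smult has_parity_mult X q)
    then show ?thesis using 2 by (simp only: One_nat_def add_0_right)
  next
    case 3
    have "has_parity (0 + 0 + 0) (E_poly (Suc (Suc 0)))"
      unfolding E_poly.simps by (intro has_parity_smult has_parity_mult X2 q)
    then have "has_parity (Suc (Suc 0)) (E_poly (Suc (Suc 0)))"
      by (rule has_parity_cong) simp
    then show ?thesis using 3 by (simp only: numeral_2_eq_2)
  next
    case (4 n)
    let ?W = "[:0, 1:]^2 * [:1, 0, 1:] :: real poly"
    let ?S = "\<Sum>j = 1..<Suc (Suc n). pderiv (E_poly j) * pderiv (E_poly (Suc (Suc n) - j))"
    have W: "has_parity 0 ?W" using has_parity_mult[OF X2 q] by (simp only: add_0)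
    have a: "has_parity s (?W * pderiv (E_poly (Suc (Suc n))))"
      using has_parity_mult[OF W has_parity_pderiv[OF less.IH[of "Suc (Suc n)"]]] 4
      by (simp only: add_0 lessI)
    have "has_parity n ?S"
    proof (rule has_parity_sum)
      fix j assume j: "j \<in> {1..<Suc (Suc n)}"
      have "has_parity (Suc j + Suc (Suc (Suc n) - j))
              (pderiv (E_poly j) * pderiv (E_poly (Suc (Suc n) - j)))"
        using j 4 by (intro has_parity_mult has_parity_pderiv less.IH) auto
      then show "has_parity n (pderiv (E_poly j) * pderiv (E_poly (Suc (Suc n) - j)))"
        by (rule has_parity_cong) (use j in auto)
    qed
    then have "has_parity (Suc n) (poly_integral (?W * ?S))"
      using has_parity_integral[OF has_parity_mult[OF W]] by (simp only: add_0)
    then have "has_parity s (poly_integral (?W * ?S))"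
      by (rule has_parity_cong) (use 4 in auto)
    then have "has_parity s (E_poly (Suc (Suc (Suc n))))"
      unfolding E_poly.simps by (intro has_parity_add has_parity_smult a)
    then show ?thesis by (simp only: 4)
  qed
qed

lemma of_real_E_hat:
  "complex_of_real (E_hat s b) =
     (if even s then E_fun s (- \<i> * of_real b) else - \<i> * E_fun s (- \<i> * of_real b))"
proof -
  let ?c = "if even s then 1 else - \<i>"
  have "?c * E_fun s (- \<i> * of_real b) \<in> \<real>"
    unfolding E_fun_def poly_altdef sum_distrib_left
  proof (rule sum_in_Reals)
    fix k
    show "?c * (coeff (map_poly complex_of_real (E_poly s)) k * (- \<i> * of_real b) ^ k) \<in> \<real>"
    proof (cases "coeff (E_poly s) k = 0")
      case True
      then show ?thesis by (simp add: coeff_map_poly)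
    next
      case False
      then have e: "even (k + s)" using has_parity_E_poly by (auto simp: has_parity_def)
      have "?c * (- \<i>) ^ k \<in> \<real>"
      proof (cases "even s")
        case True
        then obtain m where "k = 2 * m" using e by (auto elim: evenE)
        then show ?thesis using True by (simp add: power_mult)
      next
        case False
        then have "odd k" using e by simp
        then obtain m where "k = 2 * m + 1" by (auto elim: oddE)
        then show ?thesis using False by (simp add: power_mult)
      qed
      then have "of_real (coeff (E_poly s) k) * of_real b ^ k * (?c * (- \<i>) ^ k) \<in> \<real>"
        by (rule Reals_mult[OF Reals_mult[OF Reals_of_real Reals_power[OF Reals_of_real]]])
      then show ?thesis
        by (simp only: coeff_map_poly of_real_0 power_mult_distrib mult_ac)
    qed
  qed
  then have "of_real (Re (?c * E_fun s (- \<i> * of_real b))) = ?c * E_fun s (- \<i> * of_real b)"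
    by (rule of_real_Re)
  then show ?thesis
    by (cases "even s") (simp_all only: E_hat_def if_True if_False mult_1_left)
qed

definition bessel_modulus :: "real \<Rightarrow> real \<Rightarrow> real" where
  "bessel_modulus \<nu> x = cmod (bessel_J (\<i> * of_real \<nu>) (of_real (\<nu> * x)))"

text \<open>The last conjunct selects the branch. Its two error terms
  \<open>\<O>(\<nu> x\<^sup>2)\<close> and \<open>\<O>(\<nu>\<^sup>-\<^sup>1)\<close> refer to the joint limit \<open>\<nu> x \<rightarrow> 0\<^sup>+\<close>, \<open>\<nu> \<rightarrow> \<infinity>\<close>.\<close>

definition is_bessel_phase :: "(real \<Rightarrow> real \<Rightarrow> real) \<Rightarrow> bool" where
  "is_bessel_phase \<Theta> \<longleftrightarrow>
     (\<forall>\<nu>>0. \<forall>x>0. bessel_J (\<i> * of_real \<nu>) (of_real (\<nu> * x)) =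
        of_real (bessel_modulus \<nu> x) * exp (\<i> * of_real (\<Theta> \<nu> x))) \<and>
     (\<forall>\<nu>>0. continuous_on {0<..} (\<Theta> \<nu>)) \<and>
     (\<exists>C. \<exists>\<delta>>0. \<exists>\<nu>0>0. \<forall>\<nu>\<ge>\<nu>0. \<forall>x>0. \<nu> * x \<le> \<delta> \<longrightarrow>
        \<bar>\<Theta> \<nu> x - (\<nu> * ln (x / 2) + \<nu> - pi / 4)\<bar> \<le> C * (\<nu> * x\<^sup>2 + 1 / \<nu>))"

end

theory Submission
  imports Defs "HOL-Real_Asymp.Real_Asymp"
begin

text \<open>
  Write \<open>w(x) = J\<^sub>i\<^sub>\<nu>(\<nu> x)\<close> and let \<open>A\<close> be the Liouville-Green expression truncated after \<open>M\<close> terms.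
  The recursion for the coefficients makes \<open>A\<close> a solution of Bessel's equation up to a relative error
  \<open>\<O>(\<nu>\<^sup>-\<^sup>M)\<close> that is integrable over \<open>0 < x < \<infinity>\<close>. Expanding \<open>w\<close> in \<open>A\<close> and its complex conjugate by
  variation of constants and applying Gronwall's inequality from \<open>x = 0\<close>, where \<open>w\<close> is asymptotically a
  multiple of \<open>A\<close>, gives \<open>w = h A (1 + \<O>(\<nu>\<^sup>-\<^sup>M\<^sup>-\<^sup>1))\<close> uniformly in \<open>x\<close> for some constant \<open>h\<close>.

  The value of \<open>h\<close> at \<open>x = 0\<close> would involve Stirling's series for \<open>\<Gamma>(1 + i \<nu>)\<close>, with coefficients to be matched
  against those of \<open>A\<close>. Instead, \<open>h\<close> is read off at infinity, where all the coefficients vanish: the weighted means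
  \<open>\<epsilon>\<^sup>1\<^sup>/\<^sup>2 \<integral> exp (- \<epsilon> t) exp (- i t) J\<^sub>i\<^sub>\<nu>(t) dt\<close> over \<open>t > 0\<close> have an exactly computable limit as \<open>\<epsilon> \<rightarrow> 0\<close>, because the
  Laplace transform of \<open>J\<^sub>\<mu>\<close> at \<open>p\<close> is \<open>(p + s)\<^sup>-\<^sup>\<mu> / s\<close> with \<open>s = (p\<^sup>2 + 1)\<^sup>1\<^sup>/\<^sup>2\<close>; and as the weights are positive,
  this limit differs from its value for \<open>h A\<close> by a relative error \<open>\<O>(\<nu>\<^sup>-\<^sup>M\<^sup>-\<^sup>1)\<close> only.
\<close>

section \<open>The Liouville-Green coefficients\<close>

text \<open>On the real half-line \<open>lg_approx\<close> and its conjugate have the same modulus,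
  so neither wave dominates and one Gronwall estimate covers all x at once. It starts at 0 because
  there the Bessel function and \<open>lg_approx\<close> both behave like constants times exp (i
  \<nu> ln x): the conjugate wave is absent. At infinity the conjugate wave is present, smaller by a
  factor exp (- \<pi> \<nu>). Hence sqrt t exp (- i t) J(t) oscillates without a limit, and h cannot
  be read off pointwise; the positive means smooth this oscillation away. Bessel's equation is used
  throughout in the form (x d/dx)^2 w = - \<nu>^2 (1 + x^2) w, which has no first-order term and
  stays regular at 0. A small relative error determines \<Theta> only modulo 2 \<pi>, and the branch
  condition speaks only of small \<nu> x. One point near 0 fixes the multiple of 2 \<pi>, and
  continuity carries it to all x.\<close>

definition cpoly :: "real poly \<Rightarrow> complex \<Rightarrow> complex" where
  "cpoly p z = poly (map_poly of_real p) z"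

lemma cpoly_0 [simp]: "cpoly 0 z = 0"
  by (simp add: cpoly_def)

lemma cpoly_pCons [simp]: "cpoly (pCons a p) z = of_real a + z * cpoly p z"
  by (simp add: cpoly_def map_poly_pCons)

lemma cpoly_1 [simp]: "cpoly 1 z = 1"
  by (simp add: one_pCons)

lemma cpoly_add [simp]: "cpoly (p + q) z = cpoly p z + cpoly q z"
proof -
  have "map_poly complex_of_real (p + q) = map_poly of_real p + map_poly of_real q"
    by (rule poly_eqI) (simp add: coeff_map_poly)
  then show ?thesis by (simp add: cpoly_def)
qed

lemma cpoly_smult [simp]: "cpoly (smult c p) z = of_real c * cpoly p z"
  by (simp add: cpoly_def map_poly_smult)

lemma cpoly_minus [simp]: "cpoly (- p) z = - cpoly p z"
  using cpoly_smult[of "-1" p z] by simp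

lemma cpoly_diff [simp]: "cpoly (p - q) z = cpoly p z - cpoly q z"
  using cpoly_add[of p "- q" z] by simp

lemma cpoly_mult [simp]: "cpoly (p * q) z = cpoly p z * cpoly q z"
  by (induction p) (simp_all add: algebra_simps)

lemma cpoly_power [simp]: "cpoly (p ^ n) z = cpoly p z ^ n"
  by (induction n) simp_all

lemma cpoly_sum: "cpoly (sum f A) z = (\<Sum>i\<in>A. cpoly (f i) z)"
  by (induction A rule: infinite_finite_induct) simp_all

lemma has_field_derivative_cpoly:
  "(cpoly p has_field_derivative cpoly (pderiv p) z) (at z)"
proof -
  have "pderiv (map_poly complex_of_real p) = map_poly of_real (pderiv p)"
    by (rule poly_eqI) (simp add: coeff_map_poly coeff_pderiv)
  then show ?thesis using poly_DERIV[of "map_poly of_real p" z] by (simp add: cpoly_def[abs_def])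
qed

lemma cpoly_bounded: "\<exists>C. \<forall>z. norm z \<le> 1 \<longrightarrow> norm (cpoly p z) \<le> C"
proof (induction p)
  case (pCons a p)
  then obtain C where C: "\<And>z. norm z \<le> 1 \<Longrightarrow> norm (cpoly p z) \<le> C" by auto
  have "norm (cpoly (pCons a p) z) \<le> \<bar>a\<bar> + C" if z: "norm z \<le> 1" for z
  proof -
    have "norm (z * cpoly p z) \<le> 1 * C"
      unfolding norm_mult using z C[OF z] by (intro mult_mono) auto
    moreover have "norm (of_real a + z * cpoly p z) \<le> norm (complex_of_real a) + norm (z * cpoly p z)"
      by (rule norm_triangle_ineq)
    ultimately show ?thesis by simp
  qed
  then show ?case by blast
qed auto

section \<open>The residual of the truncated expansion\<close>

text \<open>The factor p^2 (p^2 + 1) of the recursion. At \<open>lg_beta x\<close> it takes the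
  value - x^2 / (1 + x^2)^2, which links the polynomial identities with Bessel's equation.\<close>

definition lg_weight :: "real poly" where
  "lg_weight = [:0, 1:]\<^sup>2 * [:1, 0, 1:]"

lemma cpoly_lg_weight: "cpoly lg_weight z = z\<^sup>2 * (1 + z\<^sup>2)"
  by (simp add: lg_weight_def power2_eq_square)

text \<open>Differentiation removes the integral from the recursion. The resulting identity already
  starts at \<open>s = 1\<close>: the sum is then empty, and the explicit first two polynomials
  satisfy it.\<close>

lemma E_poly_recursion:
  assumes "s \<ge> 1"
  shows "smult 2 (pderiv (E_poly (Suc s))) = pderiv (lg_weight * pderiv (E_poly s)) +
    lg_weight * (\<Sum>j = 1..<s. pderiv (E_poly j) * pderiv (E_poly (s - j)))"
proof (cases "s = 1")
  case True
  then show ?thesis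
    by (simp add: lg_weight_def power2_eq_square pderiv_mult pderiv_pCons pderiv_smult)
next
  case False
  then obtain n where "s = Suc (Suc n)"
    using assms by (metis One_nat_def not0_implies_Suc not_one_le_zero)
  then show ?thesis
    by (simp only: E_poly.simps(4)[of n, folded lg_weight_def] pderiv_add pderiv_smult
        pderiv_poly_integral smult_add_right smult_smult) simp
qed

definition lg_phase :: "nat \<Rightarrow> real \<Rightarrow> real poly" where
  "lg_phase M \<nu> = (\<Sum>s=1..M. smult (1 / \<nu> ^ s) (E_poly s))"

text \<open>The defect in the Riccati equation for x A'(x) / A(x), up to the factor in
  \<open>lg_error\<close>. The term with \<open>E_poly 1\<close> is what the amplitude factor (1 +
  x^2)^(-1/4) contributes on its own.\<close>

definition lg_residual :: "nat \<Rightarrow> real \<Rightarrow> real poly" where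
  "lg_residual M \<nu> = smult (2 * \<nu>) (pderiv (lg_phase M \<nu>)) - lg_weight * (pderiv (lg_phase M \<nu>))\<^sup>2
     - pderiv (lg_weight * pderiv (lg_phase M \<nu>)) - smult 2 (pderiv (E_poly 1))"

lemma pderiv_sum: "pderiv (sum f A) = (\<Sum>i\<in>A. pderiv (f i))"
  by (induction A rule: infinite_finite_induct) (simp_all add: pderiv_add)

lemma smult_sum_poly: "smult c (sum f A) = (\<Sum>i\<in>A. smult c (f i))"
  by (induction A rule: infinite_finite_induct) (simp_all add: smult_add_right)

lemma pderiv_lg_phase: "pderiv (lg_phase M \<nu>) = (\<Sum>s=1..M. smult (1 / \<nu> ^ s) (pderiv (E_poly s)))"
  by (simp add: lg_phase_def pderiv_sum pderiv_smult)

text \<open>The recursion cancels every term of order below \<open>\<nu>\<^sup>-\<^sup>M\<close>.\<close>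

lemma lg_residual_eq:
  assumes "M \<ge> 1" "\<nu> > 0"
  shows "lg_residual M \<nu> = - smult (1 / \<nu> ^ M) (pderiv (lg_weight * pderiv (E_poly M)))
     - (\<Sum>(i, j)\<in>{(i, j). i \<in> {1..M} \<and> j \<in> {1..M} \<and> M \<le> i + j}.
          smult (1 / \<nu> ^ (i + j)) (lg_weight * (pderiv (E_poly i) * pderiv (E_poly j))))"
proof -
  define e where "e s = pderiv (E_poly s)" for s
  define F where "F = (\<lambda>(i, j). smult (1 / \<nu> ^ (i + j)) (lg_weight * (e i * e j)))"
  define I where "I = {(i, j). i \<in> {1..M} \<and> j \<in> {1..M} \<and> M \<le> i + j}"
  define I' where "I' = {(i, j). i \<in> {1..M} \<and> j \<in> {1..M} \<and> i + j < M}"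
  have P: "pderiv (lg_phase M \<nu>) = (\<Sum>s=1..M. smult (1 / \<nu> ^ s) (e s))"
    by (simp add: pderiv_lg_phase e_def)
  \<comment> \<open>The factor \<nu> lowers each order by one, so that \<open>e (Suc s)\<close>
    meets the terms of order s. The peeled-off term of order 0 cancels against
    \<open>E_poly 1\<close> in the residual.\<close>
  have t1: "smult (2 * \<nu>) (pderiv (lg_phase M \<nu>))
      = smult 2 (e 1) + (\<Sum>s=1..<M. smult (1 / \<nu> ^ s) (smult 2 (e (Suc s))))"
  proof -
    have "smult (2 * \<nu>) (pderiv (lg_phase M \<nu>)) = (\<Sum>s=1..M. smult (2 * \<nu> / \<nu> ^ s) (e s))"
      by (simp add: P smult_sum_poly)
    also have "\<dots> = smult (2 * \<nu> / \<nu> ^ 1) (e 1) + (\<Sum>s=Suc 1..M. smult (2 * \<nu> / \<nu> ^ s) (e s))"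
      using assms by (intro sum.atLeast_Suc_atMost) auto
    also have "(\<Sum>s=Suc 1..M. smult (2 * \<nu> / \<nu> ^ s) (e s)) =
        (\<Sum>s=1..<M. smult (2 * \<nu> / \<nu> ^ Suc s) (e (Suc s)))"
      using sum.shift_bounds_Suc_ivl[of "\<lambda>s. smult (2 * \<nu> / \<nu> ^ s) (e s)" 1 M]
      by (simp add: atLeastLessThanSuc_atLeastAtMost)
    finally show ?thesis using assms by (simp add: mult.commute)
  qed
  have t3: "pderiv (lg_weight * pderiv (lg_phase M \<nu>)) =
      (\<Sum>s=1..<M. smult (1 / \<nu> ^ s) (pderiv (lg_weight * e s))) + smult (1 / \<nu> ^ M) (pderiv (lg_weight * e M))"
  proof -
    have "pderiv (lg_weight * pderiv (lg_phase M \<nu>)) =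
      (\<Sum>s=1..M. smult (1 / \<nu> ^ s) (pderiv (lg_weight * e s)))"
      by (simp add: P sum_distrib_left pderiv_sum pderiv_smult)
    also have "{1..M} = insert M {1..<M}" using assms by auto
    finally show ?thesis by (simp add: add.commute)
  qed
  \<comment> \<open>The pairs in \<open>I'\<close> have total order below \<open>M\<close> and are
    consumed by the recursion; those in \<open>I\<close> survive.\<close>
  have t2: "lg_weight * (pderiv (lg_phase M \<nu>))\<^sup>2 = sum F I' + sum F I"
  proof -
    have "lg_weight * (pderiv (lg_phase M \<nu>))\<^sup>2 = sum F ({1..M} \<times> {1..M})"
    proof -
      have "sum F ({1..M} \<times> {1..M}) = (\<Sum>i=1..M. \<Sum>j=1..M. F (i, j))"
        by (simp add: sum.cartesian_product)
      also have "\<dots> = lg_weight * (\<Sum>i=1..M. \<Sum>j=1..M. smult (1 / \<nu> ^ i) (e i) * smult (1 / \<nu> ^ j) (e j))"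
        by (simp add: F_def sum_distrib_left power_add mult.commute)
      finally show ?thesis by (simp add: P power2_eq_square sum_product)
    qed
    also have "{1..M} \<times> {1..M} = I' \<union> I" by (auto simp: I_def I'_def)
    also have "sum F (I' \<union> I) = sum F I' + sum F I"
    proof (rule sum.union_disjoint)
      have "I \<subseteq> {1..M} \<times> {1..M}" "I' \<subseteq> {1..M} \<times> {1..M}" by (auto simp: I_def I'_def)
      then show "finite I'" "finite I" by (auto intro: finite_subset)
    qed (auto simp: I_def I'_def)
    finally show ?thesis .
  qed
  have t4: "sum F I' = (\<Sum>s=1..<M. smult (1 / \<nu> ^ s) (lg_weight * (\<Sum>j=1..<s. e j * e (s - j))))"
  proof -
    have "(\<Sum>s=1..<M. smult (1 / \<nu> ^ s) (lg_weight * (\<Sum>j=1..<s. e j * e (s - j)))) =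
       (\<Sum>s=1..<M. \<Sum>j=1..<s. F (j, s - j))"
      by (intro sum.cong) (auto simp: sum_distrib_left smult_sum_poly F_def intro!: sum.cong)
    also have "\<dots> = (\<Sum>(s, j)\<in>(SIGMA s:{1..<M}. {1..<s}). F (j, s - j))"
      by (rule sum.Sigma) auto
    also have "\<dots> = sum F I'"
      by (rule sum.reindex_bij_witness[where i="\<lambda>(i, j). (i + j, i)" and j="\<lambda>(s, j). (j, s - j)"])
         (auto simp: I'_def)
    finally show ?thesis by simp
  qed
  have t5: "(\<Sum>s=1..<M. smult (1 / \<nu> ^ s) (smult 2 (e (Suc s)))) =
      (\<Sum>s=1..<M. smult (1 / \<nu> ^ s) (pderiv (lg_weight * e s))) + sum F I'"
    unfolding t4 sum.distrib[symmetric]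
    by (intro sum.cong refl) (simp only: E_poly_recursion e_def smult_add_right atLeastLessThan_iff)
  show ?thesis
    unfolding lg_residual_def t1 t2 t3 t5 using F_def I_def by (simp add: e_def algebra_simps)
qed

text \<open>Every surviving order is at least \<open>M\<close>, and the coefficient polynomials are
  bounded on the unit disc, which contains all values of \<open>lg_beta\<close>. For
  \<open>M = 0\<close> only the constant term with \<open>E_poly 1\<close> is left.\<close>

lemma lg_residual_bound:
  "\<exists>C>0. \<forall>\<nu>\<ge>1. \<forall>z. norm z \<le> 1 \<longrightarrow> norm (cpoly (lg_residual M \<nu>) z) \<le> C / \<nu> ^ M"
proof -
  have ex: "\<exists>C. \<forall>z. norm z \<le> 1 \<longrightarrow> norm (cpoly p z) \<le> C" for p by (rule cpoly_bounded)
  define b where "b p = (SOME C. \<forall>z. norm z \<le> 1 \<longrightarrow> norm (cpoly p z) \<le> C)" for p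
  have b: "norm (cpoly p z) \<le> b p" if "norm z \<le> 1" for p z
    using someI_ex[OF ex[of p]] that unfolding b_def by blast
  have b0: "0 \<le> b p" for p using b[of 0 p] by (smt (verit) norm_ge_zero norm_zero)
  show ?thesis
  proof (cases "M = 0")
    case True
    then have *: "lg_residual M \<nu> = - smult 2 (pderiv (E_poly 1))" for \<nu>
      by (simp add: lg_residual_def lg_phase_def)
    show ?thesis
      using b[of _ "- smult 2 (pderiv (E_poly 1))"] b0[of "- smult 2 (pderiv (E_poly 1))"] True
      unfolding * by (intro exI[of _ "b (- smult 2 (pderiv (E_poly 1))) + 1"]) force
  next
    case False
    define I where "I = {(i, j). i \<in> {1..M} \<and> j \<in> {1..M} \<and> M \<le> i + j}"
    define Q where "Q = pderiv (lg_weight * pderiv (E_poly M))"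
    define R where "R = (\<lambda>i j. lg_weight * (pderiv (E_poly i) * pderiv (E_poly j)))"
    define C where "C = b Q + (\<Sum>(i,j)\<in>I. b (R i j)) + 1"
    have "norm (cpoly (lg_residual M \<nu>) z) \<le> C / \<nu> ^ M" if \<nu>: "\<nu> \<ge> 1" and z: "norm z \<le> 1" for \<nu> z
    proof -
      have pw: "norm (cpoly (smult (1 / \<nu> ^ k) p) z) \<le> b p / \<nu> ^ M" if "M \<le> k" for k p
      proof -
        have "norm (cpoly (smult (1 / \<nu> ^ k) p) z) = norm (cpoly p z) / \<nu> ^ k"
          using \<nu> by (simp add: norm_divide norm_power)
        also have "\<dots> \<le> b p / \<nu> ^ M"
          using b[OF z] b0 \<nu> that by (intro frac_le) (auto intro: power_increasing)
        finally show ?thesis .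
      qed
      have eq: "cpoly (lg_residual M \<nu>) z = - cpoly (smult (1 / \<nu> ^ M) Q) z
          - (\<Sum>(i,j)\<in>I. cpoly (smult (1 / \<nu> ^ (i + j)) (R i j)) z)"
        using lg_residual_eq[of M \<nu>] False \<nu>
        unfolding Q_def[symmetric] I_def[symmetric]
        unfolding R_def by (simp add: cpoly_sum case_prod_beta)
      have "norm (\<Sum>(i,j)\<in>I. cpoly (smult (1 / \<nu> ^ (i + j)) (R i j)) z) \<le> (\<Sum>(i,j)\<in>I. b (R i j) / \<nu> ^ M)"
        by (rule sum_norm_le) (auto simp: I_def simp del: cpoly_smult intro!: pw)
      then have "norm (cpoly (lg_residual M \<nu>) z) \<le> b Q / \<nu> ^ M + (\<Sum>(i,j)\<in>I. b (R i j) / \<nu> ^ M)"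
        unfolding eq using pw[of M Q]
        by (smt (verit, best) norm_minus_cancel norm_triangle_ineq4 order_refl)
      also have "\<dots> = (b Q + (\<Sum>(i,j)\<in>I. b (R i j))) / \<nu> ^ M"
        by (simp add: sum_divide_distrib add_divide_distrib case_prod_beta)
      also have "\<dots> \<le> C / \<nu> ^ M" using \<nu> by (intro divide_right_mono) (auto simp: C_def)
      finally show ?thesis .
    qed
    moreover have "C > 0" unfolding C_def using b0 by (intro add_nonneg_pos add_nonneg_nonneg sum_nonneg) auto
    ultimately show ?thesis by blast
  qed
qed

section \<open>Uniform size of the truncated phase\<close>

lemma inverse_power_sum_bound:
  "\<exists>C>0. \<forall>\<nu>\<ge>1. \<forall>z. norm z \<le> 1 \<longrightarrow> norm (cpoly (\<Sum>s=1..M. smult (1 / \<nu> ^ s) (f s)) z) \<le> C / \<nu>"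
proof -
  have "\<forall>s. \<exists>C. \<forall>z. norm z \<le> 1 \<longrightarrow> norm (cpoly (f s) z) \<le> C"
    using cpoly_bounded by blast
  then obtain b where b: "\<And>s z. norm z \<le> 1 \<Longrightarrow> norm (cpoly (f s) z) \<le> b s"
    by metis
  have b0: "0 \<le> b s" for s using b[of 0 s] by (smt (verit) norm_ge_zero norm_zero)
  have "norm (cpoly (\<Sum>s=1..M. smult (1 / \<nu> ^ s) (f s)) z) \<le> (sum b {1..M} + 1) / \<nu>"
    if \<nu>: "\<nu> \<ge> 1" and z: "norm z \<le> 1" for \<nu> z
  proof -
    have "norm (cpoly (\<Sum>s=1..M. smult (1 / \<nu> ^ s) (f s)) z) \<le> (\<Sum>s=1..M. b s / \<nu>)"
      unfolding cpoly_sum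
    proof (rule sum_norm_le)
      fix s assume s: "s \<in> {1..M}"
      have "norm (cpoly (smult (1 / \<nu> ^ s) (f s)) z) = norm (cpoly (f s) z) / \<nu> ^ s"
        using \<nu> by (simp add: norm_divide norm_power)
      also have "\<dots> \<le> b s / \<nu> ^ 1"
        using b[OF z] b0 \<nu> s by (intro frac_le power_increasing) auto
      finally show "norm (cpoly (smult (1 / \<nu> ^ s) (f s)) z) \<le> b s / \<nu>" by simp
    qed
    also have "\<dots> \<le> (sum b {1..M} + 1) / \<nu>" using \<nu> by (simp add: sum_divide_distrib[symmetric] divide_right_mono)
    finally show ?thesis .
  qed
  moreover have "sum b {1..M} + 1 > 0" using b0 by (intro add_nonneg_pos sum_nonneg) auto
  ultimately show ?thesis by blast
qed

lemma lg_phase_bound: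
  "\<exists>C>0. \<forall>\<nu>\<ge>1. \<forall>z. norm z \<le> 1 \<longrightarrow> norm (cpoly (lg_phase M \<nu>) z) \<le> C / \<nu>"
  unfolding lg_phase_def by (rule inverse_power_sum_bound)

lemma lg_phase_deriv_bound:
  "\<exists>C>0. \<forall>\<nu>\<ge>1. \<forall>z. norm z \<le> 1 \<longrightarrow> norm (cpoly (pderiv (lg_phase M \<nu>)) z) \<le> C / \<nu>"
  unfolding pderiv_lg_phase by (rule inverse_power_sum_bound)

text \<open>Each polynomial has a factor \<beta> or is an integral from 0. As \<beta> tends to 0 for
  x tending to infinity, this makes all corrections disappear there.\<close>

lemma poly_E_poly_0: "poly (E_poly s) 0 = 0"
proof -
  have i0: "poly (poly_integral p) 0 = 0" for p by (simp add: poly_0_coeff_0 coeff_poly_integral)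
  consider "s = 0" | "s = 1" | "s = 2" | n where "s = Suc (Suc (Suc n))"
    by (metis One_nat_def Suc_1 not0_implies_Suc)
  then show ?thesis
  proof cases
    case (4 n)
    then show ?thesis by (simp only: E_poly.simps poly_add poly_smult poly_mult poly_power i0) simp
  qed (simp_all add: numeral_2_eq_2)
qed

lemma cpoly_0_right: "cpoly p 0 = of_real (poly p 0)"
  by (induction p) auto

lemma cpoly_lg_phase_0: "cpoly (lg_phase M \<nu>) 0 = 0"
  unfolding lg_phase_def cpoly_sum
proof (intro sum.neutral ballI)
  show "cpoly (smult (1 / \<nu> ^ s) (E_poly s)) 0 = 0" for s
    by (simp only: cpoly_0_right poly_smult poly_E_poly_0) simp
qed

lemma cpoly_lg_phase_eq: "cpoly (lg_phase M \<nu>) z = (\<Sum>s=1..M. E_fun s z / of_real \<nu> ^ s)"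
  by (simp add: lg_phase_def cpoly_sum E_fun_def cpoly_def[symmetric])

section \<open>A Gronwall estimate\<close>

lemma has_vector_derivative_field_compose:
  assumes "(g has_field_derivative g') (at (f x))" "(f has_vector_derivative f') (at x)"
  shows "((\<lambda>x. g (f x)) has_vector_derivative g' * f') (at x)"
  using field_vector_diff_chain_at[OF assms(2,1)] by (simp add: o_def mult.commute)

lemma has_vector_derivative_inner_self:
  fixes v :: "real \<Rightarrow> 'a::real_inner"
  assumes "(v has_vector_derivative v') (at x)"
  shows "((\<lambda>x. (norm (v x))\<^sup>2) has_real_derivative 2 * (v x \<bullet> v')) (at x)"
proof -
  have "((\<lambda>x. v x \<bullet> v x) has_vector_derivative v x \<bullet> v' + v' \<bullet> v x) (at x)"
    by (rule bounded_bilinear.has_vector_derivative[OF bounded_bilinear_inner assms assms])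
  then show ?thesis
    by (simp add: power2_norm_eq_inner has_real_derivative_iff_has_vector_derivative inner_commute)
qed

lemma deriv_inv_sqrt_1_plus_sq:
  "((\<lambda>x. 1 / sqrt (1 + x\<^sup>2)) has_real_derivative - (x / sqrt (1 + x\<^sup>2) ^ 3)) (at x)"
proof -
  have pos: "1 + x\<^sup>2 > 0" by (simp add: add_pos_nonneg)
  have "((\<lambda>x. 1 / sqrt (1 + x\<^sup>2)) has_real_derivative
      - (inverse (sqrt (1 + x\<^sup>2)) / 2 * (2 * x)) / (sqrt (1 + x\<^sup>2) * sqrt (1 + x\<^sup>2))) (at x)"
    using pos by (auto intro!: derivative_eq_intros)
  then show ?thesis by (rule DERIV_cong) (use pos in \<open>simp add: field_simps power3_eq_cube\<close>)
qed

text \<open>The weight has the bounded antiderivative -1 / sqrt (1 + x^2), whose increments are at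
  most 1. So the norm grows at most by the factor \<open>exp \<kappa>\<close>, and integrating the
  bound on the derivative gives \<open>\<kappa> * exp \<kappa>\<close>. Both estimates start at some
  y > 0, and y then tends to 0, where only a limit of \<open>v\<close> is available.\<close>

lemma gronwall_from_zero:
  fixes v :: "real \<Rightarrow> 'a::real_inner"
  assumes lam: "\<kappa> \<ge> 0"
    and v': "\<And>x. x > 0 \<Longrightarrow> (v has_vector_derivative v' x) (at x)"
    and bnd: "\<And>x. x > 0 \<Longrightarrow> norm (v' x) \<le> \<kappa> * (x / sqrt (1 + x\<^sup>2) ^ 3) * norm (v x)"
    and lim: "(v \<longlongrightarrow> v0) (at_right 0)"
    and x: "x > 0"
  shows "norm (v x - v0) \<le> \<kappa> * exp \<kappa> * norm v0"
proof -
  define G :: "real \<Rightarrow> real" where "G x = - (1 / sqrt (1 + x\<^sup>2))" for x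
  have G': "(G has_real_derivative x / sqrt (1 + x\<^sup>2) ^ 3) (at x)" for x
    unfolding G_def using DERIV_minus[OF deriv_inv_sqrt_1_plus_sq[of x]] by simp
  have G_diff: "G u - G y \<le> 1" for u y :: real
  proof -
    have "1 / sqrt (1 + y\<^sup>2) \<le> 1" by (rule divide_le_eq_1_pos[THEN iffD2]) (auto simp: add_pos_nonneg)
    moreover have "0 \<le> 1 / sqrt (1 + u\<^sup>2)" by simp
    ultimately show ?thesis unfolding G_def by linarith
  qed
  have growth: "norm (v u) \<le> exp \<kappa> * norm (v y)" if y: "0 < y" "y \<le> u" for y u
  proof -
    \<comment> \<open>The squared norm is differentiable also where \<open>v\<close> vanishes, and
      the integrating factor makes \<open>f\<close> nonincreasing.\<close>
    define f where "f u = (norm (v u))\<^sup>2 * exp (- 2 * \<kappa> * G u)" for u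
    have "f u \<le> f y"
    proof (rule DERIV_nonpos_imp_nonincreasing[OF y(2)])
      fix z assume z: "y \<le> z" "z \<le> u"
      then have z0: "z > 0" using y by simp
      let ?G = "z / sqrt (1 + z\<^sup>2) ^ 3"
      let ?d = "2 * (v z \<bullet> v' z) * exp (- 2 * \<kappa> * G z) +
          (norm (v z))\<^sup>2 * (exp (- 2 * \<kappa> * G z) * (- 2 * \<kappa> * ?G))"
      have "(f has_real_derivative ?d) (at z)"
        unfolding f_def
        by (rule derivative_eq_intros has_vector_derivative_inner_self v' z0 G' refl)+ simp
      moreover have "v z \<bullet> v' z \<le> norm (v z) * (\<kappa> * ?G * norm (v z))"
        using norm_cauchy_schwarz[of "v z" "v' z"] mult_left_mono[OF bnd[OF z0] norm_ge_zero[of "v z"]]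
        by linarith
      then have "v z \<bullet> v' z - \<kappa> * ?G * (norm (v z))\<^sup>2 \<le> 0"
        by (simp add: power2_eq_square mult_ac)
      then have "2 * exp (- 2 * \<kappa> * G z) * (v z \<bullet> v' z - \<kappa> * ?G * (norm (v z))\<^sup>2) \<le> 0"
        by (simp add: mult_nonneg_nonpos)
      then have "?d \<le> 0" by (simp add: algebra_simps)
      ultimately show "\<exists>d. (f has_real_derivative d) (at z) \<and> d \<le> 0" by blast
    qed
    then have "(norm (v u))\<^sup>2 \<le> (norm (v y))\<^sup>2 * exp (- 2 * \<kappa> * G y) * exp (2 * \<kappa> * G u)"
      by (simp add: f_def exp_minus field_simps)
    also have "\<dots> = (norm (v y))\<^sup>2 * exp (2 * \<kappa> * (G u - G y))"
      by (simp add: algebra_simps flip: exp_add)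
    also have "\<dots> \<le> (norm (v y))\<^sup>2 * exp (2 * \<kappa> * 1)"
      using mult_left_mono[OF G_diff[of u y] lam] by (intro mult_left_mono) auto
    also have "\<dots> = (exp \<kappa> * norm (v y))\<^sup>2"
      by (simp add: power_mult_distrib flip: exp_double)
    finally show ?thesis by (rule power2_le_imp_le) simp
  qed
  have diff: "norm (v x - v y) \<le> \<kappa> * exp \<kappa> * norm (v y)" if y: "0 < y" "y < x" for y
  proof -
    define c where "c = \<kappa> * (exp \<kappa> * norm (v y))"
    have c: "c \<ge> 0" using lam by (simp add: c_def)
    have "norm (v x - v y) \<le> c * G x - c * G y"
    proof (rule differentiable_bound_general[OF y(2), where f' = v' and \<phi>' = "\<lambda>x. c * (x / sqrt (1 + x\<^sup>2) ^ 3)"])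
      show "continuous_on {y..x} v"
        using has_vector_derivative_continuous[OF v'] y(1) by (intro continuous_at_imp_continuous_on ballI) auto
      show "continuous_on {y..x} (\<lambda>x. c * G x)"
        using DERIV_isCont[OF G'] by (intro continuous_at_imp_continuous_on ballI continuous_intros)
      fix z assume z: "y < z" "z < x"
      show "(v has_vector_derivative v' z) (at z)" using v' z y by simp
      show "((\<lambda>x. c * G x) has_vector_derivative c * (z / sqrt (1 + z\<^sup>2) ^ 3)) (at z)"
        using DERIV_cmult[OF G'] by (simp add: has_real_derivative_iff_has_vector_derivative)
      have "norm (v' z) \<le> \<kappa> * (z / sqrt (1 + z\<^sup>2) ^ 3) * norm (v z)" using bnd z y by simp
      also have "\<dots> \<le> \<kappa> * (z / sqrt (1 + z\<^sup>2) ^ 3) * (exp \<kappa> * norm (v y))"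
        using growth[of y z] z y lam by (intro mult_left_mono) auto
      finally show "norm (v' z) \<le> c * (z / sqrt (1 + z\<^sup>2) ^ 3)" by (simp add: c_def mult_ac)
    qed
    also have "\<dots> = c * (G x - G y)" by (simp add: algebra_simps)
    also have "\<dots> \<le> c * 1" using c G_diff by (intro mult_left_mono) auto
    finally show ?thesis by (simp add: c_def mult_ac)
  qed
  show ?thesis
  proof (rule tendsto_le)
    show "((\<lambda>y. \<kappa> * exp \<kappa> * norm (v y)) \<longlongrightarrow> \<kappa> * exp \<kappa> * norm v0) (at_right 0)"
      by (intro tendsto_intros lim)
    show "((\<lambda>y. norm (v x - v y)) \<longlongrightarrow> norm (v x - v0)) (at_right 0)"
      by (intro tendsto_intros lim)
    show "\<forall>\<^sub>F y in at_right 0. norm (v x - v y) \<le> \<kappa> * exp \<kappa> * norm (v y)"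
      using eventually_at_right_less[of 0] eventually_at_right_real[OF x] by eventually_elim (use diff in auto)
  qed simp
qed

section \<open>Bessel functions of imaginary order\<close>

definition bessel_coeff :: "complex \<Rightarrow> nat \<Rightarrow> complex" where
  "bessel_coeff \<mu> k = (-1) ^ k * rGamma (\<mu> + of_nat k + 1) / fact k"

text \<open>In the variable u = z^2 / 4 the Bessel function is (z / 2)^\<mu> times this power
  series, so the branch point at 0 sits in the power alone.\<close>

definition bessel_ser :: "complex \<Rightarrow> complex \<Rightarrow> complex" where
  "bessel_ser \<mu> u = (\<Sum>k. bessel_coeff \<mu> k * u ^ k)"

definition bessel_ser' :: "complex \<Rightarrow> complex \<Rightarrow> complex" where
  "bessel_ser' \<mu> u = (\<Sum>k. diffs (bessel_coeff \<mu>) k * u ^ k)"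

definition bessel_ser'' :: "complex \<Rightarrow> complex \<Rightarrow> complex" where
  "bessel_ser'' \<mu> u = (\<Sum>k. diffs (diffs (bessel_coeff \<mu>)) k * u ^ k)"

text \<open>The functional equation of the reciprocal Gamma function. Stated without division it
  holds for every \<mu>; it yields both convergence and the differential equation.\<close>

lemma bessel_coeff_Suc:
  "(\<mu> + of_nat k + 1) * (of_nat (Suc k) * bessel_coeff \<mu> (Suc k)) = - bessel_coeff \<mu> k"
proof -
  have "of_nat (Suc k) * bessel_coeff \<mu> (Suc k) = - ((-1) ^ k * rGamma (\<mu> + of_nat k + 1 + 1) / fact k)"
    unfolding bessel_coeff_def fact_Suc of_nat_mult by (simp add: field_simps del: of_nat_Suc) (simp add: algebra_simps)
  then show ?thesis
    using rGamma_plus1[of "\<mu> + of_nat k + 1"] by (simp add: bessel_coeff_def)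
qed

lemma summable_bessel_coeff:
  assumes "Re \<mu> \<ge> 0"
  shows "summable (\<lambda>k. bessel_coeff \<mu> k * u ^ k)"
proof (rule summable_ratio_test)
  show "1 / 2 < (1::real)" by simp
  fix k assume k: "k \<ge> nat \<lceil>2 * norm u\<rceil>"
  have u: "2 * norm u \<le> real (Suc k)" using k by linarith
  \<comment> \<open>The factor with \<mu> has modulus at least 1, so the factor \<open>Suc k\<close>
    alone gives the ratio 1/2 once it exceeds \<open>2 * norm u\<close>.\<close>
  have "1 \<le> Re (\<mu> + of_nat k + 1)" using assms by simp
  also have "\<dots> \<le> norm (\<mu> + of_nat k + 1)" by (rule complex_Re_le_cmod)
  finally have "1 * norm (of_nat (Suc k) * bessel_coeff \<mu> (Suc k)) \<le>
      norm (\<mu> + of_nat k + 1) * norm (of_nat (Suc k) * bessel_coeff \<mu> (Suc k))"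
    by (rule mult_right_mono) simp
  also have "\<dots> = norm (bessel_coeff \<mu> k)"
    by (simp only: norm_mult[symmetric] bessel_coeff_Suc norm_minus_cancel)
  finally have 1: "real (Suc k) * norm (bessel_coeff \<mu> (Suc k)) \<le> norm (bessel_coeff \<mu> k)"
    by (simp only: norm_mult norm_of_nat mult_1_left)
  have "2 * norm u * norm (bessel_coeff \<mu> (Suc k)) \<le> norm (bessel_coeff \<mu> k)"
    using 1 mult_right_mono[OF u norm_ge_zero[of "bessel_coeff \<mu> (Suc k)"]] by linarith
  then have "(2 * norm u * norm (bessel_coeff \<mu> (Suc k))) * norm u ^ k \<le> norm (bessel_coeff \<mu> k) * norm u ^ k"
    by (intro mult_right_mono) auto
  then show "norm (bessel_coeff \<mu> (Suc k) * u ^ Suc k) \<le> 1 / 2 * norm (bessel_coeff \<mu> k * u ^ k)"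
    by (simp add: norm_mult norm_power mult_ac)
qed

context
  fixes \<mu> :: complex
  assumes \<mu>: "Re \<mu> \<ge> 0"
begin

lemma summable_diffs_bessel_coeff: "summable (\<lambda>k. diffs (bessel_coeff \<mu>) k * u ^ k)"
  by (rule termdiff_converges_all[OF summable_bessel_coeff[OF \<mu>]])

lemma summable_diffs_diffs_bessel_coeff: "summable (\<lambda>k. diffs (diffs (bessel_coeff \<mu>)) k * u ^ k)"
  by (rule termdiff_converges_all[OF summable_diffs_bessel_coeff])

lemma has_field_derivative_bessel_ser:
  "(bessel_ser \<mu> has_field_derivative bessel_ser' \<mu> u) (at u)"
  using termdiffs_strong_converges_everywhere[OF summable_bessel_coeff[OF \<mu>]]
  unfolding bessel_ser_def[abs_def] bessel_ser'_def .

lemma has_field_derivative_bessel_ser':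
  "(bessel_ser' \<mu> has_field_derivative bessel_ser'' \<mu> u) (at u)"
  using termdiffs_strong_converges_everywhere[OF summable_diffs_bessel_coeff]
  unfolding bessel_ser'_def[abs_def] bessel_ser''_def .

text \<open>This is Bessel's equation after removing the power and substituting u = z^2 / 4.
  Multiplication by u shifts the series of the second derivative, after which each coefficient is an
  instance of \<open>bessel_coeff_Suc\<close>.\<close>

lemma bessel_ser_ode: "u * bessel_ser'' \<mu> u + (\<mu> + 1) * bessel_ser' \<mu> u = - bessel_ser \<mu> u"
proof -
  define c where "c = bessel_coeff \<mu>"
  have c: "(\<lambda>k. c k * u ^ k) sums bessel_ser \<mu> u"
    unfolding bessel_ser_def c_def by (rule summable_sums[OF summable_bessel_coeff[OF \<mu>]])
  have c1: "(\<lambda>k. diffs c k * u ^ k) sums bessel_ser' \<mu> u"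
    unfolding bessel_ser'_def c_def by (rule summable_sums[OF summable_diffs_bessel_coeff])
  have "(\<lambda>k. diffs (diffs c) k * u ^ k) sums bessel_ser'' \<mu> u"
    unfolding bessel_ser''_def c_def by (rule summable_sums[OF summable_diffs_diffs_bessel_coeff])
  then have "(\<lambda>k. u * (diffs (diffs c) k * u ^ k)) sums (u * bessel_ser'' \<mu> u)"
    by (rule sums_mult)
  then have "(\<lambda>k. of_nat (Suc k) * diffs c (Suc k) * u ^ Suc k) sums (u * bessel_ser'' \<mu> u)"
    by (simp add: diffs_def mult_ac)
  then have c2: "(\<lambda>k. of_nat k * diffs c k * u ^ k) sums (u * bessel_ser'' \<mu> u)"
    by (subst (asm) sums_Suc_iff) simp
  have "(\<lambda>k. of_nat k * diffs c k * u ^ k + (\<mu> + 1) * (diffs c k * u ^ k)) sums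
      (u * bessel_ser'' \<mu> u + (\<mu> + 1) * bessel_ser' \<mu> u)"
    by (intro sums_add c2 sums_mult c1)
  moreover have "of_nat k * diffs c k * u ^ k + (\<mu> + 1) * (diffs c k * u ^ k) = - (c k * u ^ k)" for k
  proof -
    have "of_nat k * diffs c k * u ^ k + (\<mu> + 1) * (diffs c k * u ^ k) =
        ((\<mu> + of_nat k + 1) * (of_nat (Suc k) * c (Suc k))) * u ^ k"
      by (simp add: diffs_def algebra_simps)
    then show ?thesis unfolding c_def bessel_coeff_Suc by simp
  qed
  ultimately show ?thesis using sums_unique2[OF _ sums_minus[OF c]] by auto
qed

end

lemma bessel_ser_0: "bessel_ser \<mu> 0 = rGamma (\<mu> + 1)"
  by (simp add: bessel_ser_def powser_zero) (simp add: bessel_coeff_def)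

section \<open>The Bessel function on the half-line\<close>

definition bessel_Ji :: "real \<Rightarrow> real \<Rightarrow> complex" where
  "bessel_Ji \<nu> t = exp (\<i> * of_real (\<nu> * ln (t / 2))) * bessel_ser (\<i> * of_real \<nu>) (of_real (t\<^sup>2 / 4))"

text \<open>This is t times the derivative of \<open>bessel_Ji \<nu>\<close> at t, not the
  derivative itself. Up to the unimodular factor it extends continuously to t = 0.\<close>

definition bessel_Ji' :: "real \<Rightarrow> real \<Rightarrow> complex" where
  "bessel_Ji' \<nu> t = exp (\<i> * of_real (\<nu> * ln (t / 2))) *
     (\<i> * of_real \<nu> * bessel_ser (\<i> * of_real \<nu>) (of_real (t\<^sup>2 / 4)) +
      of_real (t\<^sup>2 / 2) * bessel_ser' (\<i> * of_real \<nu>) (of_real (t\<^sup>2 / 4)))"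

lemma bessel_J_eq_bessel_Ji:
  assumes "t > 0"
  shows "bessel_J (\<i> * of_real \<nu>) (of_real t) = bessel_Ji \<nu> t"
proof -
  have "complex_of_real t / 2 = of_real (t / 2)" by simp
  then have "(complex_of_real t / 2) powr (\<i> * of_real \<nu>) = exp (\<i> * of_real (\<nu> * ln (t / 2)))"
    using assms by (simp only: powr_def Ln_of_real) (simp add: mult_ac)
  moreover have "(complex_of_real t / 2) ^ (2 * k) = of_real (t\<^sup>2 / 4) ^ k" for k
    by (simp add: power_mult power_divide)
  ultimately show ?thesis
    by (simp add: bessel_J_def bessel_Ji_def bessel_ser_def bessel_coeff_def)
qed

lemma has_vector_derivative_exp_i_ln:
  assumes "x > 0"
  shows "((\<lambda>t. exp (\<i> * of_real (\<nu> * ln (t / 2)))) has_vector_derivative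
      exp (\<i> * of_real (\<nu> * ln (x / 2))) * (\<i> * of_real (\<nu> / x))) (at x)"
proof (rule has_vector_derivative_field_compose[OF DERIV_exp])
  have "((\<lambda>t. \<nu> * ln (t / 2)) has_vector_derivative \<nu> / x) (at x)"
    unfolding has_real_derivative_iff_has_vector_derivative[symmetric]
    using assms by (auto intro!: derivative_eq_intros)
  from bounded_linear.has_vector_derivative[OF bounded_linear_of_real this]
  have "((\<lambda>t. complex_of_real (\<nu> * ln (t / 2))) has_vector_derivative of_real (\<nu> / x)) (at x)" .
  from has_vector_derivative_mult_right[OF this]
  show "((\<lambda>t. \<i> * complex_of_real (\<nu> * ln (t / 2))) has_vector_derivative \<i> * of_real (\<nu> / x)) (at x)" .
qed

lemma has_vector_derivative_of_real_sq:
  "((\<lambda>t. complex_of_real (t\<^sup>2 / c)) has_vector_derivative of_real (2 * x / c)) (at x)"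
  by (rule bounded_linear.has_vector_derivative[OF bounded_linear_of_real])
     (cases "c = 0"; auto simp: has_real_derivative_iff_has_vector_derivative[symmetric]
       intro!: derivative_eq_intros)

lemma has_vector_derivative_bessel_Ji:
  assumes "x > 0"
  shows "(bessel_Ji \<nu> has_vector_derivative bessel_Ji' \<nu> x / of_real x) (at x)"
proof -
  have \<mu>: "Re (\<i> * of_real \<nu>) \<ge> 0" by simp
  show ?thesis
    unfolding bessel_Ji_def[abs_def] bessel_Ji'_def
    by (rule has_vector_derivative_eq_rhs[OF has_vector_derivative_mult[OF has_vector_derivative_exp_i_ln[OF assms]
        has_vector_derivative_field_compose[OF has_field_derivative_bessel_ser[OF \<mu>]
         has_vector_derivative_of_real_sq]]])
       (use assms in \<open>simp add: field_simps power2_eq_square\<close>)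
qed

lemma has_vector_derivative_bessel_Ji':
  assumes "x > 0"
  shows "(bessel_Ji' \<nu> has_vector_derivative - of_real ((\<nu>\<^sup>2 + x\<^sup>2) / x) * bessel_Ji \<nu> x) (at x)"
proof -
  let ?\<mu> = "\<i> * complex_of_real \<nu>"
  let ?u = "complex_of_real (x\<^sup>2 / 4)"
  have \<mu>: "Re ?\<mu> \<ge> 0" by simp
  have ode: "?u * bessel_ser'' ?\<mu> ?u = - bessel_ser ?\<mu> ?u - (?\<mu> + 1) * bessel_ser' ?\<mu> ?u"
    using bessel_ser_ode[OF \<mu>, of ?u] by (simp add: algebra_simps)
  define f f1 f2 E where "f = bessel_ser ?\<mu> ?u" and "f1 = bessel_ser' ?\<mu> ?u" and "f2 = bessel_ser'' ?\<mu> ?u"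
    and "E = exp (\<i> * of_real (\<nu> * ln (x / 2)))"
  have ode: "of_real x * of_real x * f2 = - 4 * f - 4 * (?\<mu> + 1) * f1"
    using ode unfolding f_def[symmetric] f1_def[symmetric] f2_def[symmetric]
    by (simp add: power2_eq_square field_simps)
  have "(bessel_Ji' \<nu> has_vector_derivative
     E * (?\<mu> * (f1 * of_real (2 * x / 4)) + (of_real (x\<^sup>2 / 2) * (f2 * of_real (2 * x / 4)) + of_real (2 * x / 2) * f1))
     + E * (\<i> * of_real (\<nu> / x)) * (?\<mu> * f + of_real (x\<^sup>2 / 2) * f1)) (at x)"
    unfolding bessel_Ji'_def[abs_def] f_def f1_def f2_def E_def
    by (rule has_vector_derivative_mult has_vector_derivative_add has_vector_derivative_mult_right
        has_vector_derivative_exp_i_ln[OF assms] has_vector_derivative_of_real_sq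
        has_vector_derivative_field_compose has_field_derivative_bessel_ser[OF \<mu>]
        has_field_derivative_bessel_ser'[OF \<mu>])+
  moreover have "E * (?\<mu> * (f1 * of_real (2 * x / 4)) + (of_real (x\<^sup>2 / 2) * (f2 * of_real (2 * x / 4)) + of_real (2 * x / 2) * f1))
     + E * (\<i> * of_real (\<nu> / x)) * (?\<mu> * f + of_real (x\<^sup>2 / 2) * f1) = - of_real ((\<nu>\<^sup>2 + x\<^sup>2) / x) * (E * f)"
  proof -
    have x: "of_real x \<noteq> (0::complex)" using assms by simp
    have "?\<mu> * (f1 * of_real (2 * x / 4)) + (of_real (x\<^sup>2 / 2) * (f2 * of_real (2 * x / 4)) + of_real (2 * x / 2) * f1)
        = (of_real x / 4) * (2 * ?\<mu> * f1 + of_real x * of_real x * f2 + 4 * f1)"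
      by (simp add: power2_eq_square field_simps)
    also have "\<dots> = - of_real x * f - (of_real x / 2) * ?\<mu> * f1"
      unfolding ode by (simp add: field_simps)
    finally have eq: "?\<mu> * (f1 * of_real (2 * x / 4)) +
        (of_real (x\<^sup>2 / 2) * (f2 * of_real (2 * x / 4)) + of_real (2 * x / 2) * f1) = \<dots>" .
    show ?thesis unfolding eq using x by (simp add: field_simps power2_eq_square)
  qed
  ultimately show ?thesis by (simp only: bessel_Ji_def f_def E_def)
qed

text \<open>The energy \<open>F\<close> is nonincreasing: in its derivative the mixed terms in J and
  t J' cancel, and only the decreasing weight 1 / (\<nu>^2 + t^2) contributes. Hence
  \<open>F\<close> is bounded by its limit at 0.\<close>

lemma bessel_Ji_bound:
  assumes \<nu>: "\<nu> > 0"
  obtains K where "K > 0" "\<And>t. t > 0 \<Longrightarrow> norm (bessel_Ji \<nu> t) \<le> K"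
    "\<And>t. t > 0 \<Longrightarrow> norm (bessel_Ji' \<nu> t) \<le> K * (\<nu> + t)"
proof -
  define F where "F t = (norm (bessel_Ji \<nu> t))\<^sup>2 + (norm (bessel_Ji' \<nu> t))\<^sup>2 / (\<nu>\<^sup>2 + t\<^sup>2)" for t
  have pos: "\<nu>\<^sup>2 + t\<^sup>2 > 0" for t :: real using \<nu> by (simp add: add_pos_nonneg)
  have mono: "F t \<le> F s" if "0 < s" "s \<le> t" for s t
  proof (rule DERIV_nonpos_imp_nonincreasing[OF that(2)])
    fix x assume "s \<le> x" "x \<le> t"
    then have x: "x > 0" using that by simp
    let ?J = "bessel_Ji \<nu> x" and ?J1 = "bessel_Ji' \<nu> x" and ?w = "\<nu>\<^sup>2 + x\<^sup>2"
    let ?d1 = "2 * (?J1 \<bullet> (- of_real (?w / x) * ?J))"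
    let ?d = "2 * (?J \<bullet> (?J1 / of_real x)) +
       (?d1 * ?w - (norm ?J1)\<^sup>2 * (2 * x)) / ?w\<^sup>2"
    have w: "((\<lambda>x. \<nu>\<^sup>2 + x\<^sup>2) has_real_derivative 2 * x) (at x)"
      by (auto intro!: derivative_eq_intros)
    have "(F has_real_derivative ?d) (at x)"
      unfolding F_def power2_eq_square[of ?w]
      by (intro DERIV_add DERIV_divide has_vector_derivative_inner_self has_vector_derivative_bessel_Ji
          has_vector_derivative_bessel_Ji' x w) (use \<nu> in auto)
    moreover have e1: "?J \<bullet> (?J1 / of_real x) = (?J \<bullet> ?J1) / x"
      by (simp add: inner_complex_def add_divide_distrib)
    moreover have "- of_real (?w / x) * ?J = (- (?w / x)) *\<^sub>R ?J"
      by (simp add: scaleR_conv_of_real)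
    then have e2: "?J1 \<bullet> (- of_real (?w / x) * ?J) = - (?w / x) * (?J \<bullet> ?J1)"
      by (simp only: inner_scaleR_right) (simp add: inner_commute)
    have "?d = - (norm ?J1)\<^sup>2 * (2 * x) / ?w\<^sup>2"
    proof -
      define I n w where "I = ?J \<bullet> ?J1" and "n = (norm ?J1)\<^sup>2" and "w = ?w"
      have "w \<noteq> 0" using pos[of x] unfolding w_def by linarith
      then have "2 * (I / x) + (2 * (- (w / x) * I) * w - n * (2 * x)) / w\<^sup>2 = - n * (2 * x) / w\<^sup>2"
        using x by (simp add: field_simps power2_eq_square)
      then show ?thesis unfolding e1 e2 I_def n_def w_def .
    qed
    then have "?d \<le> 0" using x by (auto intro!: divide_nonpos_nonneg mult_nonneg_nonneg)
    ultimately show "\<exists>y. (F has_real_derivative y) (at x) \<and> y \<le> 0" by blast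
  qed
  \<comment> \<open>\<open>H\<close> is \<open>F\<close> without the unimodular factor (t / 2)^(i
    \<nu>). It is continuous at 0, although \<open>bessel_Ji\<close> itself oscillates
    there.\<close>
  define H where "H t = (norm (bessel_ser (\<i> * of_real \<nu>) (of_real (t\<^sup>2 / 4))))\<^sup>2 +
      (norm (\<i> * of_real \<nu> * bessel_ser (\<i> * of_real \<nu>) (of_real (t\<^sup>2 / 4)) +
      of_real (t\<^sup>2 / 2) * bessel_ser' (\<i> * of_real \<nu>) (of_real (t\<^sup>2 / 4))))\<^sup>2 / (\<nu>\<^sup>2 + t\<^sup>2)" for t
  have FH: "F t = H t" for t
  proof -
    have "norm (exp (\<i> * complex_of_real (\<nu> * ln (t / 2)))) = 1" by simp
    then show ?thesis unfolding F_def H_def bessel_Ji_def bessel_Ji'_def norm_mult by simp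
  qed
  have \<mu>: "Re (\<i> * of_real \<nu>) \<ge> 0" by simp
  have "isCont H 0"
    unfolding H_def
    by (intro continuous_intros isCont_o2[OF _ DERIV_isCont[OF has_field_derivative_bessel_ser[OF \<mu>]]]
        isCont_o2[OF _ DERIV_isCont[OF has_field_derivative_bessel_ser'[OF \<mu>]]]) (use \<nu> in auto)
  then have "(H \<longlongrightarrow> H 0) (at_right 0)"
    by (simp add: isCont_def filterlim_at_split)
  then have lim: "(F \<longlongrightarrow> H 0) (at_right 0)" by (simp add: FH[abs_def])
  have F: "F t \<le> H 0" if t: "t > 0" for t
  proof (rule tendsto_lowerbound[OF lim])
    show "\<forall>\<^sub>F s in at_right 0. F t \<le> F s"
      using eventually_at_right_less[of 0] eventually_at_right_real[OF t]
      by eventually_elim (use mono in auto)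
  qed simp
  define K where "K = sqrt (H 0) + 1"
  have H0: "H 0 \<ge> 0" by (simp add: H_def)
  have K: "K > 0" "K \<ge> 0" using real_sqrt_ge_zero[OF H0] unfolding K_def by linarith+
  have "K\<^sup>2 = H 0 + 2 * sqrt (H 0) + 1" using H0 by (simp add: K_def power2_sum)
  then have "K\<^sup>2 \<ge> H 0" using real_sqrt_ge_zero[OF H0] by linarith
  note K = K this
  show ?thesis
  proof (rule that[OF K(1)])
    fix t :: real assume t: "t > 0"
    have "(norm (bessel_Ji \<nu> t))\<^sup>2 \<le> F t" using pos[of t] by (simp add: F_def)
    then have "(norm (bessel_Ji \<nu> t))\<^sup>2 \<le> K\<^sup>2" using F[OF t] K(3) by linarith
    then show "norm (bessel_Ji \<nu> t) \<le> K" by (rule power2_le_imp_le[OF _ K(2)])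
    have "(norm (bessel_Ji' \<nu> t))\<^sup>2 / (\<nu>\<^sup>2 + t\<^sup>2) \<le> F t" by (simp add: F_def)
    then have "(norm (bessel_Ji' \<nu> t))\<^sup>2 / (\<nu>\<^sup>2 + t\<^sup>2) \<le> K\<^sup>2" using F[OF t] K(3) by linarith
    then have "(norm (bessel_Ji' \<nu> t))\<^sup>2 \<le> K\<^sup>2 * (\<nu>\<^sup>2 + t\<^sup>2)" using pos[of t] by (simp add: divide_le_eq)
    also have "\<dots> \<le> K\<^sup>2 * (\<nu> + t)\<^sup>2" using \<nu> t by (intro mult_left_mono) (auto simp: power2_sum)
    also have "\<dots> = (K * (\<nu> + t))\<^sup>2" by (simp add: power_mult_distrib)
    finally show "norm (bessel_Ji' \<nu> t) \<le> K * (\<nu> + t)"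
      by (rule power2_le_imp_le) (use K(2) \<nu> t in simp)
  qed
qed

text \<open>The behaviour at 0 governs the Laplace transform for large argument. Near 0 the linear
  bound comes from differentiability of \<open>H\<close>; for t \<ge> \<delta> both terms are
  bounded, and 1 \<le> t / \<delta> makes the bound linear.\<close>

lemma bessel_Ji_near_0:
  assumes \<nu>: "\<nu> > 0"
  obtains C where "C > 0" "\<And>t. t > 0 \<Longrightarrow>
    norm (exp (- \<i> * of_real t) * bessel_Ji \<nu> t - exp (\<i> * of_real (\<nu> * ln (t / 2))) * rGamma (\<i> * of_real \<nu> + 1)) \<le> C * t"
proof -
  let ?\<mu> = "\<i> * complex_of_real \<nu>"
  have \<mu>: "Re ?\<mu> \<ge> 0" by simp
  obtain K where K: "K > 0" "\<And>t. t > 0 \<Longrightarrow> norm (bessel_Ji \<nu> t) \<le> K" using bessel_Ji_bound[OF \<nu>] by metis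
  define H where "H z = exp (- \<i> * z) * bessel_ser ?\<mu> (z\<^sup>2 / 4)" for z
  obtain D where D: "(H has_field_derivative D) (at 0)"
  proof
    show "(H has_field_derivative - \<i> * bessel_ser ?\<mu> 0) (at 0)"
      unfolding H_def
      by (auto intro!: derivative_eq_intros DERIV_chain2[OF has_field_derivative_bessel_ser[OF \<mu>]])
  qed
  then have "((\<lambda>z. norm ((H z - H 0) / z)) \<longlongrightarrow> norm D) (at 0)"
    by (intro tendsto_norm) (simp add: DERIV_def)
  then have "\<forall>\<^sub>F z in at 0. norm ((H z - H 0) / z) < norm D + 1"
    by (rule order_tendstoD) simp
  then obtain \<delta> where \<delta>: "\<delta> > 0" "\<And>z. z \<noteq> 0 \<Longrightarrow> norm z < \<delta> \<Longrightarrow> norm ((H z - H 0) / z) < norm D + 1"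
    by (auto simp: eventually_at)
  have H0: "H 0 = rGamma (?\<mu> + 1)" by (simp add: H_def bessel_ser_0)
  define C where "C = norm D + 1 + (K + norm (H 0)) / \<delta>"
  have eq: "exp (- \<i> * of_real t) * bessel_Ji \<nu> t - exp (\<i> * of_real (\<nu> * ln (t / 2))) * rGamma (?\<mu> + 1) =
     exp (\<i> * of_real (\<nu> * ln (t / 2))) * (H (of_real t) - H 0)" for t
    unfolding H0 by (simp add: H_def bessel_Ji_def algebra_simps)
  have n1: "norm (exp (\<i> * complex_of_real y)) = 1" for y by simp
  have n2: "norm (exp (- \<i> * complex_of_real y)) = 1" for y by simp
  show ?thesis
  proof (rule that)
    have "0 < norm D + 1" by (simp add: add_nonneg_pos)
    moreover have "0 \<le> (K + norm (H 0)) / \<delta>" using K \<delta> by simp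
    ultimately show "C > 0" unfolding C_def by linarith
    fix t :: real assume t: "t > 0"
    show "norm (exp (- \<i> * of_real t) * bessel_Ji \<nu> t - exp (\<i> * of_real (\<nu> * ln (t / 2))) * rGamma (?\<mu> + 1)) \<le> C * t"
    proof (cases "t < \<delta>")
      case True
      have "norm (H (of_real t) - H 0) \<le> (norm D + 1) * t"
        using \<delta>(2)[of "of_real t"] True t by (simp add: norm_divide field_simps)
      also have "\<dots> \<le> C * t" using K \<delta> t by (intro mult_right_mono) (auto simp: C_def)
      finally show ?thesis unfolding eq norm_mult n1 by simp
    next
      case False
      have "norm (exp (- \<i> * of_real t) * bessel_Ji \<nu> t - exp (\<i> * of_real (\<nu> * ln (t / 2))) * rGamma (?\<mu> + 1))
        \<le> norm (exp (- \<i> * of_real t) * bessel_Ji \<nu> t) + norm (exp (\<i> * of_real (\<nu> * ln (t / 2))) * rGamma (?\<mu> + 1))"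
        by (rule norm_triangle_ineq4)
      also have "\<dots> \<le> K + norm (H 0)"
        unfolding norm_mult n1 n2 H0 using K(2)[OF t] by simp
      also have "\<dots> \<le> (K + norm (H 0)) / \<delta> * t"
      proof -
        have "(K + norm (H 0)) * \<delta> \<le> (K + norm (H 0)) * t" using False K by (intro mult_left_mono) auto
        then show ?thesis using \<delta> by (simp add: field_simps)
      qed
      also have "\<dots> \<le> C * t" using t by (intro mult_right_mono) (auto simp: C_def)
      finally show ?thesis .
    qed
  qed
qed

section \<open>Approximate solutions\<close>

definition lg_beta :: "real \<Rightarrow> complex" where
  "lg_beta x = - \<i> * of_real (beta_hat x)"

text \<open>What remains of \<open>lg_approx\<close> after splitting off exp (i \<nu> ln x), the
  only factor without a limit at 0; it is continuous on the whole real line.\<close>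

definition lg_reg :: "nat \<Rightarrow> real \<Rightarrow> real \<Rightarrow> complex" where
  "lg_reg M \<nu> x = exp (of_real (- ln (1 + x\<^sup>2) / 4) +
     \<i> * of_real (\<nu> * (sqrt (1 + x\<^sup>2) - ln (1 + sqrt (1 + x\<^sup>2)))) + cpoly (lg_phase M \<nu>) (lg_beta x))"

definition lg_approx :: "nat \<Rightarrow> real \<Rightarrow> real \<Rightarrow> complex" where
  "lg_approx M \<nu> x = exp (\<i> * of_real (\<nu> * ln x)) * lg_reg M \<nu> x"

text \<open>The logarithmic derivative of \<open>lg_approx\<close> with respect to ln x. It is
  finite at 0, with value i \<nu>.\<close>

definition lg_logderiv :: "nat \<Rightarrow> real \<Rightarrow> real \<Rightarrow> complex" where
  "lg_logderiv M \<nu> x = of_real (- (x\<^sup>2 / (2 * (1 + x\<^sup>2)))) + \<i> * of_real (\<nu> * sqrt (1 + x\<^sup>2)) +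
     \<i> * of_real (x\<^sup>2 / sqrt (1 + x\<^sup>2) ^ 3) * cpoly (pderiv (lg_phase M \<nu>)) (lg_beta x)"

definition lg_error :: "nat \<Rightarrow> real \<Rightarrow> real \<Rightarrow> complex" where
  "lg_error M \<nu> x = - of_real (x\<^sup>2 / (1 + x\<^sup>2)) * cpoly (lg_residual M \<nu>) (lg_beta x)"

lemma one_plus_sq_pos: "1 + (x::real)\<^sup>2 > 0"
  by (simp add: add_pos_nonneg)

lemma norm_lg_beta: "norm (lg_beta x) \<le> 1"
proof -
  have "1 / sqrt (1 + x\<^sup>2) \<le> 1"
    using one_plus_sq_pos[of x] by (intro divide_le_eq_1_pos[THEN iffD2]) auto
  then show ?thesis
    by (simp add: lg_beta_def beta_hat_def norm_mult norm_divide)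
qed

lemma has_vector_derivative_cnj:
  "(f has_vector_derivative f') F \<Longrightarrow> ((\<lambda>x. cnj (f x)) has_vector_derivative cnj f') F"
  by (rule bounded_linear.has_vector_derivative[OF bounded_linear_cnj])

lemma has_vector_derivative_complex_of_real:
  "(f has_real_derivative f') F \<Longrightarrow> ((\<lambda>x. complex_of_real (f x)) has_vector_derivative of_real f') F"
  unfolding has_real_derivative_iff_has_vector_derivative
  by (rule bounded_linear.has_vector_derivative[OF bounded_linear_of_real])

lemma has_vector_derivative_lg_beta:
  "(lg_beta has_vector_derivative \<i> * of_real (x / sqrt (1 + x\<^sup>2) ^ 3)) (at x)"
proof -
  have "(lg_beta has_vector_derivative - \<i> * of_real (- (x / sqrt (1 + x\<^sup>2) ^ 3))) (at x)"
    unfolding lg_beta_def[abs_def] beta_hat_def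
    by (intro has_vector_derivative_mult_right has_vector_derivative_complex_of_real deriv_inv_sqrt_1_plus_sq)
  then show ?thesis by simp
qed

lemma deriv_sqrt_1_plus_sq:
  "((\<lambda>x. sqrt (1 + x\<^sup>2)) has_real_derivative x / sqrt (1 + x\<^sup>2)) (at x)"
  using one_plus_sq_pos[of x] by (auto intro!: derivative_eq_intros simp: field_simps)

lemma lg_phase_exponent_eq:
  assumes "x > 0"
  shows "lg_approx M \<nu> x = exp (of_real (- ln (1 + x\<^sup>2) / 4) + \<i> * of_real (\<nu> * rho x)
    + cpoly (lg_phase M \<nu>) (lg_beta x))"
proof -
  have "ln ((1 + sqrt (x\<^sup>2 + 1)) / x) = ln (1 + sqrt (x\<^sup>2 + 1)) - ln x"
    using assms by (intro ln_divide_pos) (auto intro: add_pos_nonneg)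
  then have "rho x = ln x + (sqrt (1 + x\<^sup>2) - ln (1 + sqrt (1 + x\<^sup>2)))"
    unfolding rho_def add.commute[of "x\<^sup>2" 1] by linarith
  then have "\<nu> * rho x = \<nu> * ln x + \<nu> * (sqrt (1 + x\<^sup>2) - ln (1 + sqrt (1 + x\<^sup>2)))"
    by (simp add: distrib_left)
  then have "complex_of_real (\<nu> * rho x) = of_real (\<nu> * ln x) +
      of_real (\<nu> * (sqrt (1 + x\<^sup>2) - ln (1 + sqrt (1 + x\<^sup>2))))"
    by (simp only: of_real_add)
  then show ?thesis
    unfolding lg_approx_def lg_reg_def by (simp only: distrib_left exp_add mult_ac)
qed

lemma deriv_rho:
  assumes "x > 0"
  shows "(rho has_real_derivative sqrt (1 + x\<^sup>2) / x) (at x)"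
proof -
  define r where "r = sqrt (1 + x\<^sup>2)"
  have r: "r > 0" "r * r = 1 + x * x" using one_plus_sq_pos[of x] by (auto simp: r_def power2_eq_square)
  have "((\<lambda>x. sqrt (1 + x\<^sup>2) - (ln (1 + sqrt (1 + x\<^sup>2)) - ln x)) has_real_derivative
     x / r - (1 / (1 + r) * (0 + x / r) - 1 / x)) (at x)"
    unfolding r_def
    by (intro DERIV_diff deriv_sqrt_1_plus_sq DERIV_chain2[OF DERIV_ln_divide] DERIV_add DERIV_const DERIV_ln_divide)
       (use assms r(1) in \<open>auto simp flip: r_def\<close>)
  moreover have "x / r - (1 / (1 + r) * (0 + x / r) - 1 / x) = r / x"
  proof -
    have "x / r - 1 / (1 + r) * (0 + x / r) = x / (1 + r)"     proof -
      define s where "s = 1 + r"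
      have "s \<noteq> 0" "r = s - 1" using r(1) by (auto simp: s_def)
      then show ?thesis using r(1) unfolding s_def[symmetric] by (simp add: field_simps) (simp add: s_def algebra_simps)
    qed
    moreover have "x / (1 + r) = (r - 1) / x"
    proof -
      have "x * x = (r - 1) * (1 + r)" using r(2) by (simp add: algebra_simps)
      then show ?thesis using r assms by (simp add: field_simps)
    qed
    ultimately show ?thesis using assms by (simp add: field_simps)
  qed
  ultimately have "((\<lambda>x. sqrt (1 + x\<^sup>2) - (ln (1 + sqrt (1 + x\<^sup>2)) - ln x)) has_real_derivative r / x) (at x)"
    by simp
  moreover have "\<forall>\<^sub>F y in nhds x. rho y = sqrt (1 + y\<^sup>2) - (ln (1 + sqrt (1 + y\<^sup>2)) - ln y)"
    using eventually_nhds_in_open[of "{0<..}" x] assms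
    by (auto elim!: eventually_mono simp: rho_def ln_divide_pos add_pos_nonneg add.commute)
  ultimately show ?thesis unfolding r_def by (subst DERIV_cong_ev[OF refl _ refl]) auto
qed

lemma has_vector_derivative_lg_approx:
  assumes "x > 0"
  shows "(lg_approx M \<nu> has_vector_derivative lg_approx M \<nu> x * lg_logderiv M \<nu> x / of_real x) (at x)"
proof -
  let ?P = "cpoly (pderiv (lg_phase M \<nu>)) (lg_beta x)"
  define G where "G x = of_real (- ln (1 + x\<^sup>2) / 4) + \<i> * of_real (\<nu> * rho x) + cpoly (lg_phase M \<nu>) (lg_beta x)" for x
  have "(G has_vector_derivative of_real (- (x / (2 * (1 + x\<^sup>2)))) + \<i> * of_real (\<nu> * (sqrt (1 + x\<^sup>2) / x)) +
     ?P * (\<i> * of_real (x / sqrt (1 + x\<^sup>2) ^ 3))) (at x)" (is "(_ has_vector_derivative ?G') _")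
    unfolding G_def
    by (intro has_vector_derivative_add has_vector_derivative_mult_right has_vector_derivative_complex_of_real
         DERIV_cmult deriv_rho[OF assms] has_vector_derivative_field_compose[OF has_field_derivative_cpoly]
         has_vector_derivative_lg_beta)
       (use one_plus_sq_pos[of x] in \<open>auto intro!: derivative_eq_intros simp: field_simps\<close>)
  then have "((\<lambda>x. exp (G x)) has_vector_derivative exp (G x) * ?G') (at x)"
    by (rule has_vector_derivative_field_compose[OF DERIV_exp])
  moreover have "?G' = lg_logderiv M \<nu> x / of_real x"
    using assms by (simp add: lg_logderiv_def field_simps power2_eq_square)
  ultimately have "((\<lambda>x. exp (G x)) has_vector_derivative lg_approx M \<nu> x * lg_logderiv M \<nu> x / of_real x) (at x)"
    using assms by (simp add: lg_phase_exponent_eq G_def)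
  moreover have "exp (G y) = lg_approx M \<nu> y" if "y \<in> {0<..}" for y
    using that by (simp add: G_def lg_phase_exponent_eq)
  ultimately show ?thesis
    using has_vector_derivative_transform_within_open[of "\<lambda>x. exp (G x)" _ x "{0<..}" "lg_approx M \<nu>"] assms by auto
qed

text \<open>The Riccati equation equivalent to \<open>lg_approx\<close> solving Bessel's equation
  with - \<nu>^2 (1 + x^2) perturbed by \<open>lg_error\<close>. Collecting the terms by derivatives
  of \<open>lg_phase\<close>, evaluated at \<open>lg_beta x\<close>, produces exactly
  \<open>lg_residual\<close>.\<close>

lemma has_vector_derivative_lg_logderiv:
  assumes "x > 0"
  shows "(lg_logderiv M \<nu> has_vector_derivative
     (- of_real (\<nu>\<^sup>2 * (1 + x\<^sup>2)) + lg_error M \<nu> x - (lg_logderiv M \<nu> x)\<^sup>2) / of_real x) (at x)"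
proof -
  define r where "r = sqrt (1 + x\<^sup>2)"
  have r: "r > 0" "r * r = 1 + x * x" using one_plus_sq_pos[of x] by (auto simp: r_def power2_eq_square)
  let ?P1 = "cpoly (pderiv (lg_phase M \<nu>)) (lg_beta x)"
  let ?P2 = "cpoly (pderiv (pderiv (lg_phase M \<nu>))) (lg_beta x)"
  have d1: "((\<lambda>x. - (x\<^sup>2 / (2 * (1 + x\<^sup>2)))) has_real_derivative - (x / r ^ 4)) (at x)"
  proof -
    define w where "w = 1 + x\<^sup>2"
    have w: "w > 0" using one_plus_sq_pos[of x] by (simp add: w_def)
    have "((\<lambda>x. - (x\<^sup>2 / (2 * (1 + x\<^sup>2)))) has_real_derivative
       - ((2 * x * (2 * w) - x\<^sup>2 * (4 * x)) / ((2 * w) * (2 * w)))) (at x)"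
      using w unfolding w_def by (auto intro!: derivative_eq_intros)
    moreover have "x\<^sup>2 = w - 1" by (simp add: w_def)
    then have "- ((2 * x * (2 * w) - x\<^sup>2 * (4 * x)) / ((2 * w) * (2 * w))) = - (x / (w * w))"
      using w by (simp only:) (simp add: field_simps)
    moreover have "r ^ 4 = w * w"
      using r(2) by (simp add: w_def power4_eq_xxxx power2_eq_square mult.assoc[symmetric])
    ultimately show ?thesis by simp
  qed
  have d2: "((\<lambda>x. x\<^sup>2 / sqrt (1 + x\<^sup>2) ^ 3) has_real_derivative x * (2 - x\<^sup>2) / r ^ 5) (at x)"
  proof -
    have "((\<lambda>x. x\<^sup>2 / sqrt (1 + x\<^sup>2) ^ 3) has_real_derivative
       (2 * x * r ^ 3 - x\<^sup>2 * (3 * r\<^sup>2 * (x / r))) / (r ^ 3 * r ^ 3)) (at x)"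
      unfolding r_def
      by (rule derivative_eq_intros deriv_sqrt_1_plus_sq refl)+
         (use one_plus_sq_pos[of x] in \<open>auto simp: numeral_eq_Suc\<close>)
    moreover have "(2 * x * r ^ 3 - x\<^sup>2 * (3 * r\<^sup>2 * (x / r))) / (r ^ 3 * r ^ 3) = x * (2 - x\<^sup>2) / r ^ 5"
    proof -
      have "2 * x * r ^ 3 - x\<^sup>2 * (3 * r\<^sup>2 * (x / r)) = x * r * (2 * (r * r) - 3 * (x * x))"
        using r(1) by (simp add: field_simps power2_eq_square power3_eq_cube)
      also have "\<dots> = x * r * (2 - x\<^sup>2)" unfolding r(2) by (simp add: power2_eq_square algebra_simps)
      finally show ?thesis using r(1) by (simp add: field_simps eval_nat_numeral)
    qed
    ultimately show ?thesis by simp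
  qed
  have "(lg_logderiv M \<nu> has_vector_derivative of_real (- (x / r ^ 4)) + \<i> * of_real (\<nu> * (x / r)) +
     (\<i> * of_real (x\<^sup>2 / r ^ 3) * (?P2 * (\<i> * of_real (x / r ^ 3))) + \<i> * of_real (x * (2 - x\<^sup>2) / r ^ 5) * ?P1)) (at x)"
    (is "(_ has_vector_derivative ?G') _")
    using d1 d2 unfolding lg_logderiv_def[abs_def] r_def
    by (intro has_vector_derivative_add has_vector_derivative_mult has_vector_derivative_mult_right has_vector_derivative_complex_of_real
         DERIV_cmult deriv_sqrt_1_plus_sq has_vector_derivative_field_compose[OF has_field_derivative_cpoly]
         has_vector_derivative_lg_beta)
  moreover have "?G' = (- of_real (\<nu>\<^sup>2 * (1 + x\<^sup>2)) + lg_error M \<nu> x - (lg_logderiv M \<nu> x)\<^sup>2) / of_real x"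
  proof -
    \<comment> \<open>All terms are rational in \<open>R\<close> and \<open>X\<close>. Replacing
      \<open>X * X\<close> by \<open>R * R - 1\<close> reduces the claim to an identity in
      \<open>R\<close>, \<open>n\<close>, \<open>P1\<close> and \<open>P2\<close>.\<close>
    define R X n P1 P2 where "R = complex_of_real r" and "X = complex_of_real x" and "n = complex_of_real \<nu>"
      and "P1 = ?P1" and "P2 = ?P2"
    have nz: "R \<noteq> 0" "X \<noteq> 0" using r assms by (auto simp: R_def X_def)
    have RX: "X * X = R * R - 1"
      using arg_cong[OF r(2), of complex_of_real] by (simp add: R_def X_def)
    have b: "lg_beta x = - \<i> / R" by (simp add: lg_beta_def beta_hat_def R_def r_def)
    have b2: "(lg_beta x)\<^sup>2 = - 1 / (R * R)" unfolding b by (simp add: power2_eq_square field_simps)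
    have W: "cpoly lg_weight (lg_beta x) = - (X * X) / (R * R * R * R)"
      unfolding cpoly_lg_weight b2 RX using nz by (simp add: field_simps)
    have "pderiv lg_weight = [:0, 2, 0, 4:]"
      by (simp add: lg_weight_def power2_eq_square pderiv_pCons)
    then have W1: "cpoly (pderiv lg_weight) (lg_beta x) = - 2 * \<i> / R * (1 - 2 / (R * R))"
      unfolding b using nz by (simp add: field_simps)
    have E1: "complex_of_real 2 * cpoly (pderiv (E_poly 1)) (lg_beta x) = (1 - 5 / (R * R)) / 4"
      unfolding b using nz by (simp add: pderiv_smult pderiv_pCons field_simps)
    have res: "cpoly (lg_residual M \<nu>) (lg_beta x) = 2 * n * P1 + X * X / (R * R * R * R) * P1 * P1
       - (- 2 * \<i> / R * (1 - 2 / (R * R)) * P1 - X * X / (R * R * R * R) * P2) - (1 - 5 / (R * R)) / 4"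
      unfolding lg_residual_def pderiv_mult cpoly_diff cpoly_smult cpoly_mult cpoly_add cpoly_power W W1 E1
      by (simp add: n_def P1_def P2_def power2_eq_square algebra_simps)
    have err: "lg_error M \<nu> x = - (X * X / (R * R)) * cpoly (lg_residual M \<nu>) (lg_beta x)"
      using arg_cong[OF r(2), of complex_of_real] by (simp add: lg_error_def R_def X_def power2_eq_square)
    have ld: "lg_logderiv M \<nu> x = - (X * X) / (2 * (R * R)) + \<i> * (n * R) + \<i> * (X * X / (R * R * R)) * P1"
    proof -
      have "1 + x\<^sup>2 = r * r" using r(2) by (simp add: power2_eq_square)
      then show ?thesis
        unfolding lg_logderiv_def r_def[symmetric]
        by (simp add: R_def X_def n_def P1_def power2_eq_square power3_eq_cube)
    qed
    have G': "?G' * X = - (X * X) / (R * R * R * R) + \<i> * n * (X * X) / R - (X * X) * (X * X) / (R * R * R * R * R * R) * P2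
        + \<i> * (X * X) * (2 - X * X) / (R * R * R * R * R) * P1"
      by (simp add: R_def X_def n_def P1_def P2_def eval_nat_numeral algebra_simps)
    have "?G' * X = - (n * n * (R * R)) + lg_error M \<nu> x - (lg_logderiv M \<nu> x)\<^sup>2"
      unfolding G' err res ld RX using nz by (simp add: field_simps power2_eq_square)
    moreover have "of_real (\<nu>\<^sup>2 * (1 + x\<^sup>2)) = n * n * (R * R)"
      using arg_cong[OF r(2), of complex_of_real] by (simp add: R_def n_def power2_eq_square)
    ultimately show ?thesis using nz by (simp add: X_def field_simps)
  qed
  ultimately show ?thesis by simp
qed

lemma norm_lg_approx_pos: "norm (lg_approx M \<nu> x) > 0"
  by (simp add: lg_approx_def lg_reg_def)

lemma isCont_lg_beta: "isCont lg_beta x"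
  by (rule has_vector_derivative_continuous[OF has_vector_derivative_lg_beta])

lemma isCont_cpoly: "isCont (cpoly p) z"
  by (rule DERIV_isCont[OF has_field_derivative_cpoly])

lemma isCont_lg_reg: "isCont (lg_reg M \<nu>) x"
proof -
  have "1 + x\<^sup>2 \<noteq> 0" "1 + sqrt (1 + x\<^sup>2) > 0"
    using one_plus_sq_pos[of x] real_sqrt_gt_zero[OF one_plus_sq_pos[of x]] by linarith+
  then show ?thesis
    unfolding lg_reg_def[abs_def]
    by (intro continuous_intros isCont_o2[OF isCont_lg_beta isCont_cpoly]) auto
qed

lemma isCont_lg_logderiv: "isCont (lg_logderiv M \<nu>) x"
proof -
  have "1 + x\<^sup>2 \<noteq> 0" using one_plus_sq_pos[of x] by linarith
  then show ?thesis
    unfolding lg_logderiv_def[abs_def]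
    by (intro continuous_intros isCont_o2[OF isCont_lg_beta isCont_cpoly]) auto
qed

lemma isCont_at_right: "isCont f a \<Longrightarrow> (f \<longlongrightarrow> f a) (at_right a)"
  for f :: "real \<Rightarrow> 'a::topological_space"
  by (simp add: isCont_def filterlim_at_split)

section \<open>Variation of constants against the approximate solution\<close>

lemma has_vector_derivative_cmult: "((\<lambda>x. c * x) has_vector_derivative c) (at x)" for c :: real
  unfolding has_real_derivative_iff_has_vector_derivative[symmetric]
  by (auto intro!: derivative_eq_intros)

lemma norm_Pair_le_sum: "norm (a, b) \<le> norm a + norm b"
  by (simp add: norm_Pair sqrt_sum_squares_le_sum)

lemma norm_le_norm_Pair: "norm a \<le> norm (a, b)" "norm b \<le> norm (a, b)"
  by (simp_all add: norm_Pair real_le_rsqrt)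

text \<open>The pair of Wronskians of the Bessel function with the approximate solution and with its
  conjugate is almost constant, and so is the Wronskian of the two approximate solutions.\<close>

lemma lg_comparison_aux:
  assumes \<nu>: "\<nu> \<ge> 1"
    and res: "\<And>z. norm z \<le> 1 \<Longrightarrow> norm (cpoly (lg_residual M \<nu>) z) \<le> k"
    and phase: "\<And>z. norm z \<le> 1 \<Longrightarrow> norm (cpoly (pderiv (lg_phase M \<nu>)) z) \<le> \<nu> / 2"
    and small: "4 * k / \<nu> \<le> 1 / 6"
  obtains h0 where "\<And>x. x > 0 \<Longrightarrow>
    norm (bessel_Ji \<nu> (\<nu> * x) - lg_approx M \<nu> x * h0) \<le> 18 * (4 * k / \<nu>) * norm (lg_approx M \<nu> x * h0)"
proof -
  define A where "A = lg_approx M \<nu>"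
  define g where "g = lg_logderiv M \<nu>"
  define q where "q x = lg_error M \<nu> x / of_real x" for x
  define w where "w x = bessel_Ji \<nu> (\<nu> * x)" for x
  define w1 where "w1 x = bessel_Ji' \<nu> (\<nu> * x)" for x
  \<comment> \<open>\<open>A x * g x\<close> and \<open>w1 x\<close> are x A'(x) and x w'(x), so
    these are Wronskians with respect to ln x. Their derivatives contain the error \<open>q\<close>
    only.\<close>
  define a where "a x = w x * cnj (A x * g x) - w1 x * cnj (A x)" for x
  define b where "b x = w x * (A x * g x) - w1 x * A x" for x
  define D where "D x = A x * cnj (A x * g x) - (A x * g x) * cnj (A x)" for x
  \<comment> \<open>One factor 2 comes from bounding w by the two Wronskians, the other from the two
    components of the derivative of the pair.\<close>
  define \<kappa> where "\<kappa> = 4 * k / \<nu>"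
  have k0: "k \<ge> 0" using order_trans[OF norm_ge_zero res[of 0]] by simp
  then have \<kappa>0: "\<kappa> \<ge> 0" using \<nu> by (simp add: \<kappa>_def)
  have A': "(A has_vector_derivative A x * g x / of_real x) (at x)" if "x > 0" for x
    using has_vector_derivative_lg_approx[OF that] by (simp add: A_def g_def)
  have Ag': "((\<lambda>x. A x * g x) has_vector_derivative A x * (- of_real (\<nu>\<^sup>2 * (1 + x\<^sup>2)) / of_real x + q x)) (at x)"
    if "x > 0" for x
    by (rule has_vector_derivative_eq_rhs[OF has_vector_derivative_mult[OF A'[OF that]
           has_vector_derivative_lg_logderiv[where M = M and \<nu> = \<nu>, OF that, folded g_def]]])
       (use that in \<open>simp add: q_def field_simps power2_eq_square\<close>)
  have w': "(w has_vector_derivative w1 x / of_real x) (at x)" if "x > 0" for x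
  proof -
    have "((bessel_Ji \<nu> \<circ> (\<lambda>x. \<nu> * x)) has_vector_derivative \<nu> *\<^sub>R (bessel_Ji' \<nu> (\<nu> * x) / of_real (\<nu> * x))) (at x)"
      by (rule vector_diff_chain_at[OF has_vector_derivative_cmult], rule has_vector_derivative_bessel_Ji) (use that \<nu> in auto)
    then show ?thesis using \<nu> that
      by (simp add: w_def[abs_def] w1_def o_def scaleR_conv_of_real)
  qed
  have w1': "(w1 has_vector_derivative - of_real (\<nu>\<^sup>2 * (1 + x\<^sup>2)) / of_real x * w x) (at x)" if "x > 0" for x
  proof -
    have "((bessel_Ji' \<nu> \<circ> (\<lambda>x. \<nu> * x)) has_vector_derivative \<nu> *\<^sub>R (- of_real ((\<nu>\<^sup>2 + (\<nu> * x)\<^sup>2) / (\<nu> * x)) * bessel_Ji \<nu> (\<nu> * x))) (at x)"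
      by (rule vector_diff_chain_at[OF has_vector_derivative_cmult], rule has_vector_derivative_bessel_Ji') (use that \<nu> in auto)
    moreover have "\<nu> *\<^sub>R (- of_real ((\<nu>\<^sup>2 + (\<nu> * x)\<^sup>2) / (\<nu> * x)) * bessel_Ji \<nu> (\<nu> * x)) =
       - of_real (\<nu>\<^sup>2 * (1 + x\<^sup>2)) / of_real x * w x"
      using \<nu> that by (simp add: w_def scaleR_conv_of_real field_simps power2_eq_square)
    ultimately show ?thesis by (simp add: w1_def[abs_def] o_def)
  qed
  have a': "(a has_vector_derivative w x * cnj (q x * A x)) (at x)" if "x > 0" for x
    unfolding a_def[abs_def]
    by (rule has_vector_derivative_eq_rhs[OF has_vector_derivative_diff[OF
           has_vector_derivative_mult[OF w'[OF that] has_vector_derivative_cnj[OF Ag'[OF that]]]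
           has_vector_derivative_mult[OF w1'[OF that] has_vector_derivative_cnj[OF A'[OF that]]]]])
       (simp add: algebra_simps)
  have b': "(b has_vector_derivative w x * (q x * A x)) (at x)" if "x > 0" for x
    unfolding b_def[abs_def]
    by (rule has_vector_derivative_eq_rhs[OF has_vector_derivative_diff[OF
           has_vector_derivative_mult[OF w'[OF that] Ag'[OF that]]
           has_vector_derivative_mult[OF w1'[OF that] A'[OF that]]]])
       (simp add: algebra_simps)
  have D': "(D has_vector_derivative A x * cnj (A x) * (cnj (q x) - q x)) (at x)" if "x > 0" for x
    unfolding D_def[abs_def]
    by (rule has_vector_derivative_eq_rhs[OF has_vector_derivative_diff[OF
           has_vector_derivative_mult[OF A'[OF that] has_vector_derivative_cnj[OF Ag'[OF that]]]
           has_vector_derivative_mult[OF Ag'[OF that] has_vector_derivative_cnj[OF A'[OF that]]]]])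
       (simp add: algebra_simps)
  \<comment> \<open>Cramer's rule recovers w from the two Wronskians, which closes the system for
    \<open>a\<close> and \<open>b\<close>.\<close>
  have wD: "w x * D x = A x * a x - cnj (A x) * b x" for x
    by (simp add: D_def a_def b_def algebra_simps)
  have D_eq: "D x = - 2 * \<i> * of_real ((norm (A x))\<^sup>2 * Im (g x))" for x
  proof -
    have "D x = (A x * cnj (A x)) * (cnj (g x) - g x)" by (simp add: D_def algebra_simps)
    also have "cnj (g x) - g x = - 2 * \<i> * of_real (Im (g x))" by (simp add: complex_eq_iff)
    finally show ?thesis by (simp only: complex_norm_square[symmetric]) (simp add: mult_ac)
  qed
  have Apos: "norm (A x) > 0" for x unfolding A_def by (rule norm_lg_approx_pos)
  \<comment> \<open>The modulus of \<open>D\<close> is 2 |A|^2 |Im g|. The correction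
    \<open>Z\<close> takes away at most half of the leading part \<nu> r of Im g.\<close>
  have D_lower: "(norm (A x))\<^sup>2 * (\<nu> * sqrt (1 + x\<^sup>2)) \<le> norm (D x)" if x: "x > 0" for x
  proof -
    define r where "r = sqrt (1 + x\<^sup>2)"
    have r: "r \<ge> 1" "x\<^sup>2 \<le> r\<^sup>2" by (auto simp: r_def)
    define Z where "Z = \<i> * of_real (x\<^sup>2 / r ^ 3) * cpoly (pderiv (lg_phase M \<nu>)) (lg_beta x)"
    have "\<bar>Im Z\<bar> \<le> norm Z" by (rule abs_Im_le_cmod)
    also have "\<dots> = (x\<^sup>2 / r ^ 3) * norm (cpoly (pderiv (lg_phase M \<nu>)) (lg_beta x))"
      using r by (simp add: Z_def norm_mult norm_divide norm_power)
    also have "\<dots> \<le> r * (\<nu> / 2)"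
    proof (rule mult_mono)
      have "x\<^sup>2 / r ^ 3 \<le> r\<^sup>2 / r ^ 3" using r by (intro divide_right_mono) auto
      also have "\<dots> = 1 / r" using r by (simp add: power2_eq_square power3_eq_cube)
      also have "\<dots> \<le> 1" using r by simp
      also have "\<dots> \<le> r" by (rule r)
      finally show "x\<^sup>2 / r ^ 3 \<le> r" .
    qed (use r phase[OF norm_lg_beta] in auto)
    finally have "\<bar>Im Z\<bar> \<le> r * (\<nu> / 2)" .
    moreover have "g x = of_real (- (x\<^sup>2 / (2 * (1 + x\<^sup>2)))) + \<i> * of_real (\<nu> * r) + Z"
      by (simp only: g_def lg_logderiv_def Z_def r_def)
    then have "Im (g x) = \<nu> * r + Im Z"
      by (simp only: plus_complex.sel Im_complex_of_real Im_i_times Re_complex_of_real add_0_left)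
    ultimately have "Im (g x) \<ge> \<nu> * r - r * (\<nu> / 2)" by linarith
    then have "2 * Im (g x) \<ge> \<nu> * r" by simp
    then have "(norm (A x))\<^sup>2 * (\<nu> * r) \<le> (norm (A x))\<^sup>2 * (2 * Im (g x))"
      by (rule mult_left_mono) simp
    also have "\<dots> \<le> 2 * ((norm (A x))\<^sup>2 * \<bar>Im (g x)\<bar>)"
      using mult_left_mono[OF abs_ge_self[of "Im (g x)"], of "(norm (A x))\<^sup>2"] by (simp add: mult_ac)
    also have "\<dots> = norm (D x)" unfolding D_eq norm_mult norm_of_real by (simp add: abs_mult)
    finally show ?thesis unfolding r_def .
  qed
  have D_pos: "norm (D x) > 0" if "x > 0" for x
    using D_lower[OF that] Apos[of x] one_plus_sq_pos[of x] \<nu>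
    by (smt (verit) mult_pos_pos real_sqrt_gt_zero zero_less_power)
  define \<phi> where "\<phi> x = x / sqrt (1 + x\<^sup>2) ^ 3" for x :: real
  \<comment> \<open>The bound x / r^2 from the error, divided by \<nu> r from
    \<open>D_lower\<close>, is the Gronwall weight x / r^3 with one further factor 1 / \<nu>. This
    raises the final accuracy from order M to M + 1.\<close>
  have qA: "norm (q x) * (norm (A x))\<^sup>2 \<le> k / \<nu> * \<phi> x * norm (D x)" if x: "x > 0" for x
  proof -
    define r where "r = sqrt (1 + x\<^sup>2)"
    have r: "r \<ge> 1" "r * r = 1 + x\<^sup>2" by (auto simp: r_def)
    have "norm (q x) = x / (r * r) * norm (cpoly (lg_residual M \<nu>) (lg_beta x))"
    proof -
      have "norm (of_real (x\<^sup>2 / (1 + x\<^sup>2)) :: complex) = x\<^sup>2 / (1 + x\<^sup>2)"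
        unfolding norm_of_real using one_plus_sq_pos[of x] by simp
      then show ?thesis using x
        using r(1)
        by (simp only: q_def lg_error_def norm_mult norm_divide norm_minus_cancel norm_of_real r(2)[symmetric])
           (simp add: field_simps power2_eq_square)
    qed
    also have "\<dots> \<le> x / (r * r) * k" using x r by (intro mult_left_mono res norm_lg_beta) auto
    finally have "norm (q x) * (norm (A x))\<^sup>2 \<le> x / (r * r) * k * (norm (A x))\<^sup>2"
      by (rule mult_right_mono) simp
    also have "\<dots> = k / \<nu> * \<phi> x * ((norm (A x))\<^sup>2 * (\<nu> * r))"
      using \<nu> r(1) by (simp add: \<phi>_def power3_eq_cube flip: r_def)
    also have "\<dots> \<le> k / \<nu> * \<phi> x * norm (D x)"
      using D_lower[OF x] k0 \<nu> x r by (intro mult_left_mono) (auto simp: \<phi>_def r_def)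
    finally show ?thesis .
  qed
  have \<phi>0: "\<phi> x \<ge> 0" if "x > 0" for x using that by (simp add: \<phi>_def)
  define e where "e x = exp (\<i> * of_real (\<nu> * ln x))" for x
  have e1: "norm (e x) = 1" for x by (simp add: e_def)
  have e1: "norm (e x) = 1" "e x * cnj (e x) = 1" for x
    using e1[of x] by (simp_all flip: complex_norm_square)
  \<comment> \<open>\<open>w\<close> and \<open>A\<close> share the factor \<open>e\<close>, which
    has no limit at 0; the cofactors \<open>u\<close> and \<open>R\<close> are continuous there. In
    \<open>a\<close> and \<open>D\<close> the factor cancels against its conjugate.\<close>
  define u where "u x = exp (\<i> * of_real (\<nu> * ln (\<nu> / 2))) * bessel_ser (\<i> * of_real \<nu>) (of_real ((\<nu> * x)\<^sup>2 / 4))" for x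
  define u1 where "u1 x = exp (\<i> * of_real (\<nu> * ln (\<nu> / 2))) *
     (\<i> * of_real \<nu> * bessel_ser (\<i> * of_real \<nu>) (of_real ((\<nu> * x)\<^sup>2 / 4)) +
      of_real ((\<nu> * x)\<^sup>2 / 2) * bessel_ser' (\<i> * of_real \<nu>) (of_real ((\<nu> * x)\<^sup>2 / 4)))" for x
  define R where "R = lg_reg M \<nu>"
  have AR: "A x = e x * R x" for x by (simp add: A_def R_def e_def lg_approx_def)
  have wu: "w x = e x * u x" "w1 x = e x * u1 x" if "x > 0" for x
  proof -
    have "ln (\<nu> * x / 2) = ln x + ln (\<nu> / 2)"
      using that \<nu> by (simp add: ln_mult ln_div)
    then have "exp (\<i> * complex_of_real (\<nu> * ln (\<nu> * x / 2))) = e x * exp (\<i> * of_real (\<nu> * ln (\<nu> / 2)))"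
      by (simp add: e_def distrib_left exp_add)
    then show "w x = e x * u x" "w1 x = e x * u1 x"
      by (simp_all only: w_def w1_def u_def u1_def bessel_Ji_def bessel_Ji'_def mult.assoc)
  qed
  have \<mu>: "Re (\<i> * of_real \<nu>) \<ge> 0" by simp
  have "isCont u 0" "isCont u1 0"
    unfolding u_def[abs_def] u1_def[abs_def]
    by (intro continuous_intros isCont_o2[OF _ DERIV_isCont[OF has_field_derivative_bessel_ser[OF \<mu>]]]
        isCont_o2[OF _ DERIV_isCont[OF has_field_derivative_bessel_ser'[OF \<mu>]]]; simp)+
  note lims = this[THEN isCont_at_right] isCont_at_right[OF isCont_lg_reg[where M = M and \<nu> = \<nu> and x = 0, folded R_def]]
    isCont_at_right[OF isCont_lg_logderiv[where M = M and \<nu> = \<nu> and x = 0, folded g_def]]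
  have g0: "g 0 = \<i> * of_real \<nu>" by (simp add: g_def lg_logderiv_def)
  have u10: "u1 0 = \<i> * of_real \<nu> * u 0" by (simp add: u_def u1_def)
  define a0 where "a0 = u 0 * cnj (R 0 * g 0) - u1 0 * cnj (R 0)"
  define D0 where "D0 = R 0 * cnj (R 0 * g 0) - R 0 * g 0 * cnj (R 0)"
  have lim_a: "(a \<longlongrightarrow> a0) (at_right 0)"
  proof -
    have "((\<lambda>x. u x * cnj (R x * g x) - u1 x * cnj (R x)) \<longlongrightarrow> a0) (at_right 0)"
      unfolding a0_def by (intro tendsto_intros lims)
    moreover have "\<forall>\<^sub>F x in at_right 0. u x * cnj (R x * g x) - u1 x * cnj (R x) = a x"
      using eventually_at_right_less[of 0]
    proof eventually_elim
      case (elim x)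
      have "a x = (e x * cnj (e x)) * (u x * cnj (R x * g x) - u1 x * cnj (R x))"
        by (simp add: a_def AR wu[OF elim] algebra_simps)
      then show ?case by (simp add: e1)
    qed
    ultimately show ?thesis by (rule Lim_transform_eventually)
  qed
  have lim_D: "(D \<longlongrightarrow> D0) (at_right 0)"
  proof -
    have "((\<lambda>x. R x * cnj (R x * g x) - R x * g x * cnj (R x)) \<longlongrightarrow> D0) (at_right 0)"
      unfolding D0_def by (intro tendsto_intros lims)
    moreover have "R x * cnj (R x * g x) - R x * g x * cnj (R x) = D x" for x
    proof -
      have "D x = (e x * cnj (e x)) * (R x * cnj (R x * g x) - R x * g x * cnj (R x))"
        by (simp add: D_def AR algebra_simps)
      then show ?thesis by (simp add: e1)
    qed
    ultimately show ?thesis by simp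
  qed
  \<comment> \<open>The logarithmic derivatives of w and A with respect to ln x agree at 0, so the
    conjugate wave has no weight there. Here the factor is \<open>e x * e x\<close>, which does not
    converge, so the limit is taken in norm.\<close>
  have lim_b: "(b \<longlongrightarrow> 0) (at_right 0)"
  proof -
    have "((\<lambda>x. u x * (R x * g x) - u1 x * R x) \<longlongrightarrow> u 0 * (R 0 * g 0) - u1 0 * R 0) (at_right 0)"
      by (intro tendsto_intros lims)
    then have "((\<lambda>x. norm (u x * (R x * g x) - u1 x * R x)) \<longlongrightarrow> 0) (at_right 0)"
      by (simp add: g0 u10 mult_ac tendsto_norm_zero)
    moreover have "\<forall>\<^sub>F x in at_right 0. norm (u x * (R x * g x) - u1 x * R x) = norm (b x)"
      using eventually_at_right_less[of 0]
    proof eventually_elim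
      case (elim x)
      have "b x = (e x * e x) * (u x * (R x * g x) - u1 x * R x)"
        by (simp add: b_def AR wu[OF elim] algebra_simps)
      then show ?case by (simp add: e1 norm_mult)
    qed
    ultimately have "((\<lambda>x. norm (b x)) \<longlongrightarrow> 0) (at_right 0)" by (rule Lim_transform_eventually)
    then show ?thesis by (rule tendsto_norm_zero_cancel)
  qed
  have D0: "D0 \<noteq> 0"
  proof -
    have "D0 = - 2 * \<i> * of_real \<nu> * (R 0 * cnj (R 0))" by (simp add: D0_def g0)
    moreover have "R 0 \<noteq> 0" by (simp add: R_def lg_reg_def)
    ultimately show ?thesis using \<nu> by simp
  qed
  have exp_small: "\<kappa> * exp \<kappa> \<le> 3 * \<kappa>"
  proof -
    have "exp \<kappa> \<le> exp 1" using small by (simp add: \<kappa>_def)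
    also have "\<dots> \<le> 3" by (rule exp_le)
    finally show ?thesis using \<kappa>0 by (simp add: mult_left_mono mult.commute)
  qed
  have D_var: "norm (D x - D0) \<le> 3 * \<kappa> * norm D0" if "x > 0" for x
  proof -
    have "norm (D x - D0) \<le> \<kappa> * exp \<kappa> * norm D0"
    proof (rule gronwall_from_zero[OF \<kappa>0 D' _ lim_D that])
      fix x :: real assume x: "x > 0"
      have "norm (A x * cnj (A x) * (cnj (q x) - q x)) \<le> (norm (A x))\<^sup>2 * (norm (q x) + norm (q x))"
        unfolding norm_mult complex_mod_cnj power2_eq_square
        using norm_triangle_ineq4[of "cnj (q x)" "q x"] by (intro mult_left_mono) auto
      also have "\<dots> = 2 * (norm (q x) * (norm (A x))\<^sup>2)" by simp
      also have "\<dots> \<le> 2 * (k / \<nu> * \<phi> x * norm (D x))" using qA[OF x] by simp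
      also have "\<dots> \<le> 4 * (k / \<nu> * \<phi> x * norm (D x))"
      proof -
        have "0 \<le> k / \<nu> * \<phi> x * norm (D x)"
          using k0 \<nu> \<phi>0[OF x] by (intro mult_nonneg_nonneg divide_nonneg_nonneg) auto
        then show ?thesis by (rule mult_right_mono[rotated]) simp
      qed
      finally show "norm (A x * cnj (A x) * (cnj (q x) - q x)) \<le> \<kappa> * (x / sqrt (1 + x\<^sup>2) ^ 3) * norm (D x)"
        by (simp add: \<kappa>_def \<phi>_def)
    qed
    then show ?thesis using mult_right_mono[OF exp_small norm_ge_zero[of D0]] by linarith
  qed
  \<comment> \<open>The derivatives of \<open>a\<close> and \<open>b\<close> both involve w, hence
    both Wronskians, so the pair is estimated jointly from its initial value
    \<open>(a0, 0)\<close>.\<close>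
  have ab_var: "norm ((a x, b x) - (a0, 0)) \<le> 3 * \<kappa> * norm a0" if "x > 0" for x
  proof -
    have "norm ((a x, b x) - (a0, 0)) \<le> \<kappa> * exp \<kappa> * norm (a0, 0::complex)"
    proof (rule gronwall_from_zero[OF \<kappa>0 has_vector_derivative_Pair[OF a' b'] _ tendsto_Pair[OF lim_a lim_b] that])
      fix x :: real assume x: "x > 0"
      have "norm (w x) * norm (D x) \<le> norm (A x) * (norm (a x) + norm (b x))"
        using norm_triangle_ineq4[of "A x * a x" "cnj (A x) * b x"]
        by (simp add: norm_mult[symmetric] wD) (simp add: norm_mult algebra_simps)
      also have "\<dots> \<le> norm (A x) * (2 * norm (a x, b x))"
        using norm_le_norm_Pair(1)[of "a x" "b x"] norm_le_norm_Pair(2)[of "b x" "a x"]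
        by (intro mult_left_mono) auto
      finally have wb: "norm (w x) * norm (D x) \<le> 2 * norm (A x) * norm (a x, b x)" by simp
      have "norm (w x * cnj (q x * A x), w x * (q x * A x)) \<le> 2 * (norm (w x) * (norm (q x) * norm (A x)))"
        by (rule order_trans[OF norm_Pair_le_sum]) (simp add: norm_mult)
      also have "\<dots> \<le> 4 * (k / \<nu> * \<phi> x) * norm (a x, b x)"
      proof -
        have "norm (w x) * (norm (q x) * norm (A x)) * norm (D x)
            \<le> (2 * norm (A x) * norm (a x, b x)) * (norm (q x) * norm (A x))"
          using mult_right_mono[OF wb, of "norm (q x) * norm (A x)"] by (simp add: mult_ac)
        also have "\<dots> = 2 * norm (a x, b x) * (norm (q x) * (norm (A x))\<^sup>2)"
          by (simp add: power2_eq_square)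
        also have "\<dots> \<le> 2 * norm (a x, b x) * (k / \<nu> * \<phi> x * norm (D x))"
          by (rule mult_left_mono[OF qA[OF x]]) simp
        finally have le: "norm (w x) * (norm (q x) * norm (A x)) * norm (D x)
            \<le> 2 * norm (a x, b x) * (k / \<nu> * \<phi> x * norm (D x))" .
        have "norm (w x) * (norm (q x) * norm (A x)) \<le> 2 * norm (a x, b x) * (k / \<nu> * \<phi> x)"
          by (rule mult_right_le_imp_le[OF _ D_pos[OF x]]) (use le in \<open>simp only: mult.assoc\<close>)
        then have "2 * (norm (w x) * (norm (q x) * norm (A x))) \<le> 2 * (2 * norm (a x, b x) * (k / \<nu> * \<phi> x))"
          by (rule mult_left_mono) simp
        moreover have "2 * (2 * y * z) = 4 * z * y" for y z :: real by simp
        ultimately show ?thesis by (simp only:)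
      qed
      finally show "norm (w x * cnj (q x * A x), w x * (q x * A x))
          \<le> \<kappa> * (x / sqrt (1 + x\<^sup>2) ^ 3) * norm (a x, b x)"
        by (simp add: \<kappa>_def \<phi>_def)
    qed
    also have "norm (a0, 0::complex) = norm a0" by (simp add: norm_Pair)
    also have "\<kappa> * exp \<kappa> * norm a0 \<le> 3 * \<kappa> * norm a0"
      by (rule mult_right_mono[OF exp_small norm_ge_zero])
    finally show ?thesis .
  qed
  \<comment> \<open>The constant is \<open>a0 / D0\<close>. The variations of \<open>a\<close>,
    \<open>b\<close> and \<open>D\<close> cost \<open>3 * \<kappa>\<close> each, and passing from
    \<open>D0\<close> to \<open>D x\<close> doubles the sum: this is the 18.\<close>
  have "norm (w x - A x * (a0 / D0)) \<le> 18 * \<kappa> * norm (A x * (a0 / D0))" if x: "x > 0" for x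
  proof -
    have "norm D0 - norm (D x) \<le> norm (D x - D0)"
      using norm_triangle_ineq2[of D0 "D x"] by (simp add: norm_minus_commute)
    also have "\<dots> \<le> 3 * \<kappa> * norm D0" by (rule D_var[OF x])
    also have "\<dots> \<le> (1 / 2) * norm D0" using small by (intro mult_right_mono) (auto simp: \<kappa>_def)
    finally have Dhalf: "norm D0 \<le> 2 * norm (D x)" by simp
    have Dx: "D x \<noteq> 0" using D_pos[OF x] by auto
    have 1: "norm (a x - a0) \<le> 3 * \<kappa> * norm a0" and 2: "norm (b x) \<le> 3 * \<kappa> * norm a0"
      using ab_var[OF x] norm_le_norm_Pair(1)[of "a x - a0" "b x"] norm_le_norm_Pair(2)[of "b x" "a x - a0"] by auto
    have "(w x - A x * (a0 / D0)) * D x = A x * (a x - a0) - cnj (A x) * b x - A x * (a0 / D0) * (D x - D0)"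
      using D0 by (simp add: left_diff_distrib wD) (simp add: field_simps)
    then have "norm (w x - A x * (a0 / D0)) * norm (D x) =
        norm (A x * (a x - a0) - cnj (A x) * b x - A x * (a0 / D0) * (D x - D0))"
      by (simp add: norm_mult[symmetric])
    also have "\<dots> \<le> norm (A x * (a x - a0)) + norm (cnj (A x) * b x) + norm (A x * (a0 / D0) * (D x - D0))"
      by (meson norm_triangle_ineq4 order_trans add_right_mono)
    also have "\<dots> = norm (A x) * norm (a x - a0) + norm (A x) * norm (b x) + norm (A x * (a0 / D0)) * norm (D x - D0)"
      by (simp only: norm_mult complex_mod_cnj)
    also have "\<dots> \<le> norm (A x) * (3 * \<kappa> * norm a0) + norm (A x) * (3 * \<kappa> * norm a0) +
        norm (A x * (a0 / D0)) * (3 * \<kappa> * norm D0)"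
      by (intro add_mono mult_left_mono 1 2 D_var[OF x]) auto
    also have "\<dots> = 9 * \<kappa> * norm (A x * (a0 / D0)) * norm D0"
      using D0 by (simp add: norm_mult norm_divide)
    also have "\<dots> \<le> 9 * \<kappa> * norm (A x * (a0 / D0)) * (2 * norm (D x))"
      using Dhalf \<kappa>0 by (intro mult_left_mono) auto
    finally have "norm (w x - A x * (a0 / D0)) * norm (D x) \<le> 18 * \<kappa> * norm (A x * (a0 / D0)) * norm (D x)"
      by simp
    then show ?thesis using D_pos[OF x] by simp
  qed
  then show ?thesis by (intro that[of "a0 / D0"]) (simp add: w_def A_def \<kappa>_def)
qed

lemma lg_comparison:
  "\<exists>C>0. \<exists>\<nu>0\<ge>1. \<forall>\<nu>\<ge>\<nu>0. \<exists>h0. \<forall>x>0.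
     norm (bessel_Ji \<nu> (\<nu> * x) - lg_approx M \<nu> x * h0) \<le> C / \<nu> ^ (M + 1) * norm (lg_approx M \<nu> x * h0)"
proof -
  obtain C1 where C1: "C1 > 0"
    "\<And>\<nu> z. \<nu> \<ge> 1 \<Longrightarrow> norm z \<le> 1 \<Longrightarrow> norm (cpoly (lg_residual M \<nu>) z) \<le> C1 / \<nu> ^ M"
    using lg_residual_bound by blast
  obtain C2 where C2: "C2 > 0"
    "\<And>\<nu> z. \<nu> \<ge> 1 \<Longrightarrow> norm z \<le> 1 \<Longrightarrow> norm (cpoly (pderiv (lg_phase M \<nu>)) z) \<le> C2 / \<nu>"
    using lg_phase_deriv_bound by blast
  \<comment> \<open>\<open>2 * C2\<close> secures the assumption \<open>phase\<close> of
    \<open>lg_comparison_aux\<close>, and \<open>24 * C1\<close> the assumption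
    \<open>small\<close>.\<close>
  define \<nu>0 where "\<nu>0 = 1 + 2 * C2 + 24 * C1"
  have "\<exists>h0. \<forall>x>0. norm (bessel_Ji \<nu> (\<nu> * x) - lg_approx M \<nu> x * h0)
      \<le> 72 * C1 / \<nu> ^ (M + 1) * norm (lg_approx M \<nu> x * h0)" if "\<nu> \<ge> \<nu>0" for \<nu>
  proof -
    have \<nu>: "\<nu> \<ge> 1" "2 * C2 \<le> \<nu>" "24 * C1 \<le> \<nu>" using that C1(1) C2(1) by (auto simp: \<nu>0_def)
    have pw: "1 \<le> \<nu> ^ M" using \<nu> by simp
    show ?thesis
    proof (rule lg_comparison_aux[of \<nu> M "C1 / \<nu> ^ M"])
      show "norm (cpoly (lg_residual M \<nu>) z) \<le> C1 / \<nu> ^ M" if "norm z \<le> 1" for z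
        using C1(2) \<nu>(1) that by blast
      have "C2 / \<nu> \<le> C2" using C2(1) \<nu>(1) by (simp add: divide_le_eq)
      then show "norm (cpoly (pderiv (lg_phase M \<nu>)) z) \<le> \<nu> / 2" if "norm z \<le> 1" for z
        using C2(2)[OF \<nu>(1) that] \<nu>(2) by linarith
      have "C1 / \<nu> ^ M \<le> C1" using C1(1) pw by (simp add: divide_le_eq)
      then have "24 * (C1 / \<nu> ^ M) \<le> \<nu>" using \<nu>(3) by linarith
      then show "4 * (C1 / \<nu> ^ M) / \<nu> \<le> 1 / 6" using \<nu>(1) by (simp add: divide_le_eq mult.commute)
      fix h0 assume h0: "\<And>x. x > 0 \<Longrightarrow> norm (bessel_Ji \<nu> (\<nu> * x) - lg_approx M \<nu> x * h0)
         \<le> 18 * (4 * (C1 / \<nu> ^ M) / \<nu>) * norm (lg_approx M \<nu> x * h0)"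
      then show ?thesis by (intro exI[of _ h0]) (simp add: mult_ac)
    qed (use \<nu> in auto)
  qed
  moreover have "\<nu>0 \<ge> 1" "72 * C1 > 0" using C1(1) C2(1) by (auto simp: \<nu>0_def)
  ultimately show ?thesis by blast
qed

section \<open>Laplace transforms\<close>

lemma set_borel_measurable_continuous:
  fixes f :: "real \<Rightarrow> 'a::real_normed_vector"
  shows "continuous_on {0<..} f \<Longrightarrow> set_borel_measurable lborel {0<..} f"
  unfolding set_borel_measurable_def
  using borel_measurable_continuous_on_indicator[of "{0<..}" f] by simp

lemma set_integrable_powr_exp:
  assumes "Re z > -1" "\<epsilon> > 0"
  shows "set_integrable lborel {0<..} (\<lambda>t. complex_of_real t powr z * of_real (exp (- (\<epsilon> * t))))"
proof -
  let ?f = "\<lambda>t. complex_of_real t powr z * of_real (exp (- (\<epsilon> * t)))"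
  have "?f absolutely_integrable_on {0<..}"
    using absolutely_integrable_Gamma_integral[of "z + 1" \<epsilon>] assms by (simp add: exp_minus field_simps)
  moreover have "set_borel_measurable lborel {0<..} ?f"
    by (intro set_borel_measurable_continuous continuous_intros) auto
  ultimately show ?thesis
    by (simp add: set_integrable_def set_borel_measurable_def integrable_completion)
qed

lemma set_integral_powr_exp:
  assumes "Re z > -1" "\<epsilon> > 0"
  shows "(LINT t:{0<..}|lborel. complex_of_real t powr z * of_real (exp (- (\<epsilon> * t)))) =
    Gamma (z + 1) / (of_real \<epsilon> powr (z + 1))"
proof -
  let ?f = "\<lambda>\<epsilon> t. complex_of_real t powr z * of_real (exp (- (\<epsilon> * t)))"
  have "(LINT t:{0<..}|lborel. ?f 1 t) = integral {0<..} (?f 1)"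
    by (rule set_borel_integral_eq_integral(2)[OF set_integrable_powr_exp[OF assms(1)]]) simp
  also have "\<dots> = Gamma (z + 1)"
    using Gamma_integral_complex'[of "z + 1"] assms
    by (intro integral_unique) (simp add: exp_minus field_simps)
  finally have 1: "(LINT t:{0<..}|lborel. ?f 1 t) = Gamma (z + 1)" .
  \<comment> \<open>Rescaling t by \<epsilon> turns the general integral into Euler's
    integral.\<close>
  have "(LINT t:{0<..}|lborel. ?f 1 t) = \<bar>\<epsilon>\<bar> *\<^sub>R (\<integral>t. indicator {0<..} (0 + \<epsilon> * t) *\<^sub>R ?f 1 (0 + \<epsilon> * t) \<partial>lborel)"
    unfolding set_lebesgue_integral_def using assms by (intro lborel_integral_real_affine) auto
  also have "(\<lambda>t. indicator {0<..} (0 + \<epsilon> * t) *\<^sub>R ?f 1 (0 + \<epsilon> * t)) =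
      (\<lambda>t. of_real \<epsilon> powr z * (indicator {0<..} t *\<^sub>R ?f \<epsilon> t))"
    using assms by (auto simp: fun_eq_iff indicator_def zero_less_mult_iff powr_times_real)
  also have "(\<integral>t. of_real \<epsilon> powr z * (indicator {0<..} t *\<^sub>R ?f \<epsilon> t) \<partial>lborel) =
      of_real \<epsilon> powr z * (LINT t:{0<..}|lborel. ?f \<epsilon> t)"
    unfolding set_lebesgue_integral_def by (rule integral_mult_right_zero)
  finally show ?thesis
    unfolding 1 using assms by (simp add: powr_add field_simps scaleR_conv_of_real)
qed

lemma set_integrable_powr_exp_real:
  fixes a \<epsilon> :: real
  assumes "a > -1" "\<epsilon> > 0"
  shows "set_integrable lborel {0<..} (\<lambda>t. t powr a * exp (- (\<epsilon> * t)))"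
proof -
  have "set_integrable lborel {0<..} (\<lambda>t. norm (complex_of_real t powr of_real a * of_real (exp (- (\<epsilon> * t)))))"
    using assms by (intro set_integrable_norm set_integrable_powr_exp) auto
  then show ?thesis
    by (rule set_integrable_cong[THEN iffD1, rotated -1]) (auto simp: powr_of_real norm_mult)
qed

lemma set_integral_powr_exp_real:
  fixes a \<epsilon> :: real
  assumes "a > -1" "\<epsilon> > 0"
  shows "(LINT t:{0<..}|lborel. t powr a * exp (- (\<epsilon> * t))) = Gamma (a + 1) / \<epsilon> powr (a + 1)"
proof -
  have "complex_of_real (LINT t:{0<..}|lborel. t powr a * exp (- (\<epsilon> * t))) =
     (LINT t:{0<..}|lborel. complex_of_real (t powr a * exp (- (\<epsilon> * t))))"
    by (rule set_integral_complex_of_real[symmetric])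
  also have "\<dots> = (LINT t:{0<..}|lborel. complex_of_real t powr of_real a * of_real (exp (- (\<epsilon> * t))))"
    by (rule set_lebesgue_integral_cong) (auto simp: powr_of_real)
  also have "\<dots> = Gamma (of_real a + 1) / of_real \<epsilon> powr (of_real a + 1)"
    by (rule set_integral_powr_exp) (use assms in auto)
  also have "\<dots> = of_real (Gamma (a + 1) / \<epsilon> powr (a + 1))"
    using assms Gamma_complex_of_real[of "a + 1"] powr_of_real[of \<epsilon> "a + 1"] by simp
  finally show ?thesis by (simp only: of_real_eq_iff)
qed

lemma set_integrable_power_exp:
  fixes \<epsilon> :: real
  assumes "\<epsilon> > 0"
  shows "set_integrable lborel {0<..} (\<lambda>t. t ^ k * exp (- (\<epsilon> * t)))"
  by (rule set_integrable_cong[THEN iffD1, rotated -1, OF set_integrable_powr_exp_real[of "real k" \<epsilon>]])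
     (use assms in \<open>auto simp: powr_realpow\<close>)

lemma set_integral_power_exp:
  fixes \<epsilon> :: real
  assumes "\<epsilon> > 0"
  shows "(LINT t:{0<..}|lborel. t ^ k * exp (- (\<epsilon> * t))) = fact k / \<epsilon> ^ (k + 1)"
proof -
  have "(LINT t:{0<..}|lborel. t ^ k * exp (- (\<epsilon> * t))) = (LINT t:{0<..}|lborel. t powr real k * exp (- (\<epsilon> * t)))"
    by (rule set_lebesgue_integral_cong) (auto simp: powr_realpow)
  also have "\<dots> = fact k / \<epsilon> ^ (k + 1)"
    using assms set_integral_powr_exp_real[of "real k" \<epsilon>] powr_realpow[of \<epsilon> "k + 1"] Gamma_fact[of k, where 'a = real]
    by (simp add: add.commute)
  finally show ?thesis .
qed

text \<open>A quadratic remainder on the whole line; it serves to differentiate Laplace integrals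
  under the integral sign.\<close>

lemma abs_exp_minus_one_minus_le: "\<bar>exp x - 1 - x\<bar> \<le> x\<^sup>2 * exp \<bar>x\<bar>" for x :: real
proof -
  have "exp x * (1 - x) \<le> exp x * exp (- x)"
    using exp_ge_add_one_self[of "- x"] by (intro mult_left_mono) auto
  then have le: "exp x - 1 - x \<le> x * (exp x - 1)" by (simp add: algebra_simps flip: exp_add)
  have "x * (exp x - 1) \<le> x\<^sup>2 * exp \<bar>x\<bar>"
  proof (cases "x \<ge> 0")
    case True
    have "exp x * (1 - x) \<le> 1" using le by (simp add: algebra_simps)
    then have "exp x - 1 \<le> x * exp x" by (simp add: algebra_simps)
    then have "x * (exp x - 1) \<le> x * (x * exp x)" using True by (rule mult_left_mono)
    then show ?thesis using True by (simp add: power2_eq_square mult.assoc)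
  next
    case False
    have "(- x) * (1 - exp x) \<le> (- x) * (- x)"
      using exp_ge_add_one_self[of x] False by (intro mult_left_mono) linarith+
    then have "x * (exp x - 1) \<le> x\<^sup>2 * 1" by (simp add: power2_eq_square algebra_simps)
    also have "\<dots> \<le> x\<^sup>2 * exp \<bar>x\<bar>" by (intro mult_left_mono) auto
    finally show ?thesis .
  qed
  then show ?thesis using le exp_ge_add_one_self[of x] by linarith
qed

section \<open>Laplace moments and an Abelian estimate\<close>

text \<open>Up to the sign (-1)^k, the k-th derivative of the Laplace transform of \<open>g\<close>.
  The parameter stays real; an imaginary shift of the Laplace variable is put into
  \<open>g\<close>.\<close>

definition laplace_moment :: "(real \<Rightarrow> complex) \<Rightarrow> nat \<Rightarrow> real \<Rightarrow> complex" where
  "laplace_moment g k \<epsilon> = (LINT t:{0<..}|lborel. of_real (t ^ k * exp (- (\<epsilon> * t))) * g t)"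

lemma set_integrable_dominated:
  fixes f :: "real \<Rightarrow> complex"
  assumes "continuous_on {0<..} f" "set_integrable lborel {0<..} h"
    "\<And>t. t > 0 \<Longrightarrow> norm (f t) \<le> h t"
  shows "set_integrable lborel {0<..} f"
  by (rule set_integrable_bound[OF assms(2) set_borel_measurable_continuous[OF assms(1)]])
     (use assms(3) in \<open>auto intro!: AE_I2 order_trans[OF _ abs_ge_self]\<close>)

lemma norm_set_integral_dominated:
  fixes f :: "real \<Rightarrow> complex"
  assumes "continuous_on {0<..} f" "set_integrable lborel {0<..} h"
    "\<And>t. t > 0 \<Longrightarrow> norm (f t) \<le> h t"
  shows "norm (LINT t:{0<..}|lborel. f t) \<le> (LINT t:{0<..}|lborel. h t)"
proof -
  have f: "set_integrable lborel {0<..} f" by (rule set_integrable_dominated[OF assms])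
  have "norm (LINT t:{0<..}|lborel. f t) \<le> (LINT t:{0<..}|lborel. norm (f t))"
    by (rule set_integral_norm_bound[OF f])
  also have "\<dots> \<le> (LINT t:{0<..}|lborel. h t)"
    by (rule set_integral_mono[OF set_integrable_norm[OF f] assms(2)]) (use assms(3) in auto)
  finally show ?thesis .
qed

context
  fixes g :: "real \<Rightarrow> complex" and K :: real
  assumes g_cont: "continuous_on {0<..} g" and g_bound: "\<And>t. t > 0 \<Longrightarrow> norm (g t) \<le> K"
begin

lemma set_integrable_laplace_moment:
  assumes "\<epsilon> > 0"
  shows "set_integrable lborel {0<..} (\<lambda>t. of_real (t ^ k * exp (- (\<epsilon> * t))) * g t)"
proof (rule set_integrable_dominated)
  show "set_integrable lborel {0<..} (\<lambda>t. K * (t ^ k * exp (- (\<epsilon> * t))))"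
    using set_integrable_power_exp[OF assms] by simp
  show "norm (of_real (t ^ k * exp (- (\<epsilon> * t))) * g t) \<le> K * (t ^ k * exp (- (\<epsilon> * t)))" if "t > 0" for t
    using mult_right_mono[OF g_bound[OF that], of "t ^ k * exp (- (\<epsilon> * t))"] that
    by (simp add: norm_mult norm_power mult_ac)
qed (intro continuous_intros g_cont)

text \<open>For |h| < \<epsilon> / 2, half of the decay of exp (- \<epsilon> t) absorbs the growth
  exp (|h| t) of the remainder. What is left is a moment of order k + 2 at \<epsilon> / 2, so the
  error is quadratic in h.\<close>

lemma has_vector_derivative_laplace_moment:
  assumes \<epsilon>: "\<epsilon> > 0"
  shows "(laplace_moment g k has_vector_derivative - laplace_moment g (k + 1) \<epsilon>) (at \<epsilon>)"
proof -
  define C where "C = K * (fact (k + 2) / (\<epsilon> / 2) ^ (k + 2 + 1))"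
  have bound: "norm (laplace_moment g k (\<epsilon> + h) - laplace_moment g k \<epsilon> + h *\<^sub>R laplace_moment g (k + 1) \<epsilon>) \<le> C * h\<^sup>2"
    if h: "\<bar>h\<bar> < \<epsilon> / 2" for h
  proof -
    let ?f = "\<lambda>t. of_real (t ^ k * exp (- (\<epsilon> * t)) * (exp (- (h * t)) - 1 - (- (h * t)))) * g t"
    have \<epsilon>h: "\<epsilon> + h > 0" using h by linarith
    have "laplace_moment g k (\<epsilon> + h) - laplace_moment g k \<epsilon> + h *\<^sub>R laplace_moment g (k + 1) \<epsilon> =
      (LINT t:{0<..}|lborel. of_real (t ^ k * exp (- ((\<epsilon> + h) * t))) * g t - of_real (t ^ k * exp (- (\<epsilon> * t))) * g t
         + of_real h * (of_real (t ^ (k + 1) * exp (- (\<epsilon> * t))) * g t))"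
      unfolding laplace_moment_def scaleR_conv_of_real
      by (subst set_integral_add set_integral_diff set_integral_mult_right,
          (intro set_integrable_laplace_moment set_integral_diff set_integrable_mult_right \<epsilon> \<epsilon>h)+)+ simp
    also have "\<dots> = (LINT t:{0<..}|lborel. ?f t)"
      by (rule set_lebesgue_integral_cong) (auto simp: algebra_simps exp_add exp_diff exp_minus divide_simps)
    finally have eq: "laplace_moment g k (\<epsilon> + h) - laplace_moment g k \<epsilon> + h *\<^sub>R laplace_moment g (k + 1) \<epsilon> = \<dots>" .
    have "norm (LINT t:{0<..}|lborel. ?f t) \<le> (LINT t:{0<..}|lborel. (K * h\<^sup>2) * (t ^ (k + 2) * exp (- (\<epsilon> / 2 * t))))"
    proof (rule norm_set_integral_dominated)
      show "continuous_on {0<..} ?f" by (intro continuous_intros g_cont)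
      show "set_integrable lborel {0<..} (\<lambda>t. (K * h\<^sup>2) * (t ^ (k + 2) * exp (- (\<epsilon> / 2 * t))))"
        using set_integrable_power_exp[of "\<epsilon> / 2" "k + 2"] \<epsilon> by simp
      fix t :: real assume t: "t > 0"
      have K: "K \<ge> 0" using order_trans[OF norm_ge_zero g_bound[of 1]] by simp
      have "\<bar>exp (- (h * t)) - 1 - (- (h * t))\<bar> \<le> (h * t)\<^sup>2 * exp (\<bar>h\<bar> * t)"
        using abs_exp_minus_one_minus_le[of "- (h * t)"] t by (simp add: abs_mult)
      also have "\<dots> \<le> (h * t)\<^sup>2 * exp (\<epsilon> / 2 * t)"
        using h t by (intro mult_left_mono) auto
      finally have e: "\<bar>exp (- (h * t)) - 1 - (- (h * t))\<bar> \<le> (h * t)\<^sup>2 * exp (\<epsilon> / 2 * t)" .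
      have "norm (?f t) = t ^ k * exp (- (\<epsilon> * t)) * \<bar>exp (- (h * t)) - 1 - (- (h * t))\<bar> * norm (g t)"
        unfolding norm_mult norm_of_real abs_mult using t by simp
      also have "\<dots> \<le> t ^ k * exp (- (\<epsilon> * t)) * ((h * t)\<^sup>2 * exp (\<epsilon> / 2 * t)) * K"
        using t K by (intro mult_mono e g_bound mult_nonneg_nonneg) auto
      also have "\<dots> = (K * h\<^sup>2) * (t ^ (k + 2) * (exp (- (\<epsilon> * t)) * exp (\<epsilon> / 2 * t)))"
        by (simp add: power_mult_distrib power_add power2_eq_square mult_ac)
      also have "exp (- (\<epsilon> * t)) * exp (\<epsilon> / 2 * t) = exp (- (\<epsilon> / 2 * t))"
        by (simp flip: exp_add)
      finally show "norm (?f t) \<le> (K * h\<^sup>2) * (t ^ (k + 2) * exp (- (\<epsilon> / 2 * t)))" .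
    qed
    also have "\<dots> = C * h\<^sup>2"
      using set_integral_power_exp[of "\<epsilon> / 2" "k + 2"] \<epsilon> by (simp add: C_def del: fact_Suc power_Suc)
    finally show ?thesis unfolding eq .
  qed
  show ?thesis
    unfolding has_vector_derivative_def has_derivative_at
  proof
    show "bounded_linear (\<lambda>h. h *\<^sub>R - laplace_moment g (k + 1) \<epsilon>)" by (rule bounded_linear_scaleR_left)
    show "(\<lambda>h. norm (laplace_moment g k (\<epsilon> + h) - laplace_moment g k \<epsilon> - h *\<^sub>R - laplace_moment g (k + 1) \<epsilon>) / norm h) \<midarrow>0\<rightarrow> 0"
    proof (rule Lim_null_comparison)
      show "((\<lambda>h. C * \<bar>h\<bar>) \<longlongrightarrow> 0) (at 0)" by (auto intro!: tendsto_eq_intros)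
      show "\<forall>\<^sub>F h in at 0. norm (norm (laplace_moment g k (\<epsilon> + h) - laplace_moment g k \<epsilon> - h *\<^sub>R - laplace_moment g (k + 1) \<epsilon>) / norm h)
          \<le> C * \<bar>h\<bar>"
        unfolding eventually_at
      proof (intro exI conjI ballI impI)
        show "\<epsilon> / 2 > 0" using \<epsilon> by simp
        fix h :: real assume "h \<noteq> 0 \<and> dist h 0 < \<epsilon> / 2"
        then have h: "h \<noteq> 0" "\<bar>h\<bar> < \<epsilon> / 2" by auto
        show "norm (norm (laplace_moment g k (\<epsilon> + h) - laplace_moment g k \<epsilon> - h *\<^sub>R - laplace_moment g (k + 1) \<epsilon>) / norm h)
          \<le> C * \<bar>h\<bar>"
          using bound[OF h(2)] h(1) by (simp add: divide_le_eq power2_eq_square abs_mult_self_eq mult.assoc)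
      qed
    qed
  qed
qed

text \<open>The kernel \<open>\<epsilon>\<^sup>1\<^sup>/\<^sup>2 exp (- \<epsilon> t) t\<^sup>-\<^sup>1\<^sup>/\<^sup>2\<close> is positive and has constant mass, so the limit
  is controlled by the behaviour of \<open>t\<^sup>1\<^sup>/\<^sup>2 g(t)\<close> for large \<open>t\<close> without any convergence.\<close>

lemma abelian_bound:
  fixes c l :: complex and T \<eta> :: real
  assumes lim: "((\<lambda>\<epsilon>. sqrt \<epsilon> * laplace_moment g 0 \<epsilon>) \<longlongrightarrow> l) (at_right 0)"
    and T: "\<And>t. t > T \<Longrightarrow> norm (sqrt t * g t - c) \<le> \<eta>" and \<eta>: "\<eta> \<ge> 0"
  shows "norm (l - c * sqrt pi) \<le> \<eta> * sqrt pi"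
proof -
  have K: "K \<ge> 0" using order_trans[OF norm_ge_zero g_bound[of 1]] by simp
  \<comment> \<open>A majorant for the range t \<le> T, where exp (|T| - t) \<ge> 1. It does not
    depend on \<epsilon>, so its contribution \<open>sqrt \<epsilon> * B\<close> vanishes in the
    limit.\<close>
  define h where "h t = exp \<bar>T\<bar> * (K * (t ^ 0 * exp (- (1 * t))) + norm c * (t powr (- 1 / 2) * exp (- (1 * t))))" for t :: real
  have h_int: "set_integrable lborel {0<..} h"
    unfolding h_def
    by (intro set_integrable_mult_right set_integral_add set_integrable_power_exp set_integrable_powr_exp_real) auto
  define B where "B = (LINT t:{0<..}|lborel. h t)"
  have key: "norm (sqrt \<epsilon> * laplace_moment g 0 \<epsilon> - c * sqrt pi) \<le> \<eta> * sqrt pi + sqrt \<epsilon> * B" if \<epsilon>: "\<epsilon> > 0" for \<epsilon>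
  proof -
    let ?k = "\<lambda>t. t powr (- 1 / 2) * exp (- (\<epsilon> * t))"
    let ?f = "\<lambda>t. of_real (t ^ 0 * exp (- (\<epsilon> * t))) * g t - c * of_real (?k t)"
    have kint: "set_integrable lborel {0<..} ?k"
      by (rule set_integrable_powr_exp_real) (use \<epsilon> in auto)
    have kval: "(LINT t:{0<..}|lborel. ?k t) = sqrt pi / sqrt \<epsilon>"
      using set_integral_powr_exp_real[of "- 1 / 2" \<epsilon>] \<epsilon> Gamma_one_half_real by (simp add: powr_half_sqrt)
    have ck: "set_integrable lborel {0<..} (\<lambda>t. norm c * ?k t)"
      by (intro set_integrable_mult_right kint)
    have "(LINT t:{0<..}|lborel. ?f t) = laplace_moment g 0 \<epsilon> - c * of_real (sqrt pi / sqrt \<epsilon>)"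
    proof -
      have "(LINT t:{0<..}|lborel. ?f t) = laplace_moment g 0 \<epsilon> - (LINT t:{0<..}|lborel. c * complex_of_real (?k t))"
        unfolding laplace_moment_def
        by (rule set_integral_diff(2)[OF set_integrable_laplace_moment[OF \<epsilon>]])
           (rule set_integrable_dominated[OF _ ck]; auto intro!: continuous_intros simp: norm_mult)
      also have "(LINT t:{0<..}|lborel. c * complex_of_real (?k t)) = c * of_real (LINT t:{0<..}|lborel. ?k t)"
        unfolding set_integral_complex_of_real[symmetric] by (rule set_integral_mult_right)
      finally show ?thesis by (simp only: kval)
    qed
    then have eq: "sqrt \<epsilon> * laplace_moment g 0 \<epsilon> - c * sqrt pi = sqrt \<epsilon> * (LINT t:{0<..}|lborel. ?f t)"
      using \<epsilon> by (simp add: field_simps)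
    have "norm (LINT t:{0<..}|lborel. ?f t) \<le> (LINT t:{0<..}|lborel. \<eta> * ?k t + h t)"
    proof (rule norm_set_integral_dominated)
      show "continuous_on {0<..} ?f" by (intro continuous_intros g_cont) auto
      show "set_integrable lborel {0<..} (\<lambda>t. \<eta> * ?k t + h t)"
        by (intro set_integral_add set_integrable_mult_right kint h_int)
      fix t :: real assume t: "t > 0"
      have h0: "h t \<ge> 0" using K by (simp add: h_def)
      have tp: "t powr (- 1 / 2) = 1 / sqrt t" using t by (simp add: powr_minus_divide powr_half_sqrt)
      show "norm (?f t) \<le> \<eta> * ?k t + h t"
      proof (cases "t > T")
        case True
        have e: "t ^ 0 * exp (- (\<epsilon> * t)) = ?k t * sqrt t" using t by (simp only: tp) simp
        have "?f t = of_real (?k t) * (sqrt t * g t - c)"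
          unfolding e of_real_mult by (simp only: algebra_simps)
        then have "norm (?f t) = ?k t * norm (sqrt t * g t - c)" by (simp add: norm_mult)
        also have "\<dots> \<le> ?k t * \<eta>" by (rule mult_left_mono[OF T[OF True]]) simp
        finally show ?thesis using h0 by (simp add: mult.commute)
      next
        case False
        have "norm (?f t) \<le> norm (of_real (t ^ 0 * exp (- (\<epsilon> * t))) * g t) + norm (c * of_real (?k t))"
          by (rule norm_triangle_ineq4)
        also have "\<dots> = exp (- (\<epsilon> * t)) * (norm (g t) + norm c * t powr (- 1 / 2))"
          by (simp add: norm_mult algebra_simps)
        also have "\<dots> \<le> 1 * (K + norm c * t powr (- 1 / 2))"
          using \<epsilon> t g_bound[OF t] K by (intro mult_mono add_mono) auto
        also have "\<dots> \<le> exp (\<bar>T\<bar> - t) * (K + norm c * t powr (- 1 / 2))"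
          using False K t by (intro mult_right_mono) auto
        also have "\<dots> = h t" by (simp add: h_def exp_diff exp_minus field_simps)
        finally show ?thesis using \<eta> by (simp add: add_increasing)
      qed
    qed
    also have "\<dots> = \<eta> * (sqrt pi / sqrt \<epsilon>) + B"
      unfolding B_def kval[symmetric]
      by (simp only: set_integral_add(2)[OF set_integrable_mult_right[OF kint] h_int] set_integral_mult_right)
    finally have "sqrt \<epsilon> * norm (LINT t:{0<..}|lborel. ?f t) \<le> sqrt \<epsilon> * (\<eta> * (sqrt pi / sqrt \<epsilon>) + B)"
      using \<epsilon> by (intro mult_left_mono) auto
    also have "\<dots> = \<eta> * sqrt pi + sqrt \<epsilon> * B" using \<epsilon> by (simp add: field_simps)
    finally show ?thesis unfolding eq norm_mult using \<epsilon> by simp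
  qed
  have "((\<lambda>\<epsilon>. sqrt \<epsilon>) \<longlongrightarrow> 0) (at_right 0)"
    using isCont_real_sqrt[of 0] by (simp add: isCont_def filterlim_at_split)
  then have "((\<lambda>\<epsilon>. \<eta> * sqrt pi + sqrt \<epsilon> * B) \<longlongrightarrow> \<eta> * sqrt pi + 0 * B) (at_right 0)"
    by (intro tendsto_intros)
  then have r: "((\<lambda>\<epsilon>. \<eta> * sqrt pi + sqrt \<epsilon> * B) \<longlongrightarrow> \<eta> * sqrt pi) (at_right 0)" by simp
  show ?thesis
  proof (rule tendsto_le[OF _ r])
    show "((\<lambda>\<epsilon>. norm (sqrt \<epsilon> * laplace_moment g 0 \<epsilon> - c * sqrt pi)) \<longlongrightarrow> norm (l - c * sqrt pi)) (at_right 0)"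
      by (intro tendsto_intros lim)
    show "\<forall>\<^sub>F \<epsilon> in at_right 0. norm (sqrt \<epsilon> * laplace_moment g 0 \<epsilon> - c * sqrt pi) \<le> \<eta> * sqrt pi + sqrt \<epsilon> * B"
      using eventually_at_right_less[of 0] by eventually_elim (rule key)
  qed simp
qed

end

section \<open>The Laplace transform of the Bessel function\<close>

text \<open>The factor exp (- i t) places the Laplace variable at p = \<epsilon> + i. Then
  \<epsilon> tending to 0 approaches the branch point i of (p^2 + 1)^(1/2), which corresponds to the
  wave exp (i t).\<close>

definition bessel_osc :: "real \<Rightarrow> real \<Rightarrow> complex" where
  "bessel_osc \<nu> t = exp (- \<i> * of_real t) * bessel_Ji \<nu> t"

lemma tendsto_power_exp_0:
  fixes \<epsilon> :: real
  assumes "\<epsilon> > 0"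
  shows "((\<lambda>t. t ^ k * exp (- (\<epsilon> * t))) \<longlongrightarrow> 0) at_top"
proof -
  have "filterlim (\<lambda>t. \<epsilon> * t) at_top at_top"
    by (rule filterlim_tendsto_pos_mult_at_top[OF tendsto_const assms filterlim_ident])
  then have "((\<lambda>t. (\<epsilon> * t) ^ k / exp (\<epsilon> * t)) \<longlongrightarrow> 0) at_top"
    by (rule filterlim_compose[OF tendsto_power_div_exp_0])
  then have "((\<lambda>t. (\<epsilon> * t) ^ k / exp (\<epsilon> * t) / \<epsilon> ^ k) \<longlongrightarrow> 0 / \<epsilon> ^ k) at_top"
    by (rule tendsto_divide[OF _ tendsto_const]) (use assms in simp)
  then show ?thesis using assms by (simp add: power_mult_distrib exp_minus field_simps)
qed

context
  fixes \<nu> :: real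
  assumes \<nu>: "\<nu> > 0"
begin

lemma continuous_on_bessel_Ji: "continuous_on {0<..} (bessel_Ji \<nu>)"
  using has_vector_derivative_continuous[OF has_vector_derivative_bessel_Ji]
  by (intro continuous_at_imp_continuous_on ballI) auto

lemma continuous_on_bessel_osc: "continuous_on {0<..} (bessel_osc \<nu>)"
  unfolding bessel_osc_def[abs_def] by (intro continuous_intros continuous_on_bessel_Ji)

lemma bessel_osc_bound:
  obtains K where "K > 0" "\<And>t. t > 0 \<Longrightarrow> norm (bessel_osc \<nu> t) \<le> K"
proof -
  obtain K where "K > 0" "\<And>t. t > 0 \<Longrightarrow> norm (bessel_Ji \<nu> t) \<le> K" using bessel_Ji_bound[OF \<nu>] by metis
  moreover have "norm (exp (- \<i> * complex_of_real t)) = 1" for t by simp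
  ultimately show ?thesis by (intro that[of K]) (simp_all only: bessel_osc_def norm_mult mult_1_left)
qed

abbreviation osc_moment :: "nat \<Rightarrow> real \<Rightarrow> complex" where
  "osc_moment \<equiv> laplace_moment (bessel_osc \<nu>)"

lemma set_integrable_osc_moment:
  "\<epsilon> > 0 \<Longrightarrow> set_integrable lborel {0<..} (\<lambda>t. of_real (t ^ k * exp (- (\<epsilon> * t))) * bessel_osc \<nu> t)"
  using bessel_osc_bound set_integrable_laplace_moment[OF continuous_on_bessel_osc] by metis

lemma has_vector_derivative_osc_moment:
  "\<epsilon> > 0 \<Longrightarrow> (osc_moment k has_vector_derivative - osc_moment (k + 1) \<epsilon>) (at \<epsilon>)"
  using bessel_osc_bound has_vector_derivative_laplace_moment[OF continuous_on_bessel_osc] by metis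

text \<open>The Laplace transform of Bessel's equation: if L is the transform as a function of p,
  then the moments of order 0, 1, 2 are L, - L', L''.\<close>

lemma osc_moment_ode:
  assumes \<epsilon>: "\<epsilon> > 0"
  defines "p \<equiv> of_real \<epsilon> + \<i>"
  shows "(p\<^sup>2 + 1) * osc_moment 2 \<epsilon> - 3 * p * osc_moment 1 \<epsilon> + (1 + of_real (\<nu>\<^sup>2)) * osc_moment 0 \<epsilon> = 0"
proof -
  let ?J = "bessel_Ji \<nu>" and ?J1 = "bessel_Ji' \<nu>"
  let ?g = "bessel_osc \<nu>"
  obtain K where K: "K > 0" "\<And>t. t > 0 \<Longrightarrow> norm (?J t) \<le> K"
    "\<And>t. t > 0 \<Longrightarrow> norm (?J1 t) \<le> K * (\<nu> + t)" using bessel_Ji_bound[OF \<nu>] by metis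
  define m where "m k t = of_real (t ^ k * exp (- (\<epsilon> * t))) * ?g t" for k t
  define f where "f t = (p\<^sup>2 + 1) * m 2 t - 3 * p * m 1 t + (1 + of_real (\<nu>\<^sup>2)) * m 0 t" for t
  \<comment> \<open>Integrating exp (- p t) (t^2 J'' + t J' + (t^2 + \<nu>^2) J) by parts leaves the
    integral of \<open>f\<close> and boundary terms; \<open>\<Psi>\<close> is minus those terms,
    hence a primitive of \<open>f\<close>. The division by 1 matches the form of
    \<open>has_vector_derivative_of_real_sq\<close>.\<close>
  define \<Psi> where "\<Psi> t = exp (- p * of_real t) * ((of_real t - p * of_real (t\<^sup>2 / 1)) * ?J t - of_real t * ?J1 t)" for t
  have e: "exp (- p * of_real t) = of_real (exp (- (\<epsilon> * t))) * exp (- \<i> * of_real t)" for t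
    by (simp add: p_def exp_of_real[symmetric] exp_add[symmetric] algebra_simps)
  have m_eq: "m k t = of_real t ^ k * exp (- p * of_real t) * ?J t" for k t
    unfolding m_def bessel_osc_def e by (simp only: of_real_mult of_real_power mult_ac)
  have m_int: "set_integrable lborel {0<..} (m k)" for k
    unfolding m_def[abs_def] by (rule set_integrable_osc_moment[OF \<epsilon>])
  have m_cont: "continuous_on {0<..} (m k)" for k
    unfolding m_def[abs_def] by (intro continuous_intros continuous_on_bessel_osc)
  have f_cont: "continuous_on {0<..} f"
    unfolding f_def by (intro continuous_intros m_cont)
  have f_int: "set_integrable lborel {0<..} f"
    unfolding f_def by (intro set_integral_add set_integral_diff set_integrable_mult_right m_int)
  have d: "(\<Psi> has_vector_derivative f x) (at x)" if x: "x > 0" for x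
  proof -
    have t: "((\<lambda>t. complex_of_real t) has_vector_derivative of_real 1) (at x)"
      by (rule bounded_linear.has_vector_derivative[OF bounded_linear_of_real has_vector_derivative_id])
    have ex: "((\<lambda>t. exp (- p * of_real t)) has_vector_derivative exp (- p * of_real x) * (- p * of_real 1)) (at x)"
      by (rule has_vector_derivative_field_compose[OF DERIV_exp has_vector_derivative_mult_right[OF t]])
    show ?thesis
      unfolding \<Psi>_def
      by (rule has_vector_derivative_eq_rhs[OF has_vector_derivative_mult[OF ex has_vector_derivative_diff[OF
             has_vector_derivative_mult[OF has_vector_derivative_diff[OF t
               has_vector_derivative_mult_right[OF has_vector_derivative_of_real_sq]] has_vector_derivative_bessel_Ji[OF x]]
             has_vector_derivative_mult[OF t has_vector_derivative_bessel_Ji'[OF x]]]]])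
         (use x in \<open>simp add: f_def m_eq field_simps power2_eq_square\<close>)
  qed
  define c where "c = K * (1 + \<nu>)"
  define c' where "c' = K * (norm p + 1)"
  have \<Psi>_bound: "norm (\<Psi> t) \<le> c * (t ^ 1 * exp (- (\<epsilon> * t))) + c' * (t ^ 2 * exp (- (\<epsilon> * t)))" if t: "t > 0" for t
  proof -
    have "norm (\<Psi> t) = exp (- (\<epsilon> * t)) * norm ((of_real t - p * of_real (t\<^sup>2 / 1)) * ?J t - of_real t * ?J1 t)"
      unfolding \<Psi>_def e norm_mult by simp
    also have "\<dots> \<le> exp (- (\<epsilon> * t)) * ((t + norm p * t\<^sup>2) * K + t * (K * (\<nu> + t)))"
    proof (rule mult_left_mono)
      have "norm (of_real t - p * of_real (t\<^sup>2 / 1)) \<le> norm (complex_of_real t) + norm (p * of_real (t\<^sup>2 / 1))"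
        by (rule norm_triangle_ineq4)
      also have "\<dots> = t + norm p * t\<^sup>2" using t by (simp add: norm_mult norm_power)
      finally have 1: "norm (of_real t - p * of_real (t\<^sup>2 / 1)) \<le> t + norm p * t\<^sup>2" .
      have "norm ((of_real t - p * of_real (t\<^sup>2 / 1)) * ?J t - of_real t * ?J1 t) \<le>
          norm (of_real t - p * of_real (t\<^sup>2 / 1)) * norm (?J t) + norm (complex_of_real t) * norm (?J1 t)"
        unfolding norm_mult[symmetric] by (rule norm_triangle_ineq4)
      also have "\<dots> \<le> (t + norm p * t\<^sup>2) * K + t * (K * (\<nu> + t))"
        using t K(2)[OF t] K(3)[OF t] 1 by (intro add_mono mult_mono) auto
      finally show "norm ((of_real t - p * of_real (t\<^sup>2 / 1)) * ?J t - of_real t * ?J1 t)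
          \<le> (t + norm p * t\<^sup>2) * K + t * (K * (\<nu> + t))" .
    qed simp
    also have "\<dots> = c * (t ^ 1 * exp (- (\<epsilon> * t))) + c' * (t ^ 2 * exp (- (\<epsilon> * t)))"
      by (simp add: c_def c'_def algebra_simps power2_eq_square)
    finally show ?thesis .
  qed
  have lim_top: "(\<Psi> \<longlongrightarrow> 0) at_top"
  proof (rule Lim_null_comparison)
    show "\<forall>\<^sub>F t in at_top. norm (\<Psi> t) \<le> c * (t ^ 1 * exp (- (\<epsilon> * t))) + c' * (t ^ 2 * exp (- (\<epsilon> * t)))"
      using eventually_gt_at_top[of 0] by eventually_elim (rule \<Psi>_bound)
    have "((\<lambda>t. c * (t ^ 1 * exp (- (\<epsilon> * t))) + c' * (t ^ 2 * exp (- (\<epsilon> * t)))) \<longlongrightarrow> c * 0 + c' * 0) at_top"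
      by (intro tendsto_intros tendsto_power_exp_0 \<epsilon>)
    then show "((\<lambda>t. c * (t ^ 1 * exp (- (\<epsilon> * t))) + c' * (t ^ 2 * exp (- (\<epsilon> * t)))) \<longlongrightarrow> 0) at_top" by simp
  qed
  have lim_0: "(\<Psi> \<longlongrightarrow> 0) (at_right 0)"
  proof (rule Lim_null_comparison)
    show "\<forall>\<^sub>F t in at_right 0. norm (\<Psi> t) \<le> c * (t ^ 1 * exp (- (\<epsilon> * t))) + c' * (t ^ 2 * exp (- (\<epsilon> * t)))"
      using eventually_at_right_less[of 0] by eventually_elim (rule \<Psi>_bound)
    have "isCont (\<lambda>t. c * (t ^ 1 * exp (- (\<epsilon> * t))) + c' * (t ^ 2 * exp (- (\<epsilon> * t)))) 0"
      by (intro continuous_intros)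
    then show "((\<lambda>t. c * (t ^ 1 * exp (- (\<epsilon> * t))) + c' * (t ^ 2 * exp (- (\<epsilon> * t)))) \<longlongrightarrow> 0) (at_right 0)"
      by (simp add: isCont_def filterlim_at_split)
  qed
  have "(LBINT x=ereal 0..\<infinity>. f x) = 0 - 0"
  proof (rule interval_integral_FTC_integrable[where F = \<Psi>])
    show "(\<Psi> has_vector_derivative f x) (at x)" if "ereal 0 < ereal x" for x using d that by simp
    show "isCont f x" if "ereal 0 < ereal x" for x
      using f_cont that by (simp add: continuous_on_eq_continuous_at)
    show "set_integrable lborel (einterval (ereal 0) \<infinity>) f" using f_int by simp
    show "((\<Psi> \<circ> real_of_ereal) \<longlongrightarrow> 0) (at_right (ereal 0))" using lim_0 by (simp only: ereal_tendsto_simps)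
    show "((\<Psi> \<circ> real_of_ereal) \<longlongrightarrow> 0) (at_left \<infinity>)" using lim_top by (simp only: ereal_tendsto_simps)
  qed simp
  then have "(LINT t:{0<..}|lborel. f t) = 0" by (simp only: interval_integral_to_infinity_eq) simp
  moreover have "(LINT t:{0<..}|lborel. f t) =
      (p\<^sup>2 + 1) * osc_moment 2 \<epsilon> - 3 * p * osc_moment 1 \<epsilon> + (1 + of_real (\<nu>\<^sup>2)) * osc_moment 0 \<epsilon>"
  proof -
    have mi: "set_integrable lborel {0<..} (\<lambda>t. a * m k t)" for a k
      by (intro set_integrable_mult_right m_int)
    have "(LINT t:{0<..}|lborel. f t) = (LINT t:{0<..}|lborel. (p\<^sup>2 + 1) * m 2 t) - (LINT t:{0<..}|lborel. 3 * p * m 1 t)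
       + (LINT t:{0<..}|lborel. (1 + of_real (\<nu>\<^sup>2)) * m 0 t)"
      unfolding f_def by (simp only: set_integral_add(2)[OF set_integral_diff(1)[OF mi mi] mi] set_integral_diff(2)[OF mi mi])
    then show ?thesis
      by (simp only: set_integral_mult_right laplace_moment_def m_def)
  qed
  ultimately show ?thesis by simp
qed

text \<open>For large \<epsilon> the integral concentrates at t = 0, where \<open>bessel_osc\<close>
  is (t / 2)^\<mu> / Gamma (\<mu> + 1) up to O(t); this costs a relative error O(1 / \<epsilon>).
  The orders 0 and 1 single out the solution of the differential equation for the transform.\<close>

lemma osc_moment_asymp_at_top:
  defines "\<mu> \<equiv> \<i> * complex_of_real \<nu>"
  shows "((\<lambda>\<epsilon>. of_real \<epsilon> powr (\<mu> + of_nat k + 1) * osc_moment k \<epsilon>) \<longlongrightarrow>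
    exp (- \<mu> * of_real (ln 2)) * rGamma (\<mu> + 1) * Gamma (\<mu> + of_nat k + 1)) at_top"
proof -
  obtain C where C: "C > 0" "\<And>t. t > 0 \<Longrightarrow>
    norm (bessel_osc \<nu> t - exp (\<i> * of_real (\<nu> * ln (t / 2))) * rGamma (\<mu> + 1)) \<le> C * t"
    using bessel_Ji_near_0[OF \<nu>] unfolding bessel_osc_def \<mu>_def by metis
  define \<kappa> where "\<kappa> = exp (- \<mu> * of_real (ln 2)) * rGamma (\<mu> + 1)"
  have pw: "exp (\<i> * of_real (\<nu> * ln (t / 2))) = exp (- \<mu> * of_real (ln 2)) * of_real t powr \<mu>" if "t > 0" for t
    using that by (simp add: powr_def Ln_of_real \<mu>_def ln_div algebra_simps flip: exp_add)
  have re: "Re (\<mu> + of_nat k) > -1" by (simp add: \<mu>_def)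
  have main: "norm (osc_moment k \<epsilon> - \<kappa> * (Gamma (\<mu> + of_nat k + 1) / of_real \<epsilon> powr (\<mu> + of_nat k + 1))) \<le> C * (fact (k + 1) / \<epsilon> ^ (k + 1 + 1))"
    if \<epsilon>: "\<epsilon> > 0" for \<epsilon>
  proof -
    let ?h = "\<lambda>t. \<kappa> * (of_real t powr (\<mu> + of_nat k) * of_real (exp (- (\<epsilon> * t))))"
    let ?m = "\<lambda>t. of_real (t ^ k * exp (- (\<epsilon> * t))) * bessel_osc \<nu> t"
    have "osc_moment k \<epsilon> - \<kappa> * (Gamma (\<mu> + of_nat k + 1) / of_real \<epsilon> powr (\<mu> + of_nat k + 1)) =
       (LINT t:{0<..}|lborel. ?m t) - (LINT t:{0<..}|lborel. ?h t)"
      by (simp only: laplace_moment_def set_integral_mult_right set_integral_powr_exp[OF re \<epsilon>])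
    also have "\<dots> = (LINT t:{0<..}|lborel. ?m t - ?h t)"
      by (rule set_integral_diff(2)[symmetric, OF set_integrable_osc_moment[OF \<epsilon>] set_integrable_mult_right[OF set_integrable_powr_exp[OF re \<epsilon>]]])
    finally have eq: "osc_moment k \<epsilon> - \<kappa> * (Gamma (\<mu> + of_nat k + 1) / of_real \<epsilon> powr (\<mu> + of_nat k + 1)) = \<dots>" .
    have "norm (LINT t:{0<..}|lborel. ?m t - ?h t) \<le> (LINT t:{0<..}|lborel. C * (t ^ (k + 1) * exp (- (\<epsilon> * t))))"
    proof (rule norm_set_integral_dominated)
      show "continuous_on {0<..} (\<lambda>t. ?m t - ?h t)"
        by (intro continuous_intros continuous_on_bessel_osc) auto
      show "set_integrable lborel {0<..} (\<lambda>t. C * (t ^ (k + 1) * exp (- (\<epsilon> * t))))"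
        by (intro set_integrable_mult_right set_integrable_power_exp \<epsilon>)
      fix t :: real assume t: "t > 0"
      have mh: "?m t - ?h t = of_real (t ^ k * exp (- (\<epsilon> * t))) *
          (bessel_osc \<nu> t - exp (\<i> * of_real (\<nu> * ln (t / 2))) * rGamma (\<mu> + 1))"
        using t by (simp only: pw[OF t]) (simp add: \<kappa>_def powr_add powr_nat' algebra_simps)
      have "norm (?m t - ?h t) = t ^ k * exp (- (\<epsilon> * t)) *
          norm (bessel_osc \<nu> t - exp (\<i> * of_real (\<nu> * ln (t / 2))) * rGamma (\<mu> + 1))"
        unfolding mh norm_mult norm_of_real using t by (simp add: abs_mult)
      also have "\<dots> \<le> t ^ k * exp (- (\<epsilon> * t)) * (C * t)"
        using t by (intro mult_left_mono C) auto
      finally show "norm (?m t - ?h t) \<le> C * (t ^ (k + 1) * exp (- (\<epsilon> * t)))" by (simp add: mult_ac)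
    qed
    also have "\<dots> = C * (fact (k + 1) / \<epsilon> ^ (k + 1 + 1))"
      by (simp only: set_integral_mult_right set_integral_power_exp[OF \<epsilon>])
    finally show ?thesis unfolding eq .
  qed
  have "((\<lambda>\<epsilon>. of_real \<epsilon> powr (\<mu> + of_nat k + 1) * osc_moment k \<epsilon> - \<kappa> * Gamma (\<mu> + of_nat k + 1)) \<longlongrightarrow> 0) at_top"
  proof (rule Lim_null_comparison)
    show "\<forall>\<^sub>F \<epsilon> in at_top. norm (of_real \<epsilon> powr (\<mu> + of_nat k + 1) * osc_moment k \<epsilon> - \<kappa> * Gamma (\<mu> + of_nat k + 1))
       \<le> C * fact (k + 1) * inverse \<epsilon>"
      using eventually_gt_at_top[of 0]
    proof eventually_elim
      case (elim \<epsilon>)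
      define w where "w = complex_of_real \<epsilon> powr (\<mu> + of_nat k + 1)"
      have w: "w \<noteq> 0" using elim by (simp add: w_def)
      have nw: "norm w = \<epsilon> ^ (k + 1)"
        using elim powr_realpow[of \<epsilon> "k + 1"] by (simp add: w_def norm_powr_real_powr \<mu>_def add.commute)
      have "w * osc_moment k \<epsilon> - \<kappa> * Gamma (\<mu> + of_nat k + 1) = w * (osc_moment k \<epsilon> - \<kappa> * (Gamma (\<mu> + of_nat k + 1) / w))"
        using w by (simp add: field_simps)
      then have "norm (w * osc_moment k \<epsilon> - \<kappa> * Gamma (\<mu> + of_nat k + 1)) =
         \<epsilon> ^ (k + 1) * norm (osc_moment k \<epsilon> - \<kappa> * (Gamma (\<mu> + of_nat k + 1) / w))"
        by (simp only: norm_mult nw)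
      also have "\<dots> \<le> \<epsilon> ^ (k + 1) * (C * (fact (k + 1) / \<epsilon> ^ (k + 1 + 1)))"
        using main[OF elim] elim unfolding w_def by (intro mult_left_mono) auto
      also have "\<dots> = C * fact (k + 1) * inverse \<epsilon>"
        using elim by (simp add: field_simps)
      finally show ?case unfolding w_def .
    qed
    have "((\<lambda>\<epsilon>. C * fact (k + 1) * inverse \<epsilon>) \<longlongrightarrow> C * fact (k + 1) * 0) at_top"
      by (intro tendsto_intros tendsto_inverse_0_at_top filterlim_ident)
    then show "((\<lambda>\<epsilon>. C * fact (k + 1) * inverse \<epsilon>) \<longlongrightarrow> 0) at_top" by simp
  qed
  then show ?thesis unfolding \<kappa>_def by (simp add: LIM_zero_iff)
qed

end

section \<open>Closed form of the transform and its behaviour at the branch point\<close>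

text \<open>In the variable \<theta> = ln (p + s) the function Y = s L satisfies d^2 Y / d
  \<theta>^2 = \<mu>^2 Y, and its behaviour at infinity selects Y = exp (- \<mu> \<theta>). At
  \<epsilon> = 0 one has p + s = i, so \<theta> = i \<pi> / 2, while s / sqrt \<epsilon> tends to
  sqrt (2 i) = 1 + i.\<close>

lemma laplace_bessel_osc_at_0:
  assumes \<nu>: "\<nu> > 0"
  shows "((\<lambda>\<epsilon>. sqrt \<epsilon> * laplace_moment (bessel_osc \<nu>) 0 \<epsilon>) \<longlongrightarrow> exp (of_real (\<nu> * pi / 2)) / (1 + \<i>)) (at_right 0)"
proof -
  let ?L = "laplace_moment (bessel_osc \<nu>)"
  define \<mu> where "\<mu> = \<i> * complex_of_real \<nu>"
  define p where "p \<epsilon> = complex_of_real \<epsilon> + \<i>" for \<epsilon>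
  \<comment> \<open>Since p^2 + 1 = \<epsilon> (\<epsilon> + 2 i), the root s splits into sqrt
    \<epsilon> and \<open>q\<close>. The second factor is continuous and nonzero down to \<epsilon>
    = 0 and stays off the branch cut.\<close>
  define q where "q \<epsilon> = csqrt (complex_of_real \<epsilon> + 2 * \<i>)" for \<epsilon>
  define s where "s \<epsilon> = complex_of_real (sqrt \<epsilon>) * q \<epsilon>" for \<epsilon>
  define \<theta> where "\<theta> \<epsilon> = Ln (p \<epsilon> + s \<epsilon>)" for \<epsilon>
  define Y where "Y \<epsilon> = s \<epsilon> * ?L 0 \<epsilon>" for \<epsilon>
  \<comment> \<open>This is s dY/d\<epsilon>, that is, the derivative of Y with respect to
    \<theta>.\<close>
  define DY where "DY \<epsilon> = p \<epsilon> * ?L 0 \<epsilon> - (s \<epsilon>)\<^sup>2 * ?L 1 \<epsilon>" for \<epsilon>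
  have "\<mu> * \<mu> = (\<i> * \<i>) * of_real (\<nu>\<^sup>2)"
    by (simp only: \<mu>_def power2_eq_square of_real_mult mult_ac)
  then have \<mu>2: "\<mu> * \<mu> = - of_real (\<nu>\<^sup>2)" "\<mu> \<noteq> 0" using \<nu> by (simp_all add: \<mu>_def)
  have ni: "complex_of_real \<epsilon> + 2 * \<i> \<notin> \<real>\<^sub>\<le>\<^sub>0" for \<epsilon> by (simp add: complex_nonpos_Reals_iff)
  have q2: "q \<epsilon> * q \<epsilon> = complex_of_real \<epsilon> + 2 * \<i>" for \<epsilon>
    unfolding q_def power2_eq_square[symmetric] by simp
  have q0: "q \<epsilon> \<noteq> 0" for \<epsilon> using q2[of \<epsilon>] by (auto simp: complex_eq_iff)
  have s2: "s \<epsilon> * s \<epsilon> = p \<epsilon> * p \<epsilon> + 1" if "\<epsilon> > 0" for \<epsilon>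
  proof -
    have "s \<epsilon> * s \<epsilon> = complex_of_real (sqrt \<epsilon> * sqrt \<epsilon>) * (q \<epsilon> * q \<epsilon>)" by (simp only: s_def of_real_mult mult_ac)
    also have "\<dots> = complex_of_real \<epsilon> * (complex_of_real \<epsilon> + 2 * \<i>)" using that by (simp add: q2)
    finally show ?thesis by (simp add: p_def algebra_simps)
  qed
  have s0: "s \<epsilon> \<noteq> 0" if "\<epsilon> > 0" for \<epsilon> using that q0 by (simp add: s_def)
  have Res: "Re (s \<epsilon>) \<ge> 0" if "\<epsilon> > 0" for \<epsilon>
    using that csqrt_principal[of "complex_of_real \<epsilon> + 2 * \<i>"] by (auto simp: s_def q_def)
  have Reps: "Re (p \<epsilon> + s \<epsilon>) > 0" if "\<epsilon> > 0" for \<epsilon>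
    using that Res[OF that] by (simp add: p_def)
  have ps1: "p \<epsilon> + s \<epsilon> \<notin> \<real>\<^sub>\<le>\<^sub>0" if "\<epsilon> > 0" for \<epsilon>
    using Reps[OF that] by (auto simp: complex_nonpos_Reals_iff)
  then have ps2: "p \<epsilon> + s \<epsilon> \<noteq> 0" if "\<epsilon> > 0" for \<epsilon>
    using that by force
  note ps = ps1 ps2
  have p': "(p has_vector_derivative 1) (at x)" for x
    unfolding p_def[abs_def]
    by (rule has_vector_derivative_eq_rhs[OF has_vector_derivative_add[OF
          has_vector_derivative_complex_of_real[OF DERIV_ident] has_vector_derivative_const]]) simp
  have s': "(s has_vector_derivative p x / s x) (at x)" if x: "x > 0" for x
  proof -
    have "((\<lambda>x. complex_of_real x + 2 * \<i>) has_vector_derivative of_real 1 + 0) (at x)"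
      by (intro has_vector_derivative_add has_vector_derivative_complex_of_real DERIV_ident has_vector_derivative_const)
    from has_vector_derivative_field_compose[OF has_field_derivative_csqrt[OF ni] this]
    have q': "(q has_vector_derivative inverse (2 * q x)) (at x)"
      by (simp add: q_def[abs_def])
    have "(s has_vector_derivative of_real (sqrt x) * inverse (2 * q x) + of_real (inverse (sqrt x) / 2) * q x) (at x)"
      unfolding s_def[abs_def]
      by (rule has_vector_derivative_mult[OF has_vector_derivative_complex_of_real[OF DERIV_real_sqrt[OF x]] q'])
    moreover have "of_real (sqrt x) * inverse (2 * q x) + of_real (inverse (sqrt x) / 2) * q x = p x / s x"
    proof -
      define S where "S = complex_of_real (sqrt x)"
      have S: "S * S = of_real x" "S \<noteq> 0" using x by (auto simp: S_def simp flip: of_real_mult)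
      have "S * inverse (2 * q x) + inverse S / 2 * q x = (S * S + q x * q x) / (2 * (S * q x))"
        using S(2) q0[of x] by (simp add: field_simps)
      also have "\<dots> = p x / (S * q x)"
        unfolding S q2 p_def using S(2) q0[of x] by (simp add: field_simps)
      finally show ?thesis by (simp add: S_def s_def)
    qed
    ultimately show ?thesis by simp
  qed
  have \<theta>': "(\<theta> has_vector_derivative 1 / s x) (at x)" if x: "x > 0" for x
  proof -
    have "(\<theta> has_vector_derivative inverse (p x + s x) * (1 + p x / s x)) (at x)"
      unfolding \<theta>_def[abs_def]
      by (rule has_vector_derivative_field_compose[OF has_field_derivative_Ln[OF ps(1)[OF x]] has_vector_derivative_add[OF p' s'[OF x]]])
    moreover have "inverse (p x + s x) * (1 + p x / s x) = 1 / s x"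
      using s0[OF x] ps(2)[OF x] by (simp add: field_simps)
    ultimately show ?thesis by simp
  qed
  have Y': "(Y has_vector_derivative DY x / s x) (at x)" if x: "x > 0" for x
    unfolding Y_def[abs_def]
    by (rule has_vector_derivative_eq_rhs[OF has_vector_derivative_mult[OF s'[OF x] has_vector_derivative_osc_moment[OF \<nu> x]]])
       (use s0[OF x] in \<open>simp add: DY_def field_simps power2_eq_square\<close>)
  have DY': "(DY has_vector_derivative - of_real (\<nu>\<^sup>2) * ?L 0 x) (at x)" if x: "x > 0" for x
  proof -
    have "(DY has_vector_derivative p x * (- ?L (0 + 1) x) + 1 * ?L 0 x - ((s x * s x) * (- ?L (1 + 1) x) + (s x * (p x / s x) + p x / s x * s x) * ?L 1 x)) (at x)"
      unfolding DY_def[abs_def] power2_eq_square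
      by (intro has_vector_derivative_diff has_vector_derivative_mult p' s'[OF x] has_vector_derivative_osc_moment[OF \<nu> x])
    moreover have "p x * (- ?L (0 + 1) x) + 1 * ?L 0 x - ((s x * s x) * (- ?L (1 + 1) x) + (s x * (p x / s x) + p x / s x * s x) * ?L 1 x)
       = - of_real (\<nu>\<^sup>2) * ?L 0 x"
    proof -
      have "p x * (- ?L (0 + 1) x) + 1 * ?L 0 x - ((s x * s x) * (- ?L (1 + 1) x) + (s x * (p x / s x) + p x / s x * s x) * ?L 1 x)
          = (p x * p x + 1) * ?L 2 x - 3 * p x * ?L 1 x + ?L 0 x"
        unfolding s2[OF x] using s0[OF x] by (simp add: numeral_2_eq_2 algebra_simps)
      also have "\<dots> = ((p x)\<^sup>2 + 1) * ?L 2 x - 3 * p x * ?L 1 x + (1 + of_real (\<nu>\<^sup>2)) * ?L 0 x - of_real (\<nu>\<^sup>2) * ?L 0 x"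
        by (simp add: power2_eq_square algebra_simps)
      also have "\<dots> = - of_real (\<nu>\<^sup>2) * ?L 0 x"
        unfolding osc_moment_ode[OF \<nu> x, folded p_def] by simp
      finally show ?thesis .
    qed
    ultimately show ?thesis by simp
  qed
  \<comment> \<open>First integrals of the constant-coefficient equation. The two choices c = \<mu>
    and c = - \<mu> together determine Y.\<close>
  have conserved: "((\<lambda>x. (DY x + c * Y x) * exp (- c * \<theta> x)) has_vector_derivative 0) (at x)"
    if x: "x > 0" and c: "c * c = - of_real (\<nu>\<^sup>2)" for x c
  proof -
    have "((\<lambda>x. (DY x + c * Y x) * exp (- c * \<theta> x)) has_vector_derivative
       (DY x + c * Y x) * (exp (- c * \<theta> x) * (- c * (1 / s x))) + (- of_real (\<nu>\<^sup>2) * ?L 0 x + c * (DY x / s x)) * exp (- c * \<theta> x)) (at x)"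
      by (intro has_vector_derivative_mult has_vector_derivative_add has_vector_derivative_mult_right Y'[OF x] DY'[OF x]
          has_vector_derivative_field_compose[OF DERIV_exp] \<theta>'[OF x])
    moreover have "(DY x + c * Y x) * (exp (- c * \<theta> x) * (- c * (1 / s x))) + (- of_real (\<nu>\<^sup>2) * ?L 0 x + c * (DY x / s x)) * exp (- c * \<theta> x) = 0"
      unfolding c[symmetric] using s0[OF x] by (simp add: Y_def field_simps)
    ultimately show ?thesis by simp
  qed
  have const: "(DY x + c * Y x) * exp (- c * \<theta> x) = l"
    if x: "x > 0" and c: "c * c = - of_real (\<nu>\<^sup>2)" and l: "((\<lambda>x. (DY x + c * Y x) * exp (- c * \<theta> x)) \<longlongrightarrow> l) at_top" for x c l
  proof -
    obtain k where k: "\<And>x. x \<in> {0<..} \<Longrightarrow> (DY x + c * Y x) * exp (- c * \<theta> x) = k"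
      using has_vector_derivative_zero_constant[of "{0<..}" "\<lambda>x. (DY x + c * Y x) * exp (- c * \<theta> x)"]
        has_vector_derivative_at_within[OF conserved[OF _ c]] by auto
    have "((\<lambda>x. (DY x + c * Y x) * exp (- c * \<theta> x)) \<longlongrightarrow> k) at_top"
      by (rule tendsto_eventually) (use eventually_gt_at_top[of 0] in \<open>eventually_elim; use k in auto\<close>)
    then have "k = l" using l by (intro tendsto_unique) auto
    then show ?thesis using k x by simp
  qed
  define c0 where "c0 = exp (- \<mu> * of_real (ln 2))"
  have re: "\<mu> + 1 \<notin> \<int>\<^sub>\<le>\<^sub>0" using \<nu> by (auto simp: \<mu>_def complex_eq_iff elim!: nonpos_Ints_cases)
  have rG: "rGamma (\<mu> + 1) * Gamma (\<mu> + 1) = 1"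
    using re by (simp add: rGamma_inverse_Gamma Gamma_eq_zero_iff)
  define e where "e \<epsilon> = complex_of_real \<epsilon> powr \<mu>" for \<epsilon>
  have e0: "e \<epsilon> \<noteq> 0" "norm (e \<epsilon>) = 1" if "\<epsilon> > 0" for \<epsilon>
    using that by (auto simp: e_def \<mu>_def norm_powr_real_powr)
  have l0: "((\<lambda>\<epsilon>. e \<epsilon> * of_real \<epsilon> * ?L 0 \<epsilon>) \<longlongrightarrow> c0) at_top"
  proof -
    have "((\<lambda>\<epsilon>. of_real \<epsilon> powr (\<mu> + of_nat 0 + 1) * ?L 0 \<epsilon>) \<longlongrightarrow> c0) at_top"
      using osc_moment_asymp_at_top[OF \<nu>, of 0, folded \<mu>_def] rG by (simp add: c0_def mult.assoc)
    moreover have "\<forall>\<^sub>F \<epsilon> in at_top. of_real \<epsilon> powr (\<mu> + of_nat 0 + 1) * ?L 0 \<epsilon> = e \<epsilon> * of_real \<epsilon> * ?L 0 \<epsilon>"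
      using eventually_gt_at_top[of 0] by eventually_elim (simp add: e_def powr_add)
    ultimately show ?thesis by (rule Lim_transform_eventually)
  qed
  have l1: "((\<lambda>\<epsilon>. e \<epsilon> * of_real \<epsilon> * of_real \<epsilon> * ?L 1 \<epsilon>) \<longlongrightarrow> c0 * (\<mu> + 1)) at_top"
  proof -
    have "Gamma (\<mu> + 1 + 1) = (\<mu> + 1) * Gamma (\<mu> + 1)" using re by (rule Gamma_plus1)
    then have "c0 * rGamma (\<mu> + 1) * Gamma (\<mu> + of_nat 1 + 1) = c0 * (\<mu> + 1) * (rGamma (\<mu> + 1) * Gamma (\<mu> + 1))"
      by (simp only: of_nat_1 mult_ac)
    then have "c0 * rGamma (\<mu> + 1) * Gamma (\<mu> + of_nat 1 + 1) = c0 * (\<mu> + 1)"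
      by (simp only: rG mult_1_right)
    moreover have "((\<lambda>\<epsilon>. of_real \<epsilon> powr (\<mu> + of_nat 1 + 1) * ?L 1 \<epsilon>)
        \<longlongrightarrow> c0 * rGamma (\<mu> + 1) * Gamma (\<mu> + of_nat 1 + 1)) at_top"
      unfolding c0_def \<mu>_def by (rule osc_moment_asymp_at_top[OF \<nu>])
    ultimately have "((\<lambda>\<epsilon>. of_real \<epsilon> powr (\<mu> + of_nat 1 + 1) * ?L 1 \<epsilon>) \<longlongrightarrow> c0 * (\<mu> + 1)) at_top"
      by (simp only:)
    moreover have "\<forall>\<^sub>F \<epsilon> in at_top. of_real \<epsilon> powr (\<mu> + of_nat 1 + 1) * ?L 1 \<epsilon> = e \<epsilon> * of_real \<epsilon> * of_real \<epsilon> * ?L 1 \<epsilon>"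
      using eventually_gt_at_top[of 0] by eventually_elim (unfold powr_add e_def, simp)
    ultimately show ?thesis by (rule Lim_transform_eventually)
  qed
  have inv0: "((\<lambda>\<epsilon>. complex_of_real (inverse \<epsilon>)) \<longlongrightarrow> 0) at_top"
    by (rule tendsto_of_real[of _ 0, unfolded of_real_0]) (rule tendsto_inverse_0_at_top[OF filterlim_ident])
  have p_lim: "((\<lambda>\<epsilon>. p \<epsilon> / of_real \<epsilon>) \<longlongrightarrow> 1) at_top"
  proof -
    have "((\<lambda>\<epsilon>. 1 + \<i> * complex_of_real (inverse \<epsilon>)) \<longlongrightarrow> 1 + \<i> * 0) at_top"
      by (intro tendsto_intros inv0)
    moreover have "\<forall>\<^sub>F \<epsilon> in at_top. 1 + \<i> * complex_of_real (inverse \<epsilon>) = p \<epsilon> / of_real \<epsilon>"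
      using eventually_gt_at_top[of 0] by eventually_elim (simp add: p_def field_simps)
    ultimately show ?thesis by (simp add: Lim_transform_eventually)
  qed
  have s2_eq: "(s \<epsilon> / of_real \<epsilon>)\<^sup>2 = 1 + 2 * \<i> * of_real (inverse \<epsilon>)" if "\<epsilon> > 0" for \<epsilon>
    using s2[OF that] that by (simp add: power_divide p_def) (simp add: power2_eq_square field_simps)
  have s2_lim: "((\<lambda>\<epsilon>. (s \<epsilon> / of_real \<epsilon>)\<^sup>2) \<longlongrightarrow> 1) at_top"
  proof -
    have "((\<lambda>\<epsilon>. 1 + 2 * \<i> * complex_of_real (inverse \<epsilon>)) \<longlongrightarrow> 1 + 2 * \<i> * 0) at_top"
      by (intro tendsto_intros inv0)
    moreover have "\<forall>\<^sub>F \<epsilon> in at_top. 1 + 2 * \<i> * complex_of_real (inverse \<epsilon>) = (s \<epsilon> / of_real \<epsilon>)\<^sup>2"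
      using eventually_gt_at_top[of 0] by eventually_elim (simp only: s2_eq)
    ultimately show ?thesis by (simp add: Lim_transform_eventually)
  qed
  \<comment> \<open>The limit of the square leaves the sign open. As z = s / \<epsilon> has
    nonnegative real part, |z + 1| \<ge> 1 and therefore |z - 1| \<le> |z^2 - 1|.\<close>
  have s_lim: "((\<lambda>\<epsilon>. s \<epsilon> / of_real \<epsilon>) \<longlongrightarrow> 1) at_top"
  proof -
    have "((\<lambda>\<epsilon>. s \<epsilon> / of_real \<epsilon> - 1) \<longlongrightarrow> 0) at_top"
    proof (rule Lim_null_comparison)
      have "((\<lambda>\<epsilon>. norm ((s \<epsilon> / of_real \<epsilon>)\<^sup>2 - 1)) \<longlongrightarrow> norm (1 - 1 :: complex)) at_top"
        by (intro tendsto_intros s2_lim)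
      then show "((\<lambda>\<epsilon>. norm ((s \<epsilon> / of_real \<epsilon>)\<^sup>2 - 1)) \<longlongrightarrow> 0) at_top" by simp
      show "\<forall>\<^sub>F \<epsilon> in at_top. norm (s \<epsilon> / of_real \<epsilon> - 1) \<le> norm ((s \<epsilon> / of_real \<epsilon>)\<^sup>2 - 1)"
        using eventually_gt_at_top[of 0]
      proof eventually_elim
        case (elim \<epsilon>)
        let ?z = "s \<epsilon> / of_real \<epsilon>"
        have "1 \<le> Re (?z + 1)" using Res[OF elim] elim by simp
        also have "\<dots> \<le> norm (?z + 1)" by (rule complex_Re_le_cmod)
        finally have "norm (?z - 1) * 1 \<le> norm (?z - 1) * norm (?z + 1)" by (intro mult_left_mono) auto
        also have "\<dots> = norm (?z\<^sup>2 - 1)" by (simp add: norm_mult[symmetric] power2_eq_square algebra_simps)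
        finally show ?case by simp
      qed
    qed
    then show ?thesis by (simp add: LIM_zero_iff)
  qed
  have eY: "((\<lambda>\<epsilon>. e \<epsilon> * Y \<epsilon>) \<longlongrightarrow> c0) at_top"
  proof -
    have "((\<lambda>\<epsilon>. s \<epsilon> / of_real \<epsilon> * (e \<epsilon> * of_real \<epsilon> * ?L 0 \<epsilon>)) \<longlongrightarrow> 1 * c0) at_top"
      by (intro tendsto_mult s_lim l0)
    moreover have "\<forall>\<^sub>F \<epsilon> in at_top. s \<epsilon> / of_real \<epsilon> * (e \<epsilon> * of_real \<epsilon> * ?L 0 \<epsilon>) = e \<epsilon> * Y \<epsilon>"
      using eventually_gt_at_top[of 0] by eventually_elim (simp add: Y_def)
    ultimately show ?thesis by (simp add: Lim_transform_eventually)
  qed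
  have eDY: "((\<lambda>\<epsilon>. e \<epsilon> * DY \<epsilon>) \<longlongrightarrow> - \<mu> * c0) at_top"
  proof -
    have "((\<lambda>\<epsilon>. p \<epsilon> / of_real \<epsilon> * (e \<epsilon> * of_real \<epsilon> * ?L 0 \<epsilon>) - (s \<epsilon> / of_real \<epsilon>)\<^sup>2 * (e \<epsilon> * of_real \<epsilon> * of_real \<epsilon> * ?L 1 \<epsilon>))
       \<longlongrightarrow> 1 * c0 - 1 * (c0 * (\<mu> + 1))) at_top"
      by (intro tendsto_diff tendsto_mult p_lim s2_lim l0 l1)
    moreover have "\<forall>\<^sub>F \<epsilon> in at_top. p \<epsilon> / of_real \<epsilon> * (e \<epsilon> * of_real \<epsilon> * ?L 0 \<epsilon>) - (s \<epsilon> / of_real \<epsilon>)\<^sup>2 * (e \<epsilon> * of_real \<epsilon> * of_real \<epsilon> * ?L 1 \<epsilon>)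
        = e \<epsilon> * DY \<epsilon>"
      using eventually_gt_at_top[of 0] by eventually_elim (simp add: DY_def field_simps power2_eq_square)
    ultimately have "((\<lambda>\<epsilon>. e \<epsilon> * DY \<epsilon>) \<longlongrightarrow> 1 * c0 - 1 * (c0 * (\<mu> + 1))) at_top"
      by (rule Lim_transform_eventually)
    then show ?thesis by (simp add: algebra_simps)
  qed
  \<comment> \<open>For c = \<mu> the leading terms cancel, so a bound on the exponential is enough:
    its modulus is exp (\<nu> Im \<theta>) with Im \<theta> \<le> \<pi>.\<close>
  have U: "DY x + \<mu> * Y x = 0" if x: "x > 0" for x
  proof -
    have "((\<lambda>\<epsilon>. norm (e \<epsilon> * DY \<epsilon> + \<mu> * (e \<epsilon> * Y \<epsilon>)) * exp (\<nu> * pi)) \<longlongrightarrow> norm (- \<mu> * c0 + \<mu> * c0) * exp (\<nu> * pi)) at_top"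
      by (intro tendsto_intros eY eDY)
    then have "((\<lambda>\<epsilon>. norm (e \<epsilon> * DY \<epsilon> + \<mu> * (e \<epsilon> * Y \<epsilon>)) * exp (\<nu> * pi)) \<longlongrightarrow> 0) at_top" by simp
    moreover have "\<forall>\<^sub>F \<epsilon> in at_top. norm ((DY \<epsilon> + \<mu> * Y \<epsilon>) * exp (- \<mu> * \<theta> \<epsilon>)) \<le> norm (e \<epsilon> * DY \<epsilon> + \<mu> * (e \<epsilon> * Y \<epsilon>)) * exp (\<nu> * pi)"
      using eventually_gt_at_top[of 0]
    proof eventually_elim
      case (elim \<epsilon>)
      have "norm (exp (- \<mu> * \<theta> \<epsilon>)) = exp (\<nu> * Im (\<theta> \<epsilon>))" by (simp add: \<mu>_def)
      also have "\<dots> \<le> exp (\<nu> * pi)" using Im_Ln_le_pi[OF ps(2)[OF elim]] \<nu> by (simp add: \<theta>_def)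
      finally have le: "norm (DY \<epsilon> + \<mu> * Y \<epsilon>) * norm (exp (- \<mu> * \<theta> \<epsilon>)) \<le> norm (DY \<epsilon> + \<mu> * Y \<epsilon>) * exp (\<nu> * pi)"
        by (intro mult_left_mono) auto
      have "e \<epsilon> * DY \<epsilon> + \<mu> * (e \<epsilon> * Y \<epsilon>) = e \<epsilon> * (DY \<epsilon> + \<mu> * Y \<epsilon>)" by (simp only: algebra_simps)
      then have "norm (e \<epsilon> * DY \<epsilon> + \<mu> * (e \<epsilon> * Y \<epsilon>)) = norm (DY \<epsilon> + \<mu> * Y \<epsilon>)"
        by (simp only: norm_mult e0[OF elim] mult_1_left)
      then show ?case using le by (simp only: norm_mult)
    qed
    ultimately have "((\<lambda>\<epsilon>. (DY \<epsilon> + \<mu> * Y \<epsilon>) * exp (- \<mu> * \<theta> \<epsilon>)) \<longlongrightarrow> 0) at_top"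
      by (rule Lim_null_comparison[rotated])
    from const[OF x \<mu>2(1) this] show ?thesis by simp
  qed
  \<comment> \<open>For c = - \<mu> the limit is nonzero, so \<epsilon>^\<mu> must be combined
    exactly with the exponential. Ln ((p + s) / \<epsilon>) tends to ln 2, which cancels the factor
    2^(- \<mu>) in \<open>c0\<close>.\<close>
  have V: "(DY x + (- \<mu>) * Y x) * exp (- (- \<mu>) * \<theta> x) = - 2 * \<mu>" if x: "x > 0" for x
  proof (rule const[OF x])
    show "- \<mu> * - \<mu> = - of_real (\<nu>\<^sup>2)" using \<mu>2 by simp
    have ln: "((\<lambda>\<epsilon>. Ln (p \<epsilon> / of_real \<epsilon> + s \<epsilon> / of_real \<epsilon>)) \<longlongrightarrow> Ln (1 + 1)) at_top"
      by (intro tendsto_Ln tendsto_add p_lim s_lim) (simp add: complex_nonpos_Reals_iff)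
    have lim: "((\<lambda>\<epsilon>. (e \<epsilon> * DY \<epsilon> - \<mu> * (e \<epsilon> * Y \<epsilon>)) * exp (\<mu> * Ln (p \<epsilon> / of_real \<epsilon> + s \<epsilon> / of_real \<epsilon>)))
        \<longlongrightarrow> (- \<mu> * c0 - \<mu> * c0) * exp (\<mu> * Ln (1 + 1))) at_top"
      by (intro tendsto_mult tendsto_diff tendsto_exp tendsto_const eY eDY ln)
    have val: "(- \<mu> * c0 - \<mu> * c0) * exp (\<mu> * Ln (1 + 1)) = - 2 * \<mu>"
    proof -
      have "Ln (1 + 1) = of_real (ln 2)" using Ln_of_real[of 2] by simp
      then have "c0 * exp (\<mu> * Ln (1 + 1)) = 1" by (simp add: c0_def flip: exp_add)
      then show ?thesis by (simp add: algebra_simps)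
    qed
    have ev: "\<forall>\<^sub>F \<epsilon> in at_top. (e \<epsilon> * DY \<epsilon> - \<mu> * (e \<epsilon> * Y \<epsilon>)) * exp (\<mu> * Ln (p \<epsilon> / of_real \<epsilon> + s \<epsilon> / of_real \<epsilon>))
        = (DY \<epsilon> + (- \<mu>) * Y \<epsilon>) * exp (- (- \<mu>) * \<theta> \<epsilon>)"
      using eventually_gt_at_top[of 0]
    proof eventually_elim
      case (elim \<epsilon>)
      have "Ln (p \<epsilon> / of_real \<epsilon> + s \<epsilon> / of_real \<epsilon>) = \<theta> \<epsilon> - of_real (ln \<epsilon>)"
        unfolding add_divide_distrib[symmetric] \<theta>_def using elim ps(2)[OF elim] by (intro Ln_divide_of_real) auto
      moreover have "e \<epsilon> = exp (\<mu> * of_real (ln \<epsilon>))"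
        using elim by (simp add: e_def powr_def Ln_of_real)
      ultimately have "e \<epsilon> * exp (\<mu> * Ln (p \<epsilon> / of_real \<epsilon> + s \<epsilon> / of_real \<epsilon>)) = exp (\<mu> * \<theta> \<epsilon>)"
        by (simp only: exp_add[symmetric]) (simp add: algebra_simps)
      moreover have "(e \<epsilon> * DY \<epsilon> - \<mu> * (e \<epsilon> * Y \<epsilon>)) * exp (\<mu> * Ln (p \<epsilon> / of_real \<epsilon> + s \<epsilon> / of_real \<epsilon>)) =
          (DY \<epsilon> - \<mu> * Y \<epsilon>) * (e \<epsilon> * exp (\<mu> * Ln (p \<epsilon> / of_real \<epsilon> + s \<epsilon> / of_real \<epsilon>)))"
        by (simp only: algebra_simps)
      ultimately show ?case by simp
    qed
    show "((\<lambda>\<epsilon>. (DY \<epsilon> + (- \<mu>) * Y \<epsilon>) * exp (- (- \<mu>) * \<theta> \<epsilon>)) \<longlongrightarrow> - 2 * \<mu>) at_top"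
      using Lim_transform_eventually[OF lim ev] unfolding val .
  qed
  have L0: "sqrt x * ?L 0 x = exp (- \<mu> * \<theta> x) / q x" if x: "x > 0" for x
  proof -
    have "DY x = - \<mu> * Y x" using U[OF x] by (simp add: eq_neg_iff_add_eq_0)
    then have "(- 2 * \<mu>) * (Y x * exp (\<mu> * \<theta> x)) = (- 2 * \<mu>) * 1" using V[OF x] by (simp add: algebra_simps)
    then have "Y x * exp (\<mu> * \<theta> x) = 1" using \<mu>2(2) by (simp only: mult_cancel_left) simp
    then have "Y x = exp (- \<mu> * \<theta> x)" by (simp add: exp_minus field_simps)
    then show ?thesis using q0[of x] by (simp add: Y_def s_def field_simps)
  qed
  have "((\<lambda>x. exp (- \<mu> * \<theta> x) / q x) \<longlongrightarrow> exp (- \<mu> * \<theta> 0) / q 0) (at_right 0)"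
  proof -
    have "isCont (\<lambda>\<epsilon>. complex_of_real \<epsilon> + 2 * \<i>) 0" by (intro continuous_intros)
    then have "isCont q 0"
      unfolding q_def[abs_def] by (rule isCont_o2) (rule continuous_at_csqrt[OF ni])
    moreover from this have "isCont s 0"
      unfolding s_def[abs_def] by (intro continuous_intros)
    then have "isCont (\<lambda>\<epsilon>. p \<epsilon> + s \<epsilon>) 0"
      unfolding p_def[abs_def] by (intro continuous_intros)
    then have "isCont \<theta> 0"
      unfolding \<theta>_def[abs_def]
      by (rule isCont_Ln') (simp add: p_def s_def complex_nonpos_Reals_iff)
    ultimately have "isCont (\<lambda>x. exp (- \<mu> * \<theta> x) / q x) 0"
      using q0[of 0] by (intro continuous_intros)
    then show ?thesis by (simp add: isCont_def filterlim_at_split)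
  qed
  moreover have "exp (- \<mu> * \<theta> 0) / q 0 = exp (of_real (\<nu> * pi / 2)) / (1 + \<i>)"
  proof -
    have "\<theta> 0 = \<i> * pi / 2" by (simp add: \<theta>_def p_def s_def)
    moreover have "q 0 = 1 + \<i>"
      unfolding q_def by (rule csqrt_unique) (auto simp: power2_eq_square algebra_simps)
    moreover have "- \<mu> * (\<i> * pi / 2) = of_real (\<nu> * pi / 2)"
      by (simp add: \<mu>_def complex_eq_iff)
    ultimately show ?thesis by (simp only:)
  qed
  ultimately have "((\<lambda>x. exp (- \<mu> * \<theta> x) / q x) \<longlongrightarrow> exp (of_real (\<nu> * pi / 2)) / (1 + \<i>)) (at_right 0)" by simp
  moreover have "\<forall>\<^sub>F x in at_right 0. exp (- \<mu> * \<theta> x) / q x = sqrt x * ?L 0 x"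
    using eventually_at_right_less[of 0] by eventually_elim (simp only: L0)
  ultimately show ?thesis by (rule Lim_transform_eventually)
qed

section \<open>Matching the two analyses\<close>

text \<open>Both rho x - x and the truncated phase tend to 0, so the normalisation at infinity is
  the same for every \<open>M\<close> and no series remains to be matched.\<close>

lemma lg_approx_at_top:
  "((\<lambda>x. sqrt x * exp (- \<i> * of_real (\<nu> * x)) * lg_approx M \<nu> x) \<longlongrightarrow> 1) at_top"
proof -
  have 1: "((\<lambda>x::real. ln x / 2 - ln (1 + x\<^sup>2) / 4) \<longlongrightarrow> 0) at_top" by real_asymp
  have 2: "((\<lambda>x. rho x - x) \<longlongrightarrow> 0) at_top" unfolding rho_def by real_asymp
  have 3: "(beta_hat \<longlongrightarrow> 0) at_top" unfolding beta_hat_def by real_asymp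
  have 4: "((\<lambda>x. cpoly (lg_phase M \<nu>) (lg_beta x)) \<longlongrightarrow> cpoly (lg_phase M \<nu>) 0) at_top"
  proof (rule isCont_tendsto_compose[OF isCont_cpoly])
    have "((\<lambda>x. - \<i> * of_real (beta_hat x)) \<longlongrightarrow> - \<i> * of_real 0) at_top"
      by (intro tendsto_intros 3)
    then show "(lg_beta \<longlongrightarrow> 0) at_top" by (simp add: lg_beta_def[abs_def])
  qed
  have "((\<lambda>x. exp (of_real (ln x / 2 - ln (1 + x\<^sup>2) / 4) + \<i> * of_real (\<nu> * (rho x - x)) + cpoly (lg_phase M \<nu>) (lg_beta x)))
      \<longlongrightarrow> exp (of_real 0 + \<i> * of_real (\<nu> * 0) + cpoly (lg_phase M \<nu>) 0)) at_top"
    by (intro tendsto_intros 1 2 4)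
  then have "((\<lambda>x. exp (of_real (ln x / 2 - ln (1 + x\<^sup>2) / 4) + \<i> * of_real (\<nu> * (rho x - x)) + cpoly (lg_phase M \<nu>) (lg_beta x)))
      \<longlongrightarrow> 1) at_top"
    by (simp add: cpoly_lg_phase_0)
  moreover have "\<forall>\<^sub>F x in at_top. exp (of_real (ln x / 2 - ln (1 + x\<^sup>2) / 4) + \<i> * of_real (\<nu> * (rho x - x)) + cpoly (lg_phase M \<nu>) (lg_beta x))
      = sqrt x * exp (- \<i> * of_real (\<nu> * x)) * lg_approx M \<nu> x"
    using eventually_gt_at_top[of 0]
  proof eventually_elim
    case (elim x)
    have "sqrt x = exp (ln x / 2)" using elim by (simp add: powr_def flip: powr_half_sqrt)
    then have "complex_of_real (sqrt x) = exp (of_real (ln x / 2))" by (simp only: exp_of_real)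
    then show ?case
      unfolding lg_phase_exponent_eq[OF elim] by (simp only: exp_add[symmetric]) (simp add: algebra_simps)
  qed
  ultimately show ?thesis by (rule Lim_transform_eventually)
qed

text \<open>The limit in \<open>laplace_bessel_osc_at_0\<close>, divided by the mass sqrt \<pi> of
  the kernel and by the sqrt \<nu> that the scaling t = \<nu> x brings in.\<close>

definition lg_const :: "real \<Rightarrow> complex" where
  "lg_const \<nu> = exp (of_real (\<nu> * pi / 2)) / ((1 + \<i>) * of_real (sqrt (pi * \<nu>)))"

text \<open>For large t the function sqrt t * \<open>bessel_osc\<close> stays near
  \<open>sqrt \<nu> * h0\<close>, and \<open>abelian_bound\<close> carries this closeness over to
  the exact limit of the means. In \<open>3 * \<eta>\<close>, one part comes from \<open>m x\<close>
  being close to 1 and two from the assumption \<open>h\<close>, as |m x| \<le> 2.\<close>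

lemma lg_const_bound:
  assumes \<nu>: "\<nu> > 0" and \<eta>: "0 < \<eta>" "\<eta> \<le> 1"
    and h: "\<And>x. x > 0 \<Longrightarrow>
      norm (bessel_Ji \<nu> (\<nu> * x) - lg_approx M \<nu> x * h0) \<le> \<eta> * norm (lg_approx M \<nu> x * h0)"
  shows "norm (lg_const \<nu> - h0) \<le> 3 * \<eta> * norm h0"
proof -
  define m where "m x = sqrt x * exp (- \<i> * of_real (\<nu> * x)) * lg_approx M \<nu> x" for x
  have "\<forall>\<^sub>F x in at_top. dist (m x) 1 < \<eta>"
    using lg_approx_at_top[of \<nu> M] \<eta>(1) unfolding m_def[symmetric] by (rule tendstoD)
  then obtain X where X: "\<And>x. x \<ge> X \<Longrightarrow> dist (m x) 1 < \<eta>" by (auto simp: eventually_at_top_linorder)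
  obtain K where K: "K > 0" "\<And>t. t > 0 \<Longrightarrow> norm (bessel_osc \<nu> t) \<le> K" using bessel_osc_bound[OF \<nu>] by metis
  define T where "T = \<nu> * max X 0"
  have n1: "norm (exp (- \<i> * complex_of_real y)) = 1" for y by simp
  have main: "norm (sqrt t * bessel_osc \<nu> t - sqrt \<nu> * h0) \<le> 3 * \<eta> * sqrt \<nu> * norm h0" if t: "t > T" for t
  proof -
    define x where "x = t / \<nu>"
    have tx: "t = \<nu> * x" using \<nu> by (simp add: x_def)
    then have "max X 0 < x" using t \<nu> by (simp add: T_def)
    then have x: "t = \<nu> * x" "x > X" "x > 0" using tx by auto
    have m: "norm (m x - 1) \<le> \<eta>" using X[of x] x by (simp add: dist_norm)
    have "norm (m x) \<le> norm (m x - 1) + norm (1::complex)" using norm_triangle_ineq[of "m x - 1" 1] by simp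
    then have m2: "norm (m x) \<le> 2" using m \<eta> by simp
    define d where "d = bessel_Ji \<nu> (\<nu> * x) - lg_approx M \<nu> x * h0"
    have "norm (of_real (sqrt x) * exp (- \<i> * of_real (\<nu> * x)) * d) = sqrt x * norm d"
      unfolding norm_mult n1 using x by simp
    also have "\<dots> \<le> sqrt x * (\<eta> * norm (lg_approx M \<nu> x * h0))"
      unfolding d_def using x by (intro mult_left_mono h) auto
    also have "\<dots> = \<eta> * norm (m x) * norm h0"
      unfolding m_def norm_mult n1 using x by simp
    also have "\<dots> \<le> \<eta> * 2 * norm h0" using m2 \<eta> by (intro mult_right_mono mult_left_mono) auto
    finally have e1: "norm (of_real (sqrt x) * exp (- \<i> * of_real (\<nu> * x)) * d) \<le> 2 * \<eta> * norm h0" by simp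
    have "sqrt t * bessel_osc \<nu> t - sqrt \<nu> * h0 =
       of_real (sqrt \<nu>) * (of_real (sqrt x) * exp (- \<i> * of_real (\<nu> * x)) * d + (m x - 1) * h0)"
      by (simp add: x(1) bessel_osc_def d_def m_def real_sqrt_mult algebra_simps)
    then have "norm (sqrt t * bessel_osc \<nu> t - sqrt \<nu> * h0) =
       sqrt \<nu> * norm (of_real (sqrt x) * exp (- \<i> * of_real (\<nu> * x)) * d + (m x - 1) * h0)"
      using \<nu> by (simp only: norm_mult norm_of_real) simp
    also have "\<dots> \<le> sqrt \<nu> * (2 * \<eta> * norm h0 + \<eta> * norm h0)"
    proof (rule mult_left_mono)
      have "norm ((m x - 1) * h0) \<le> \<eta> * norm h0" using m by (simp add: norm_mult mult_right_mono)
      then show "norm (of_real (sqrt x) * exp (- \<i> * of_real (\<nu> * x)) * d + (m x - 1) * h0) \<le> 2 * \<eta> * norm h0 + \<eta> * norm h0"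
        using e1 norm_triangle_ineq[of "of_real (sqrt x) * exp (- \<i> * of_real (\<nu> * x)) * d" "(m x - 1) * h0"] by linarith
    qed (use \<nu> in simp)
    finally show ?thesis by (simp add: algebra_simps)
  qed
  have "norm (exp (of_real (\<nu> * pi / 2)) / (1 + \<i>) - sqrt \<nu> * h0 * sqrt pi) \<le> 3 * \<eta> * sqrt \<nu> * norm h0 * sqrt pi"
    by (rule abelian_bound[OF continuous_on_bessel_osc[OF \<nu>] K(2) laplace_bessel_osc_at_0[OF \<nu>] main])
       (use \<nu> \<eta> in auto)
  moreover have "exp (of_real (\<nu> * pi / 2)) / (1 + \<i>) - sqrt \<nu> * h0 * sqrt pi = of_real (sqrt (pi * \<nu>)) * (lg_const \<nu> - h0)"
  proof -
    have "of_real (sqrt (pi * \<nu>)) * lg_const \<nu> = exp (of_real (\<nu> * pi / 2)) / (1 + \<i>)"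
      using \<nu> by (simp add: lg_const_def)
    then show ?thesis by (simp add: right_diff_distrib real_sqrt_mult mult_ac)
  qed
  ultimately have "norm (of_real (sqrt (pi * \<nu>)) * (lg_const \<nu> - h0)) \<le> 3 * \<eta> * sqrt \<nu> * norm h0 * sqrt pi"
    by (simp only:)
  then have "sqrt (pi * \<nu>) * norm (lg_const \<nu> - h0) \<le> sqrt (pi * \<nu>) * (3 * \<eta> * norm h0)"
    using \<nu> by (simp add: norm_mult real_sqrt_mult mult_ac)
  then show ?thesis using \<nu> by (simp add: mult_le_cancel_left_pos)
qed

lemma bessel_lg_expansion:
  "\<exists>C>0. \<exists>\<nu>0\<ge>1. \<forall>\<nu>\<ge>\<nu>0. \<forall>x>0.
     norm (bessel_Ji \<nu> (\<nu> * x) - lg_approx M \<nu> x * lg_const \<nu>) \<le> C / \<nu> ^ (M + 1) * norm (lg_approx M \<nu> x * lg_const \<nu>)"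
proof -
  obtain C \<nu>0 where C: "C > 0" "\<nu>0 \<ge> 1" "\<And>\<nu>. \<nu> \<ge> \<nu>0 \<Longrightarrow> \<exists>h0. \<forall>x>0.
     norm (bessel_Ji \<nu> (\<nu> * x) - lg_approx M \<nu> x * h0) \<le> C / \<nu> ^ (M + 1) * norm (lg_approx M \<nu> x * h0)"
    using lg_comparison[of M] by blast
  \<comment> \<open>The comparison with \<open>h0\<close> costs one \<eta> and its replacement by
    \<open>lg_const \<nu>\<close> three. Since \<nu> \<ge> 6 C makes |h0| at most twice |lg_const
    \<nu>|, the sum doubles to 8.\<close>
  have "norm (bessel_Ji \<nu> (\<nu> * x) - lg_approx M \<nu> x * lg_const \<nu>) \<le> 8 * C / \<nu> ^ (M + 1) * norm (lg_approx M \<nu> x * lg_const \<nu>)"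
    if \<nu>: "\<nu> \<ge> max \<nu>0 (6 * C)" and x: "x > 0" for \<nu> x
  proof -
    define \<eta> where "\<eta> = C / \<nu> ^ (M + 1)"
    have \<nu>1: "\<nu> \<ge> 1" using \<nu> C by auto
    have "\<nu> ^ 1 \<le> \<nu> ^ (M + 1)" using \<nu>1 by (intro power_increasing) auto
    then have "6 * C \<le> \<nu> ^ (M + 1)" using \<nu> by simp
    then have \<eta>: "0 < \<eta>" "6 * \<eta> \<le> 1" using C \<nu>1 by (auto simp: \<eta>_def divide_le_eq)
    obtain h0 where h0: "\<And>x. x > 0 \<Longrightarrow> norm (bessel_Ji \<nu> (\<nu> * x) - lg_approx M \<nu> x * h0) \<le> \<eta> * norm (lg_approx M \<nu> x * h0)"
      using C(3)[of \<nu>] \<nu> unfolding \<eta>_def by auto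
    have d: "norm (lg_const \<nu> - h0) \<le> 3 * \<eta> * norm h0"
      by (rule lg_const_bound[OF _ _ _ h0]) (use \<nu>1 \<eta> in auto)
    also have "\<dots> \<le> (1 / 2) * norm h0" using \<eta> by (intro mult_right_mono) auto
    finally have "norm (lg_const \<nu> - h0) \<le> (1 / 2) * norm h0" .
    moreover have "norm h0 - norm (lg_const \<nu>) \<le> norm (lg_const \<nu> - h0)"
      using norm_triangle_ineq2[of h0 "lg_const \<nu>"] by (simp add: norm_minus_commute)
    ultimately have h2: "norm h0 \<le> 2 * norm (lg_const \<nu>)" by linarith
    let ?A = "lg_approx M \<nu> x"
    have "norm (bessel_Ji \<nu> (\<nu> * x) - ?A * lg_const \<nu>) \<le>
       norm (bessel_Ji \<nu> (\<nu> * x) - ?A * h0) + norm (?A * h0 - ?A * lg_const \<nu>)"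
      using norm_triangle_ineq[of "bessel_Ji \<nu> (\<nu> * x) - ?A * h0" "?A * h0 - ?A * lg_const \<nu>"] by simp
    also have "norm (?A * h0 - ?A * lg_const \<nu>) = norm ?A * norm (lg_const \<nu> - h0)"
      by (simp add: norm_mult[symmetric] right_diff_distrib norm_minus_commute)
    also have "norm (bessel_Ji \<nu> (\<nu> * x) - ?A * h0) + norm ?A * norm (lg_const \<nu> - h0)
       \<le> \<eta> * norm (?A * h0) + norm ?A * (3 * \<eta> * norm h0)"
      by (intro add_mono h0 x mult_left_mono d) auto
    also have "\<dots> = 4 * \<eta> * norm ?A * norm h0" by (simp add: norm_mult)
    also have "\<dots> \<le> 4 * \<eta> * norm ?A * (2 * norm (lg_const \<nu>))" using \<eta> h2 by (intro mult_left_mono) auto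
    also have "\<dots> = 8 * C / \<nu> ^ (M + 1) * norm (?A * lg_const \<nu>)" by (simp add: norm_mult \<eta>_def)
    finally show ?thesis .
  qed
  moreover have "8 * C > 0" "max \<nu>0 (6 * C) \<ge> 1" using C by auto
  ultimately show ?thesis by blast
qed

lemma lg_const_eq:
  assumes "\<nu> > 0"
  shows "lg_const \<nu> = of_real (exp (\<nu> * pi / 2) / sqrt (2 * pi * \<nu>)) * exp (- \<i> * of_real (pi / 4))"
proof -
  have e: "exp (- \<i> * complex_of_real (pi / 4)) = (1 - \<i>) / of_real (sqrt 2)"
  proof -
    have "exp (- \<i> * complex_of_real (pi / 4)) = cis (- (pi / 4))" by (simp add: cis_conv_exp)
    also have "\<dots> = Complex (sqrt 2 / 2) (- (sqrt 2 / 2))" by (simp add: cis.ctr sin_45 cos_45)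
    also have "\<dots> = (1 - \<i>) / of_real (sqrt 2)"
      by (simp add: complex_eq_iff) (simp add: real_div_sqrt)
    finally show ?thesis .
  qed
  have "(1 - \<i>) / 2 = 1 / (1 + \<i>)"
    by (rule eq_divide_imp) (auto simp: complex_eq_iff)
  then have "1 / (1 + \<i>) = (1 - \<i>) / 2" by (rule sym)
  moreover have "(2::complex) = of_real (sqrt 2) * of_real (sqrt 2)"
    by (simp flip: of_real_mult)
  ultimately have "1 / (1 + \<i>) = exp (- \<i> * complex_of_real (pi / 4)) / of_real (sqrt 2)"
    unfolding e by simp
  then have "lg_const \<nu> = exp (of_real (\<nu> * pi / 2)) * (exp (- \<i> * complex_of_real (pi / 4)) / of_real (sqrt 2)) / of_real (sqrt (pi * \<nu>))"
    unfolding lg_const_def by (metis divide_divide_eq_left times_divide_eq_right mult_1_right)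
  then show ?thesis
    by (simp add: real_sqrt_mult exp_of_real[symmetric] mult_ac)
qed

section \<open>Amplitude and argument of the approximation\<close>

definition lg_amplitude :: "nat \<Rightarrow> real \<Rightarrow> real \<Rightarrow> real" where
  "lg_amplitude M \<nu> x = 1 / (sqrt (2 * pi * \<nu>) * (x\<^sup>2 + 1) powr (1 / 4)) *
     exp (\<nu> * pi / 2 + Re (cpoly (lg_phase M \<nu>) (lg_beta x)))"

definition lg_argument :: "nat \<Rightarrow> real \<Rightarrow> real \<Rightarrow> real" where
  "lg_argument M \<nu> x = \<nu> * rho x - pi / 4 + Im (cpoly (lg_phase M \<nu>) (lg_beta x))"

lemma lg_polar:
  assumes "\<nu> > 0" "x > 0"
  shows "lg_approx M \<nu> x * lg_const \<nu> = of_real (lg_amplitude M \<nu> x) * exp (\<i> * of_real (lg_argument M \<nu> x))"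
proof -
  let ?S = "cpoly (lg_phase M \<nu>) (lg_beta x)"
  have S: "exp ?S = of_real (exp (Re ?S)) * exp (\<i> * of_real (Im ?S))"
    by (metis complex_eq exp_add exp_of_real)
  have "(x\<^sup>2 + 1) powr (1 / 4) = exp (ln (1 + x\<^sup>2) / 4)"
    using one_plus_sq_pos[of x] by (simp add: powr_def add.commute)
  then have q: "exp (- ln (1 + x\<^sup>2) / 4) = 1 / (x\<^sup>2 + 1) powr (1 / 4)"
    by (simp add: exp_minus inverse_eq_divide)
  have "lg_approx M \<nu> x = of_real (exp (- ln (1 + x\<^sup>2) / 4)) * exp (\<i> * of_real (\<nu> * rho x)) * (of_real (exp (Re ?S)) * exp (\<i> * of_real (Im ?S)))"
    unfolding lg_phase_exponent_eq[OF assms(2)] exp_add S exp_of_real by (rule refl)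
  then have "lg_approx M \<nu> x * lg_const \<nu> =
     of_real (exp (- ln (1 + x\<^sup>2) / 4) * exp (Re ?S) * (exp (\<nu> * pi / 2) / sqrt (2 * pi * \<nu>))) *
     (exp (\<i> * of_real (\<nu> * rho x)) * exp (\<i> * of_real (Im ?S)) * exp (- \<i> * of_real (pi / 4)))"
    unfolding lg_const_eq[OF assms(1)] of_real_mult by (simp only: mult_ac)
  also have "exp (\<i> * of_real (\<nu> * rho x)) * exp (\<i> * of_real (Im ?S)) * exp (- \<i> * of_real (pi / 4)) =
      exp (\<i> * of_real (lg_argument M \<nu> x))"
    by (simp add: lg_argument_def algebra_simps flip: exp_add)
  also have "exp (- ln (1 + x\<^sup>2) / 4) * exp (Re ?S) * (exp (\<nu> * pi / 2) / sqrt (2 * pi * \<nu>)) = lg_amplitude M \<nu> x"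
    unfolding q by (simp add: lg_amplitude_def exp_add mult_ac)
  finally show ?thesis .
qed

lemma lg_amplitude_pos: "\<nu> > 0 \<Longrightarrow> lg_amplitude M \<nu> x > 0"
  using one_plus_sq_pos[of x] by (simp add: lg_amplitude_def add.commute)

lemma bessel_polar_expansion:
  "\<exists>C>0. \<exists>\<nu>0\<ge>1. \<forall>\<nu>\<ge>\<nu>0. \<forall>x>0. \<exists>\<delta>. norm \<delta> \<le> C / \<nu> ^ (M + 1) \<and>
     bessel_J (\<i> * of_real \<nu>) (of_real (\<nu> * x)) =
       of_real (lg_amplitude M \<nu> x) * exp (\<i> * of_real (lg_argument M \<nu> x)) * (1 + \<delta>)"
proof -
  obtain C \<nu>0 where C: "C > 0" "\<nu>0 \<ge> 1" "\<And>\<nu> x. \<nu> \<ge> \<nu>0 \<Longrightarrow> x > 0 \<Longrightarrow>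
     norm (bessel_Ji \<nu> (\<nu> * x) - lg_approx M \<nu> x * lg_const \<nu>) \<le> C / \<nu> ^ (M + 1) * norm (lg_approx M \<nu> x * lg_const \<nu>)"
    using bessel_lg_expansion[of M] by blast
  have "\<exists>\<delta>. norm \<delta> \<le> C / \<nu> ^ (M + 1) \<and> bessel_J (\<i> * of_real \<nu>) (of_real (\<nu> * x)) =
       of_real (lg_amplitude M \<nu> x) * exp (\<i> * of_real (lg_argument M \<nu> x)) * (1 + \<delta>)"
    if \<nu>: "\<nu> \<ge> \<nu>0" and x: "x > 0" for \<nu> x
  proof -
    have \<nu>1: "\<nu> > 0" using \<nu> C by simp
    define Z where "Z = of_real (lg_amplitude M \<nu> x) * exp (\<i> * of_real (lg_argument M \<nu> x))"
    have Z: "norm Z > 0" using lg_amplitude_pos[OF \<nu>1, of M x] by (simp add: Z_def)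
    define J where "J = bessel_J (\<i> * of_real \<nu>) (of_real (\<nu> * x))"
    have "norm (J - Z) \<le> C / \<nu> ^ (M + 1) * norm Z"
      using C(3)[OF \<nu> x] \<nu>1 x bessel_J_eq_bessel_Ji[of "\<nu> * x" \<nu>]
      unfolding lg_polar[OF \<nu>1 x] Z_def[symmetric] J_def by simp
    then have "norm ((J - Z) / Z) \<le> C / \<nu> ^ (M + 1)"
      using Z by (simp only: norm_divide divide_le_eq if_True)
    moreover have "J = Z * (1 + (J - Z) / Z)" using Z by (simp add: field_simps)
    ultimately show ?thesis unfolding J_def[symmetric] Z_def[symmetric] by blast
  qed
  then show ?thesis using C by blast
qed

lemma cpoly_lg_phase_E_hat:
  "cpoly (lg_phase M \<nu>) (lg_beta x) =
     (\<Sum>s=1..M. (if even s then 1 else \<i>) * of_real (E_hat s (beta_hat x) / \<nu> ^ s))"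
  unfolding cpoly_lg_phase_eq
proof (rule sum.cong)
  fix s assume "s \<in> {1..M}"
  have "E_fun s (lg_beta x) = (if even s then 1 else \<i>) * of_real (E_hat s (beta_hat x))"
    unfolding of_real_E_hat lg_beta_def by simp
  then show "E_fun s (lg_beta x) / of_real \<nu> ^ s = (if even s then 1 else \<i>) * of_real (E_hat s (beta_hat x) / \<nu> ^ s)"
    by simp
qed simp

text \<open>The last term, of odd index 2 N + 1, is imaginary and leaves the sum unchanged. Keeping
  it improves the error of the modulus to order 2 N + 2, the first omitted even power.\<close>

lemma Re_lg_phase:
  "Re (cpoly (lg_phase (2 * N + 1) \<nu>) (lg_beta x)) = (\<Sum>s=1..N. E_hat (2 * s) (beta_hat x) / \<nu> ^ (2 * s))"
  unfolding cpoly_lg_phase_E_hat by (induction N) simp_all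

text \<open>The last term, of index 2 N, is real; the error then has order 2 N + 1, the first
  omitted odd power.\<close>

lemma Im_lg_phase:
  "Im (cpoly (lg_phase (2 * N) \<nu>) (lg_beta x)) = (\<Sum>s<N. E_hat (2 * s + 1) (beta_hat x) / \<nu> ^ (2 * s + 1))"
  unfolding cpoly_lg_phase_E_hat by (induction N) simp_all

section \<open>From a small relative error to modulus and phase\<close>

lemma abs_ln_le_of_close:
  fixes y \<eta> :: real
  assumes "\<bar>y - 1\<bar> \<le> \<eta>" "\<eta> \<le> 1 / 2"
  shows "\<bar>ln y\<bar> \<le> 2 * \<eta>"
proof -
  define u where "u = y - 1"
  have u: "\<bar>u\<bar> \<le> \<eta>" "\<bar>u\<bar> \<le> 1 / 2" using assms by (auto simp: u_def)
  have "\<bar>ln (1 + u) - u\<bar> \<le> 2 * u\<^sup>2" by (rule abs_ln_one_plus_x_minus_x_bound[OF u(2)])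
  also have "\<dots> = 2 * \<bar>u\<bar> * \<bar>u\<bar>" by (simp add: power2_eq_square)
  also have "\<dots> \<le> 2 * (1 / 2) * \<bar>u\<bar>" using u by (intro mult_right_mono mult_left_mono) auto
  finally have "\<bar>ln (1 + u)\<bar> \<le> 2 * \<bar>u\<bar>" by linarith
  then show ?thesis using u by (simp add: u_def)
qed

lemma norm_unit_minus_one_le:
  fixes \<delta> :: complex
  assumes "norm \<delta> \<le> \<eta>" "\<eta> \<le> 1 / 2"
  shows "norm ((1 + \<delta>) / of_real (norm (1 + \<delta>)) - 1) \<le> 4 * \<eta>"
proof -
  define n where "n = norm (1 + \<delta>)"
  have n1: "\<bar>n - 1\<bar> \<le> \<eta>" using norm_triangle_ineq3[of "1 + \<delta>" 1] assms(1) by (simp add: n_def)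
  then have n: "n \<ge> 1 / 2" using assms(2) by linarith
  have "(1 + \<delta>) / of_real n - 1 = (\<delta> - of_real (n - 1)) / of_real n" using n by (simp add: field_simps)
  then have "norm ((1 + \<delta>) / of_real n - 1) = norm (\<delta> - of_real (n - 1)) / n" using n by (simp add: norm_divide)
  also have "\<dots> \<le> (\<eta> + \<eta>) / (1 / 2)"
  proof (rule frac_le)
    have "norm (\<delta> - of_real (n - 1)) \<le> norm \<delta> + norm (complex_of_real (n - 1))" by (rule norm_triangle_ineq4)
    also have "norm (complex_of_real (n - 1)) = \<bar>n - 1\<bar>" by (rule norm_of_real)
    finally show "norm (\<delta> - of_real (n - 1)) \<le> \<eta> + \<eta>" using assms(1) n1 by linarith
    show "0 \<le> \<eta> + \<eta>" using assms(1) norm_ge_zero[of \<delta>] by linarith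
  qed (use n in auto)
  finally show ?thesis by (simp add: n_def)
qed

text \<open>Closeness of exp (i d) to 1 keeps cos d away from 0, so by the intermediate value
  theorem |d| never reaches \<pi> / 2 once it is below 1 somewhere. Then |d| \<le> |tan d|, and cos
  d \<ge> 1/2 gives the factor 2.\<close>

lemma phase_difference_bound:
  fixes d :: "real \<Rightarrow> real"
  assumes cont: "continuous_on {0<..} d" and x0: "x0 > 0" "\<bar>d x0\<bar> < 1"
    and close: "\<And>x. x > 0 \<Longrightarrow> norm (exp (\<i> * of_real (d x)) - 1) \<le> \<eta>" and \<eta>: "\<eta> \<le> 1 / 2"
    and x: "x > 0"
  shows "\<bar>d x\<bar> \<le> 2 * \<eta>"
proof -
  have e: "exp (\<i> * of_real y) = cis y" for y by (simp add: cis_conv_exp)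
  have cos: "cos (d y) \<ge> 1 / 2" and sin: "\<bar>sin (d y)\<bar> \<le> \<eta>" if "y > 0" for y
  proof -
    have "\<bar>Re (cis (d y) - 1)\<bar> \<le> \<eta>" "\<bar>Im (cis (d y) - 1)\<bar> \<le> \<eta>"
      using close[OF that] abs_Re_le_cmod[of "cis (d y) - 1"] abs_Im_le_cmod[of "cis (d y) - 1"] unfolding e by linarith+
    then show "cos (d y) \<ge> 1 / 2" "\<bar>sin (d y)\<bar> \<le> \<eta>" using \<eta> by (auto simp: abs_le_iff)
  qed
  have "\<bar>d x\<bar> < pi / 2"
  proof (rule ccontr)
    assume "\<not> \<bar>d x\<bar> < pi / 2"
    then have ge: "\<bar>d x\<bar> \<ge> pi / 2" by simp
    have "connected ((\<lambda>x. \<bar>d x\<bar>) ` {0<..})"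
      by (intro connected_continuous_image continuous_intros cont) auto
    from connected_contains_Icc[OF this, of "\<bar>d x0\<bar>" "\<bar>d x\<bar>"]
    have "{\<bar>d x0\<bar>..\<bar>d x\<bar>} \<subseteq> (\<lambda>x. \<bar>d x\<bar>) ` {0<..}" using x x0 by auto
    moreover have "pi / 2 \<in> {\<bar>d x0\<bar>..\<bar>d x\<bar>}" using ge x0(2) pi_gt3 by simp
    ultimately have "pi / 2 \<in> (\<lambda>x. \<bar>d x\<bar>) ` {0<..}" by (rule subsetD)
    then obtain y where "y \<in> {0<..}" "pi / 2 = \<bar>d y\<bar>" unfolding image_iff by (elim bexE)
    then have y: "y > 0" "\<bar>d y\<bar> = pi / 2" by simp_all
    have "cos (d y) = cos \<bar>d y\<bar>" by (simp add: abs_if)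
    then show False using cos[OF y(1)] y(2) by simp
  qed
  then have "\<bar>d x\<bar> \<le> \<bar>tan (d x)\<bar>" by (rule abs_tan_ge)
  also have "\<dots> = \<bar>sin (d x)\<bar> / cos (d x)" using cos[OF x] by (simp add: tan_def)
  also have "\<dots> \<le> \<eta> / (1 / 2)"
    using sin[OF x] cos[OF x] by (intro frac_le) auto
  finally show ?thesis by simp
qed

text \<open>The error moves into the exponent as ln |1 + \<delta>|, where \<delta> is the complex
  relative error.\<close>

lemma bessel_modulus_expansion:
  "\<exists>C. \<exists>\<nu>0>0. \<forall>\<nu>\<ge>\<nu>0. \<forall>x>0. \<exists>\<epsilon>. \<bar>\<epsilon>\<bar> \<le> C / \<nu> ^ (M + 1) \<and>
     bessel_modulus \<nu> x = lg_amplitude M \<nu> x * exp \<epsilon>"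
proof -
  obtain C \<nu>0 where C: "C > 0" "\<nu>0 \<ge> 1" "\<And>\<nu> x. \<nu> \<ge> \<nu>0 \<Longrightarrow> x > 0 \<Longrightarrow> \<exists>\<delta>. norm \<delta> \<le> C / \<nu> ^ (M + 1) \<and>
     bessel_J (\<i> * of_real \<nu>) (of_real (\<nu> * x)) =
       of_real (lg_amplitude M \<nu> x) * exp (\<i> * of_real (lg_argument M \<nu> x)) * (1 + \<delta>)"
    using bessel_polar_expansion[of M] by blast
  have "\<exists>\<epsilon>. \<bar>\<epsilon>\<bar> \<le> 2 * C / \<nu> ^ (M + 1) \<and> bessel_modulus \<nu> x = lg_amplitude M \<nu> x * exp \<epsilon>"
    if \<nu>: "\<nu> \<ge> max \<nu>0 (2 * C)" and x: "x > 0" for \<nu> x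
  proof -
    have \<nu>1: "\<nu> \<ge> 1" "\<nu> \<ge> \<nu>0" using \<nu> C by auto
    obtain \<delta> where \<delta>: "norm \<delta> \<le> C / \<nu> ^ (M + 1)" "bessel_J (\<i> * of_real \<nu>) (of_real (\<nu> * x)) =
       of_real (lg_amplitude M \<nu> x) * exp (\<i> * of_real (lg_argument M \<nu> x)) * (1 + \<delta>)"
      using C(3)[OF \<nu>1(2) x] by blast
    have "\<nu> ^ 1 \<le> \<nu> ^ (M + 1)" using \<nu>1 by (intro power_increasing) auto
    moreover have P: "0 < \<nu> ^ (M + 1)" using \<nu>1 by (intro zero_less_power) linarith
    ultimately have half: "C / \<nu> ^ (M + 1) \<le> 1 / 2"
      unfolding pos_divide_le_eq[OF P] power_one_right using \<nu> by linarith
    have c: "\<bar>norm (1 + \<delta>) - 1\<bar> \<le> C / \<nu> ^ (M + 1)"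
      using norm_triangle_ineq3[of "1 + \<delta>" 1] \<delta>(1) by simp
    have "\<bar>ln (norm (1 + \<delta>))\<bar> \<le> 2 * (C / \<nu> ^ (M + 1))" by (rule abs_ln_le_of_close[OF c half])
    moreover have "norm (1 + \<delta>) > 0" using c half by linarith
    moreover have "bessel_modulus \<nu> x = lg_amplitude M \<nu> x * norm (1 + \<delta>)"
    proof -
      have a: "lg_amplitude M \<nu> x > 0" by (rule lg_amplitude_pos) (use \<nu>1 in linarith)
      show ?thesis
        by (simp only: bessel_modulus_def \<delta>(2) norm_mult norm_of_real norm_exp_i_times mult_1_right abs_of_pos[OF a])
    qed
    ultimately show ?thesis by (intro exI[of _ "ln (norm (1 + \<delta>))"]) simp
  qed
  moreover have "max \<nu>0 (2 * C) > 0" using C by auto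
  ultimately show ?thesis by blast
qed

lemma continuous_on_lg_argument: "continuous_on {0<..} (lg_argument M \<nu>)"
proof -
  have "continuous_on {0<..} rho"
    using DERIV_isCont[OF deriv_rho] by (intro continuous_at_imp_continuous_on ballI) auto
  moreover have "continuous_on {0<..} (\<lambda>x. cpoly (lg_phase M \<nu>) (lg_beta x))"
    by (intro continuous_at_imp_continuous_on ballI isCont_o2[OF isCont_lg_beta isCont_cpoly])
  ultimately show ?thesis
    unfolding lg_argument_def[abs_def] by (intro continuous_intros)
qed

text \<open>This matches the leading argument with the normalisation \<nu> ln (x / 2) + \<nu> of the
  branch, for fixed \<nu>.\<close>

lemma rho_at_0: "((\<lambda>x. rho x - ln (x / 2) - 1) \<longlongrightarrow> 0) (at_right 0)"
proof -
  let ?f = "\<lambda>x::real. sqrt (1 + x\<^sup>2) - ln (1 + sqrt (1 + x\<^sup>2)) + ln 2 - 1"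
  have "isCont ?f 0" by (intro continuous_intros) auto
  then have "(?f \<longlongrightarrow> 0) (at_right 0)" using isCont_at_right[of 0 ?f] by simp
  moreover have "\<forall>\<^sub>F x in at_right 0. ?f x = rho x - ln (x / 2) - 1"
    using eventually_at_right_less[of 0]
  proof eventually_elim
    case (elim x)
    have "ln ((1 + sqrt (x\<^sup>2 + 1)) / x) = ln (1 + sqrt (x\<^sup>2 + 1)) - ln x"
      using elim by (intro ln_divide_pos) (auto intro: add_pos_nonneg)
    moreover have "ln (x / 2) = ln x - ln 2" using elim by (intro ln_divide_pos) auto
    ultimately show ?case unfolding rho_def add.commute[of "x\<^sup>2" 1] by linarith
  qed
  ultimately show ?thesis by (rule Lim_transform_eventually)
qed

text \<open>The polar form makes exp (i d) close to 1, where d is the difference of the two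
  arguments. The branch condition supplies a point, depending on \<nu>, at which |d| < 1; continuity
  then excludes every nonzero multiple of 2 \<pi>, uniformly in x.\<close>

lemma bessel_phase_expansion:
  assumes "is_bessel_phase \<Theta>"
  shows "\<exists>C. \<exists>\<nu>0>0. \<forall>\<nu>\<ge>\<nu>0. \<forall>x>0. \<bar>\<Theta> \<nu> x - lg_argument M \<nu> x\<bar> \<le> C / \<nu> ^ (M + 1)"
proof -
  obtain C \<nu>0 where C: "C > 0" "\<nu>0 \<ge> 1" "\<And>\<nu> x. \<nu> \<ge> \<nu>0 \<Longrightarrow> x > 0 \<Longrightarrow> \<exists>\<delta>. norm \<delta> \<le> C / \<nu> ^ (M + 1) \<and>
     bessel_J (\<i> * of_real \<nu>) (of_real (\<nu> * x)) =
       of_real (lg_amplitude M \<nu> x) * exp (\<i> * of_real (lg_argument M \<nu> x)) * (1 + \<delta>)"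
    using bessel_polar_expansion[of M] by blast
  obtain C2 where C2: "C2 > 0" "\<And>\<nu> z. \<nu> \<ge> 1 \<Longrightarrow> norm z \<le> 1 \<Longrightarrow> norm (cpoly (lg_phase M \<nu>) z) \<le> C2 / \<nu>"
    using lg_phase_bound[of M] by blast
  have polar: "\<And>\<nu> x. \<nu> > 0 \<Longrightarrow> x > 0 \<Longrightarrow> bessel_J (\<i> * of_real \<nu>) (of_real (\<nu> * x)) =
        of_real (bessel_modulus \<nu> x) * exp (\<i> * of_real (\<Theta> \<nu> x))"
    and cont: "\<And>\<nu>. \<nu> > 0 \<Longrightarrow> continuous_on {0<..} (\<Theta> \<nu>)"
    using assms unfolding is_bessel_phase_def by blast+
  have "\<exists>C. \<exists>\<delta>>0. \<exists>\<nu>0>0. \<forall>\<nu>\<ge>\<nu>0. \<forall>x>0. \<nu> * x \<le> \<delta> \<longrightarrow>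
      \<bar>\<Theta> \<nu> x - (\<nu> * ln (x / 2) + \<nu> - pi / 4)\<bar> \<le> C * (\<nu> * x\<^sup>2 + 1 / \<nu>)"
    using assms unfolding is_bessel_phase_def by (elim conjE)
  then obtain C3 r \<nu>1 where branch': "r > 0" "\<nu>1 > 0"
    "\<forall>\<nu>\<ge>\<nu>1. \<forall>x>0. \<nu> * x \<le> r \<longrightarrow>
        \<bar>\<Theta> \<nu> x - (\<nu> * ln (x / 2) + \<nu> - pi / 4)\<bar> \<le> C3 * (\<nu> * x\<^sup>2 + 1 / \<nu>)"
    by (elim exE conjE) (rule that)
  note branch = branch'(1,2) branch'(3)[rule_format]
  \<comment> \<open>The three summands bring the relative error, the truncated phase and the 1 /
    \<nu> term of the branch condition below 1/8 each. The constant \<open>C3\<close> may be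
    negative, hence its absolute value.\<close>
  define \<nu>2 where "\<nu>2 = max (max \<nu>0 \<nu>1) (8 * C + 8 * C2 + 8 * \<bar>C3\<bar>)"
  have "\<bar>\<Theta> \<nu> x - lg_argument M \<nu> x\<bar> \<le> 8 * C / \<nu> ^ (M + 1)" if \<nu>: "\<nu> \<ge> \<nu>2" and x: "x > 0" for \<nu> x
  proof -
    have \<nu>': "\<nu> \<ge> \<nu>0" "\<nu> \<ge> \<nu>1" "8 * C + 8 * C2 + 8 * \<bar>C3\<bar> \<le> \<nu>" "\<nu> \<ge> 1" "\<nu> > 0"
      using \<nu> C(2) unfolding \<nu>2_def by auto
    have le: "8 * C \<le> \<nu>" "8 * C2 \<le> \<nu>" "8 * \<bar>C3\<bar> \<le> \<nu>" using \<nu>'(3) C(1) C2(1) by linarith+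
    have "\<nu> ^ 1 \<le> \<nu> ^ (M + 1)" using \<nu>' by (intro power_increasing) auto
    moreover have P: "0 < \<nu> ^ (M + 1)" using \<nu>' by (intro zero_less_power) linarith
    ultimately have \<eta>: "C / \<nu> ^ (M + 1) \<le> 1 / 8"
      unfolding pos_divide_le_eq[OF P] power_one_right using le by linarith
    define d where "d x = \<Theta> \<nu> x - lg_argument M \<nu> x" for x
    have close: "norm (exp (\<i> * of_real (d x)) - 1) \<le> 4 * (C / \<nu> ^ (M + 1))" if x: "x > 0" for x
    proof -
      obtain \<delta> where \<delta>: "norm \<delta> \<le> C / \<nu> ^ (M + 1)" "bessel_J (\<i> * of_real \<nu>) (of_real (\<nu> * x)) =
         of_real (lg_amplitude M \<nu> x) * exp (\<i> * of_real (lg_argument M \<nu> x)) * (1 + \<delta>)"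
        using C(3)[OF \<nu>'(1) x] by blast
      have a: "lg_amplitude M \<nu> x > 0" by (rule lg_amplitude_pos[OF \<nu>'(5)])
      have "bessel_modulus \<nu> x = lg_amplitude M \<nu> x * norm (1 + \<delta>)"
        by (simp only: bessel_modulus_def \<delta>(2) norm_mult norm_of_real norm_exp_i_times mult_1_right abs_of_pos[OF a])
      then have "of_real (lg_amplitude M \<nu> x) * (of_real (norm (1 + \<delta>)) * exp (\<i> * of_real (\<Theta> \<nu> x))) =
        of_real (lg_amplitude M \<nu> x) * (exp (\<i> * of_real (lg_argument M \<nu> x)) * (1 + \<delta>))"
        using polar[OF \<nu>'(5) x] \<delta>(2) by (simp add: mult.assoc)
      then have "of_real (norm (1 + \<delta>)) * exp (\<i> * of_real (\<Theta> \<nu> x)) = exp (\<i> * of_real (lg_argument M \<nu> x)) * (1 + \<delta>)"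
        using a by simp
      moreover have "exp (\<i> * of_real (\<Theta> \<nu> x)) = exp (\<i> * of_real (lg_argument M \<nu> x)) * exp (\<i> * of_real (d x))"
        by (simp add: d_def algebra_simps flip: exp_add)
      ultimately have "exp (\<i> * of_real (lg_argument M \<nu> x)) * (of_real (norm (1 + \<delta>)) * exp (\<i> * of_real (d x))) =
          exp (\<i> * of_real (lg_argument M \<nu> x)) * (1 + \<delta>)"
        by (simp only: mult_ac)
      then have "of_real (norm (1 + \<delta>)) * exp (\<i> * of_real (d x)) = 1 + \<delta>" by simp
      moreover have "\<bar>norm (1 + \<delta>) - 1\<bar> \<le> norm \<delta>"
        using norm_triangle_ineq3[of "1 + \<delta>" 1] by simp
      then have "norm (1 + \<delta>) > 0" using \<delta>(1) \<eta> by linarith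
      ultimately have eq: "exp (\<i> * of_real (d x)) = (1 + \<delta>) / of_real (norm (1 + \<delta>))"
        by (metis less_irrefl nonzero_mult_div_cancel_left of_real_eq_0_iff)
      show ?thesis
        unfolding eq by (rule norm_unit_minus_one_le[OF \<delta>(1)]) (use \<eta> in linarith)
    qed
    \<comment> \<open>At such a point the branch remainder contributes 1/4 + 1/8, the distance of
      \<nu> rho to its logarithmic form 1/4, and the truncated phase 1/8: together at most
      3/4.\<close>
    obtain x0 where x0: "x0 > 0" "\<bar>d x0\<bar> < 1"
    proof -
      have "((\<lambda>x. \<nu> * (rho x - ln (x / 2) - 1)) \<longlongrightarrow> \<nu> * 0) (at_right 0)"
        by (intro tendsto_mult tendsto_const rho_at_0)
      then have "\<forall>\<^sub>F x in at_right 0. dist (\<nu> * (rho x - ln (x / 2) - 1)) (\<nu> * 0) < 1 / 4"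
        by (rule tendstoD) simp
      then have e1: "\<forall>\<^sub>F x in at_right 0. \<bar>\<nu> * (rho x - ln (x / 2) - 1)\<bar> < 1 / 4"
        by (simp only: dist_real_def mult_zero_right diff_zero)
      have "isCont (\<lambda>x. \<bar>C3\<bar> * (\<nu> * x\<^sup>2)) 0" "isCont (\<lambda>x. \<nu> * x) 0" by (intro continuous_intros)+
      from isCont_at_right[OF this(1)] isCont_at_right[OF this(2)]
      have l: "((\<lambda>x. \<bar>C3\<bar> * (\<nu> * x\<^sup>2)) \<longlongrightarrow> 0) (at_right 0)" "((\<lambda>x. \<nu> * x) \<longlongrightarrow> 0) (at_right 0)" by simp_all
      have e2: "\<forall>\<^sub>F x in at_right 0. \<bar>C3\<bar> * (\<nu> * x\<^sup>2) < 1 / 4" by (rule order_tendstoD(2)[OF l(1)]) simp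
      have e3: "\<forall>\<^sub>F x in at_right 0. \<nu> * x < r" by (rule order_tendstoD(2)[OF l(2) branch(1)])
      have e4: "\<forall>\<^sub>F x :: real in at_right 0. x > 0" by (rule eventually_at_right_less)
      have "\<forall>\<^sub>F x in at_right 0. x > 0 \<and> \<nu> * x < r \<and> \<bar>C3\<bar> * (\<nu> * x\<^sup>2) < 1 / 4 \<and> \<bar>\<nu> * (rho x - ln (x / 2) - 1)\<bar> < 1 / 4"
        using e1 e2 e3 e4 by eventually_elim blast
      then obtain y where y: "y > 0" "\<nu> * y < r" "\<bar>C3\<bar> * (\<nu> * y\<^sup>2) < 1 / 4" "\<bar>\<nu> * (rho y - ln (y / 2) - 1)\<bar> < 1 / 4"
        using eventually_happens' trivial_limit_at_right_real by blast
      have "\<bar>\<Theta> \<nu> y - (\<nu> * ln (y / 2) + \<nu> - pi / 4)\<bar> \<le> C3 * (\<nu> * y\<^sup>2 + 1 / \<nu>)"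
        using branch(3)[OF \<nu>'(2) y(1)] y(2) by simp
      also have "\<dots> \<le> \<bar>C3\<bar> * (\<nu> * y\<^sup>2 + 1 / \<nu>)" using \<nu>'(5) by (intro mult_right_mono) auto
      also have "\<dots> = \<bar>C3\<bar> * (\<nu> * y\<^sup>2) + \<bar>C3\<bar> / \<nu>" by (simp add: distrib_left)
      also have "\<bar>C3\<bar> / \<nu> \<le> 1 / 8" using le \<nu>'(5) by (simp add: divide_le_eq)
      finally have b1: "\<bar>\<Theta> \<nu> y - (\<nu> * ln (y / 2) + \<nu> - pi / 4)\<bar> < 1 / 4 + 1 / 8" using y(3) by linarith
      have "\<bar>Im (cpoly (lg_phase M \<nu>) (lg_beta y))\<bar> \<le> norm (cpoly (lg_phase M \<nu>) (lg_beta y))" by (rule abs_Im_le_cmod)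
      also have "\<dots> \<le> C2 / \<nu>" by (rule C2(2)[OF \<nu>'(4) norm_lg_beta])
      also have "\<dots> \<le> 1 / 8" using le \<nu>'(5) by (simp add: divide_le_eq)
      finally have b2: "\<bar>Im (cpoly (lg_phase M \<nu>) (lg_beta y))\<bar> \<le> 1 / 8" .
      have "d y = (\<Theta> \<nu> y - (\<nu> * ln (y / 2) + \<nu> - pi / 4)) - \<nu> * (rho y - ln (y / 2) - 1) - Im (cpoly (lg_phase M \<nu>) (lg_beta y))"
        by (simp add: d_def lg_argument_def algebra_simps)
      then have "\<bar>d y\<bar> < 1" using b1 b2 y(4) by linarith
      then show ?thesis using that y(1) by blast
    qed
    have "\<bar>d x\<bar> \<le> 2 * (4 * (C / \<nu> ^ (M + 1)))"
    proof (rule phase_difference_bound[where d = d, OF _ x0 close _ x])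
      show "continuous_on {0<..} d"
        unfolding d_def by (intro continuous_intros cont \<nu>' continuous_on_lg_argument)
      show "4 * (C / \<nu> ^ (M + 1)) \<le> 1 / 2" using \<eta> by linarith
    qed
    then show ?thesis by (simp add: d_def)
  qed
  moreover have "\<nu>2 > 0" using C(2) by (auto simp: \<nu>2_def)
  ultimately show ?thesis by blast
qed

theorem theorem3p1:
  fixes \<Theta> :: "real \<Rightarrow> real \<Rightarrow> real"
  assumes "is_bessel_phase \<Theta>"
  shows "(\<forall>N. \<exists>C. \<exists>\<nu>0>0. \<forall>\<nu>\<ge>\<nu>0. \<forall>x>0. \<exists>\<epsilon>.
            \<bar>\<epsilon>\<bar> \<le> C / \<nu> ^ (2 * N + 2) \<and>
            bessel_modulus \<nu> x =
              1 / (sqrt (2 * pi * \<nu>) * (x\<^sup>2 + 1) powr (1 / 4)) *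
              exp (\<nu> * pi / 2 + (\<Sum>s = 1..N. E_hat (2 * s) (beta_hat x) / \<nu> ^ (2 * s)) + \<epsilon>)) \<and>
         (\<forall>N. \<exists>C. \<exists>\<nu>0>0. \<forall>\<nu>\<ge>\<nu>0. \<forall>x>0.
            \<bar>\<Theta> \<nu> x - (\<nu> * rho x - pi / 4 +
              (\<Sum>s<N. E_hat (2 * s + 1) (beta_hat x) / \<nu> ^ (2 * s + 1)))\<bar>
            \<le> C / \<nu> ^ (2 * N + 1))"
proof (intro conjI allI)
  fix N :: nat
  have "2 * N + 1 + 1 = 2 * N + 2" by simp
  then show "\<exists>C. \<exists>\<nu>0>0. \<forall>\<nu>\<ge>\<nu>0. \<forall>x>0. \<exists>\<epsilon>. \<bar>\<epsilon>\<bar> \<le> C / \<nu> ^ (2 * N + 2) \<and>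
      bessel_modulus \<nu> x = 1 / (sqrt (2 * pi * \<nu>) * (x\<^sup>2 + 1) powr (1 / 4)) *
        exp (\<nu> * pi / 2 + (\<Sum>s = 1..N. E_hat (2 * s) (beta_hat x) / \<nu> ^ (2 * s)) + \<epsilon>)"
    using bessel_modulus_expansion[of "2 * N + 1"]
    by (simp only: lg_amplitude_def Re_lg_phase exp_add mult.assoc)
next
  fix N
  show "\<exists>C. \<exists>\<nu>0>0. \<forall>\<nu>\<ge>\<nu>0. \<forall>x>0.
      \<bar>\<Theta> \<nu> x - (\<nu> * rho x - pi / 4 + (\<Sum>s<N. E_hat (2 * s + 1) (beta_hat x) / \<nu> ^ (2 * s + 1)))\<bar>
      \<le> C / \<nu> ^ (2 * N + 1)"
    using bessel_phase_expansion[OF assms, of "2 * N"] by (simp only: lg_argument_def Im_lg_phase)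
qed

end
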